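(* Let $p>-1$ and let $J_p$ be the Laguerre operator. For $t\neq0$ and a function $g$ on $\mathbb R_+$ with $g\in C_0^\infty(\mathbb R_+)$, let $$(U(t)g)_n=(-1)^n e^{in/t}\,|t|^{-1}\,g(n/t^2),\qquad n\in\mathbb Z_+ .$$ Suppose that $\Phi_pf\in C_0^\infty(\mathbb R_+)$. Then $$\lim_{t\to\pm\infty}\big\|e^{-iJ_pt}f-e^{\mp i(p+1)\pi/2}\,U(t)\Phi_pf\big\|=0 .$$
   Context: $\mathbb Z_+=\{0,1,2,\dots\}$, $\mathbb R_+=(0,\infty)$; $\|\cdot\|$ is the norm of $\ell^2(\mathbb Z_+)$; functions in $C_0^\infty(\mathbb R_+)$ are taken to be $0$ at the point $0$. For $p>-1$ put $a_n=\sqrt{(n+1)(n+1+p)}$, $b_n=2n+p+1$. The Laguerre operator $J_p$ acts in $\ell^2(\mathbb Z_+)$ by $(J_pf)_n=a_{n-1}f_{n-1}+b_nf_n+a_nf_{n+1}$, $a_{-1}=0$; it is essentially self-adjoint on the set $\mathcal D$ of sequences with finitely many non-zero components, and $J_p$ denotes its self-adjoint closure. The orthonormal Laguerre polynomials $L_n^{(p)}$ are defined by $a_{n-1}L_{n-1}^{(p)}(z)+b_nL_n^{(p)}(z)+a_nL_{n+1}^{(p)}(z)=zL_n^{(p)}(z)$, $L_{-1}^{(p)}=0$, $L_0^{(p)}=1$. Put $\tau_p(\lambda)=\Gamma(p+1)^{-1}\lambda^pe^{-\lambda}$ and $\varphi_n^{(p)}(\lambda)=\sqrt{\tau_p(\lambda)}\,L_n^{(p)}(\lambda)$,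 $\lambda\in\mathbb R_+$. The operator $\Phi_p:\ell^2(\mathbb Z_+)\to L^2(\mathbb R_+)$ is the unitary operator defined by $(\Phi_pf)(\lambda)=\sum_{n=0}^\infty\varphi_n^{(p)}(\lambda)f_n$ for $f\in\mathcal D$ (and extended by continuity). *)

theory Defs
  imports "HOL-Analysis.Analysis"
begin

section \<open>The sequence space l2 and operators in it\<close>

definition l2 :: "(nat \<Rightarrow> complex) set" where
  "l2 = {f. summable (\<lambda>n. (cmod (f n))\<^sup>2)}"

text \<open>Meaningful for members of \<open>l2\<close> only: \<open>suminf\<close> of a divergent series is a junk value.\<close>
definition l2_norm :: "(nat \<Rightarrow> complex) \<Rightarrow> real" where
  "l2_norm f = sqrt (\<Sum>n. (cmod (f n))\<^sup>2)"

definition l2_dist :: "(nat \<Rightarrow> complex) \<Rightarrow> (nat \<Rightarrow> complex) \<Rightarrow> real" where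
  "l2_dist f g = l2_norm (\<lambda>n. f n - g n)"

definition finite_seqs :: "(nat \<Rightarrow> complex) set" where
  "finite_seqs = {f. finite {n. f n \<noteq> 0}}"

text \<open>A possibly unbounded operator in \<open>l2\<close> is represented by its graph.\<close>
type_synonym l2_operator = "((nat \<Rightarrow> complex) \<times> (nat \<Rightarrow> complex)) set"

definition op_closure :: "l2_operator \<Rightarrow> l2_operator" where
  "op_closure H = {(f, g). f \<in> l2 \<and> g \<in> l2 \<and>
     (\<exists>u v. (\<forall>k. (u k, v k) \<in> H) \<and>
            (\<lambda>k. l2_dist (u k) f) \<longlonglongrightarrow> 0 \<and> (\<lambda>k. l2_dist (v k) g) \<longlonglongrightarrow> 0)}"

definition unitary_l2 :: "((nat \<Rightarrow> complex) \<Rightarrow> (nat \<Rightarrow> complex)) \<Rightarrow> bool" where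
  "unitary_l2 T \<longleftrightarrow>
     (\<forall>f\<in>l2. \<forall>g\<in>l2. \<forall>\<alpha> \<beta>.
        T (\<lambda>n. \<alpha> * f n + \<beta> * g n) = (\<lambda>n. \<alpha> * T f n + \<beta> * T g n)) \<and>
     T ` l2 = l2 \<and> (\<forall>f\<in>l2. l2_norm (T f) = l2_norm f)"

definition unitary_group :: "(real \<Rightarrow> (nat \<Rightarrow> complex) \<Rightarrow> (nat \<Rightarrow> complex)) \<Rightarrow> bool" where
  "unitary_group V \<longleftrightarrow>
     (\<forall>t. unitary_l2 (V t)) \<and>
     (\<forall>f\<in>l2. V 0 f = f) \<and>
     (\<forall>s t. \<forall>f\<in>l2. V (s + t) f = V s (V t f)) \<and>
     (\<forall>f\<in>l2. ((\<lambda>t. l2_dist (V t f) f) \<longlongrightarrow> 0) (at 0))"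

text \<open>The operator \<open>i V'(0)\<close>, with its maximal domain.\<close>
definition hamiltonian ::
    "(real \<Rightarrow> (nat \<Rightarrow> complex) \<Rightarrow> (nat \<Rightarrow> complex)) \<Rightarrow> l2_operator" where
  "hamiltonian V = {(f, g). f \<in> l2 \<and> g \<in> l2 \<and>
     ((\<lambda>t. l2_dist (\<lambda>n. \<i> * (V t f n - f n) / of_real t) g) \<longlongrightarrow> 0) (at 0)}"

text \<open>
  For self-adjoint \<open>H\<close>, \<open>exp_minus_i H t\<close> is the operator \<open>exp (- i H t)\<close>: by Stone's theorem
  there is exactly one strongly continuous unitary group whose generator is \<open>- i H\<close> (domains
  included). Operators on \<open>l2\<close> are made extensional functions to have literal uniqueness.
\<close>
definition exp_minus_i :: "l2_operator \<Rightarrow> real \<Rightarrow> (nat \<Rightarrow> complex) \<Rightarrow> (nat \<Rightarrow> complex)" where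
  "exp_minus_i H =
     (THE V. (\<forall>t. V t \<in> extensional l2) \<and> unitary_group V \<and> hamiltonian V = H)"

section \<open>The Laguerre operator\<close>

definition lag_a :: "real \<Rightarrow> nat \<Rightarrow> real" where
  "lag_a p n = sqrt ((real n + 1) * (real n + 1 + p))"

definition lag_b :: "real \<Rightarrow> nat \<Rightarrow> real" where
  "lag_b p n = 2 * real n + p + 1"

definition lag_action :: "real \<Rightarrow> (nat \<Rightarrow> complex) \<Rightarrow> (nat \<Rightarrow> complex)" where
  "lag_action p f n =
     (if n = 0 then 0 else of_real (lag_a p (n - 1)) * f (n - 1))
     + of_real (lag_b p n) * f n + of_real (lag_a p n) * f (n + 1)"

definition laguerre_op :: "real \<Rightarrow> l2_operator" where
  "laguerre_op p = op_closure {(f, lag_action p f) | f. f \<in> finite_seqs}"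

section \<open>Laguerre polynomials and the transform diagonalizing the Laguerre operator\<close>

text \<open>The three-term recurrence, solved for the term of highest index; see
  \<open>laguerre_recurrence\<close>.\<close>
fun laguerre :: "real \<Rightarrow> nat \<Rightarrow> real \<Rightarrow> real" where
  "laguerre p 0 z = 1"
| "laguerre p (Suc 0) z = (z - lag_b p 0) / lag_a p 0"
| "laguerre p (Suc (Suc n)) z =
     ((z - lag_b p (Suc n)) * laguerre p (Suc n) z - lag_a p n * laguerre p n z)
       / lag_a p (Suc n)"

lemma laguerre_recurrence:
  assumes "p > -1"
  shows "(if n = 0 then 0 else lag_a p (n - 1) * laguerre p (n - 1) z)
         + lag_b p n * laguerre p n z + lag_a p n * laguerre p (n + 1) z = z * laguerre p n z"
proof -
  have "lag_a p n > 0"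
    unfolding lag_a_def using assms by (intro real_sqrt_gt_zero mult_pos_pos) auto
  then show ?thesis
    by (cases n) (auto simp: field_simps)
qed

definition laguerre_weight :: "real \<Rightarrow> real \<Rightarrow> real" where
  "laguerre_weight p x = x powr p * exp (- x) / Gamma (p + 1)"

definition laguerre_fun :: "real \<Rightarrow> nat \<Rightarrow> real \<Rightarrow> real" where
  "laguerre_fun p n x = sqrt (laguerre_weight p x) * laguerre p n x"

text \<open>Elements of \<open>L\<^sup>2(0,\<infinity>)\<close> are represented by functions on the real line; their values
  outside \<open>(0,\<infinity>)\<close> are ignored.\<close>
definition L2_pos :: "(real \<Rightarrow> complex) set" where
  "L2_pos = {g. set_borel_measurable lborel {0<..} g \<and>
                set_integrable lborel {0<..} (\<lambda>x. (cmod (g x))\<^sup>2)}"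

definition L2_pos_dist :: "(real \<Rightarrow> complex) \<Rightarrow> (real \<Rightarrow> complex) \<Rightarrow> real" where
  "L2_pos_dist g h = sqrt (LINT x:{0<..}|lborel. (cmod (g x - h x))\<^sup>2)"

definition laguerre_transform_fin :: "real \<Rightarrow> (nat \<Rightarrow> complex) \<Rightarrow> real \<Rightarrow> complex" where
  "laguerre_transform_fin p f x = (\<Sum>n | f n \<noteq> 0. of_real (laguerre_fun p n x) * f n)"

text \<open>
  \<open>is_laguerre_transform p f g\<close> says that \<open>g\<close> represents \<open>\<Phi>\<^sub>p f\<close> in \<open>L\<^sup>2(0,\<infinity>)\<close>, where \<open>\<Phi>\<^sub>p\<close>
  is the extension by continuity of \<open>laguerre_transform_fin p\<close> from \<open>finite_seqs\<close>, which is
  dense in \<open>l2\<close>. It is a relation because \<open>g\<close> is determined only almost everywhere.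
\<close>
definition is_laguerre_transform ::
    "real \<Rightarrow> (nat \<Rightarrow> complex) \<Rightarrow> (real \<Rightarrow> complex) \<Rightarrow> bool" where
  "is_laguerre_transform p f g \<longleftrightarrow> f \<in> l2 \<and> g \<in> L2_pos \<and>
     (\<forall>u. (\<forall>k. u k \<in> finite_seqs) \<longrightarrow> (\<lambda>k. l2_dist (u k) f) \<longlonglongrightarrow> 0 \<longrightarrow>
        (\<lambda>k. L2_pos_dist (laguerre_transform_fin p (u k)) g) \<longlonglongrightarrow> 0)"

text \<open>Complex-valued test functions with compact support in \<open>(0,\<infinity>)\<close>, extended by \<open>0\<close> to the
  real line and in particular to the point \<open>0\<close>. The function \<open>D k\<close> is the \<open>k\<close>-th derivative.\<close>
definition test_fun_pos :: "(real \<Rightarrow> complex) \<Rightarrow> bool" where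
  "test_fun_pos g \<longleftrightarrow>
     (\<exists>D :: nat \<Rightarrow> real \<Rightarrow> complex. D 0 = g \<and>
        (\<forall>k x. (D k has_vector_derivative D (Suc k) x) (at x))) \<and>
     (\<exists>K. compact K \<and> K \<subseteq> {0<..} \<and> (\<forall>x. x \<notin> K \<longrightarrow> g x = 0))"

definition free_evol :: "real \<Rightarrow> (real \<Rightarrow> complex) \<Rightarrow> nat \<Rightarrow> complex" where
  "free_evol t g n =
     (-1) ^ n * exp (\<i> * of_real (real n / t)) * of_real (1 / \<bar>t\<bar>) * g (real n / t\<^sup>2)"

end

theory Submission
  imports Defs "HOL-Probability.Characteristic_Functions" "HOL-Real_Asymp.Real_Asymp"
begin

text \<open>
  The functions \<open>h\<^sub>s(\<lambda>) = \<lambda>\<^sup>p\<^sup>/\<^sup>2 exp (- s \<lambda>)\<close> have explicit Laguerre coefficients, even for complex \<open>s\<close> with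
  positive real part: with \<open>w = s + 1/2\<close>, the \<open>n\<close>-th one is \<open>w\<close> to the power \<open>- p - 1\<close> times
  \<open>(1/w - 1)\<^sup>n\<close>, up to a constant and a square root of a binomial coefficient (a coherent state of the
  discrete series of SU(1,1), for which \<open>J\<^sub>p\<close> is a parabolic generator). Multiplication by
  \<open>exp (- i t \<lambda>)\<close> replaces \<open>s\<close> by \<open>s + i t\<close>, which moves \<open>1/w - 1\<close> close to
  \<open>- exp ((i t - s) / t\<^sup>2)\<close>; inner products of coherent states are binomial series, and so the claim
  for \<open>h\<^sub>s\<close> is a computation of limits. By Weierstrass' theorem in the variable \<open>exp (- \<lambda>)\<close>, a test
  function is approximated by combinations of the \<open>h\<^sub>s\<close> uniformly with respect to the weight \<open>h\<^sub>1\<^sub>/\<^sub>4\<close>,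
  and both evolutions are bounded for this kind of approximation.

  The matrix elements of \<open>exp (- i J\<^sub>p t)\<close> are the integrals of \<open>exp (- i t \<lambda>) \<phi>\<^sub>m \<phi>\<^sub>n\<close>; the group law is
  Parseval's identity. That the generator is the closure of the Jacobi matrix on finite sequences
  follows because the off-diagonal entries grow only linearly.
\<close>

section \<open>Square-integrable functions\<close>

text \<open>\<open>free_evol\<close> samples its argument at the points n/t^2, so an error that is
  small in L2 need not stay small under it, and density of the functions \<open>hfun\<close> in L2
  would not suffice. The weight of the sup norm is therefore \<open>hfun p (1/4)\<close>, a function
  whose asymptotics is already known: the free evolution of an error is dominated by that of the
  weight, whose norm at late times is within 1 of an explicit bound.

  Closeness of coherent states is read off from inner products alone. Apart from the amplitudes
  these depend on t^2 (1 - cnj z w), and for all four pairs formed from the exact point and its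
  model this has the same limit 2 s, so expanding the squared norm of the difference gives 0. What
  remains is the mismatch between the root of the binomial coefficient and n^(p/2): their ratio
  tends to a constant, and the mass at each fixed n vanishes as t grows.

  Since \<open>exp_minus_i\<close> is given by \<open>THE\<close>, the candidate group must have the
  closure of the Jacobi matrix as its exact generator, domain included, and must be unique.\<close>

definition sq_int :: "'a measure \<Rightarrow> ('a \<Rightarrow> complex) set" where
  "sq_int M = {f. f \<in> borel_measurable M \<and> integrable M (\<lambda>x. (cmod (f x))\<^sup>2)}"

definition norm2 :: "'a measure \<Rightarrow> ('a \<Rightarrow> complex) \<Rightarrow> real" where
  "norm2 M f = sqrt (\<integral>x. (cmod (f x))\<^sup>2 \<partial>M)"

text \<open>Conjugate-linear in the first argument. The measure is a parameter so that one set of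
  lemmas serves both the sequence space (counting measure) and the half-line; functions are not
  identified almost everywhere.\<close>

definition ip :: "'a measure \<Rightarrow> ('a \<Rightarrow> complex) \<Rightarrow> ('a \<Rightarrow> complex) \<Rightarrow> complex" where
  "ip M f g = (\<integral>x. cnj (f x) * g x \<partial>M)"

lemma norm2_nonneg [simp]: "norm2 M f \<ge> 0"
  by (simp add: norm2_def)

lemma norm2_power2: "(norm2 M f)\<^sup>2 = (\<integral>x. (cmod (f x))\<^sup>2 \<partial>M)"
  by (simp add: norm2_def)

lemma sq_int_measurable: "f \<in> sq_int M \<Longrightarrow> f \<in> borel_measurable M"
  by (simp add: sq_int_def)

lemma sq_int_prod_integrable:
  assumes "f \<in> sq_int M" "g \<in> sq_int M"
  shows "integrable M (\<lambda>x. cmod (f x) * cmod (g x))"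
proof (rule Bochner_Integration.integrable_bound)
  show "integrable M (\<lambda>x. (cmod (f x))\<^sup>2 + (cmod (g x))\<^sup>2)"
    using assms by (auto simp: sq_int_def)
  show "AE x in M. norm (cmod (f x) * cmod (g x)) \<le> norm ((cmod (f x))\<^sup>2 + (cmod (g x))\<^sup>2)"
  proof (intro AE_I2)
    fix x
    have "0 \<le> (cmod (f x) - cmod (g x))\<^sup>2" by simp
    moreover have "0 \<le> cmod (f x) * cmod (g x)" by simp
    ultimately have "cmod (f x) * cmod (g x) \<le> (cmod (f x))\<^sup>2 + (cmod (g x))\<^sup>2"
      unfolding power2_diff by linarith
    then show "norm (cmod (f x) * cmod (g x)) \<le> norm ((cmod (f x))\<^sup>2 + (cmod (g x))\<^sup>2)"
      by (simp add: norm_mult)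
  qed
qed (use assms in \<open>auto simp: sq_int_def\<close>)

lemma borel_measurable_cnj [measurable (raw)]:
  "f \<in> borel_measurable M \<Longrightarrow> (\<lambda>x. cnj (f x)) \<in> borel_measurable M"
  by (rule measurable_compose[where g = cnj]) (auto intro!: borel_measurable_continuous_onI continuous_intros)

lemma sq_int_cnj_mult_integrable:
  assumes "f \<in> sq_int M" "g \<in> sq_int M"
  shows "integrable M (\<lambda>x. cnj (f x) * g x)"
  by (rule Bochner_Integration.integrable_bound[OF sq_int_prod_integrable[OF assms]])
     (use assms in \<open>auto simp: sq_int_def norm_mult\<close>)

lemma sq_int_scale: "f \<in> sq_int M \<Longrightarrow> (\<lambda>x. c * f x) \<in> sq_int M"
  by (auto simp: sq_int_def norm_mult power_mult_distrib)

lemma sq_int_zero: "(\<lambda>x. 0) \<in> sq_int M"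
  by (auto simp: sq_int_def)

lemma cmod_add_power2: "(cmod (a + b))\<^sup>2 = (cmod a)\<^sup>2 + 2 * Re (cnj a * b) + (cmod b)\<^sup>2"
  unfolding cmod_power2 by (simp add: power2_eq_square algebra_simps)

lemma sq_int_add:
  assumes "f \<in> sq_int M" "g \<in> sq_int M"
  shows "(\<lambda>x. f x + g x) \<in> sq_int M"
proof -
  have "integrable M (\<lambda>x. (cmod (f x))\<^sup>2 + 2 * Re (cnj (f x) * g x) + (cmod (g x))\<^sup>2)"
    using assms sq_int_cnj_mult_integrable[OF assms]
    by (intro Bochner_Integration.integrable_add integrable_mult_right integrable_Re)
       (auto simp: sq_int_def)
  then show ?thesis
    using assms by (auto simp: sq_int_def cmod_add_power2)
qed

lemma sq_int_diff:
  assumes "f \<in> sq_int M" "g \<in> sq_int M"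
  shows "(\<lambda>x. f x - g x) \<in> sq_int M"
  using sq_int_add[OF assms(1) sq_int_scale[OF assms(2), of "-1"]] by simp

lemma sq_int_sum:
  assumes "\<And>i. i \<in> I \<Longrightarrow> f i \<in> sq_int M"
  shows "(\<lambda>x. \<Sum>i\<in>I. f i x) \<in> sq_int M"
  using assms by (induction I rule: infinite_finite_induct) (auto intro: sq_int_add sq_int_zero)

text \<open>The form in which most norm bounds below are obtained: it turns weighted pointwise
  bounds on the half-line into L2 bounds, and componentwise bounds on sequences into bounds in
  \<open>l2\<close>.\<close>

lemma sq_int_dominated:
  assumes "g \<in> sq_int M" "f \<in> borel_measurable M" "\<And>x. x \<in> space M \<Longrightarrow> cmod (f x) \<le> C * cmod (g x)"
  shows "f \<in> sq_int M" "C \<ge> 0 \<Longrightarrow> norm2 M f \<le> C * norm2 M g"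
proof -
  have *: "(cmod (f x))\<^sup>2 \<le> C\<^sup>2 * (cmod (g x))\<^sup>2" if "x \<in> space M" for x
    using power_mono[OF assms(3)[OF that], of 2] by (simp add: power_mult_distrib)
  have int: "integrable M (\<lambda>x. C\<^sup>2 * (cmod (g x))\<^sup>2)"
    using assms by (auto simp: sq_int_def)
  show f: "f \<in> sq_int M"
    unfolding sq_int_def mem_Collect_eq
  proof (intro conjI Bochner_Integration.integrable_bound[OF int] AE_I2)
    show "(\<lambda>x. (cmod (f x))\<^sup>2) \<in> borel_measurable M" using assms(2) by measurable
  qed (use * assms(2) in auto)
  assume "C \<ge> 0"
  have "(\<integral>x. (cmod (f x))\<^sup>2 \<partial>M) \<le> (\<integral>x. C\<^sup>2 * (cmod (g x))\<^sup>2 \<partial>M)"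
    using f int * by (intro integral_mono) (auto simp: sq_int_def)
  then show "norm2 M f \<le> C * norm2 M g"
    using \<open>C \<ge> 0\<close> by (intro power2_le_imp_le[OF _ mult_nonneg_nonneg]) (simp_all add: norm2_power2 power_mult_distrib)
qed

lemma norm2_scale: "norm2 M (\<lambda>x. c * f x) = cmod c * norm2 M f"
  by (simp add: norm2_def norm_mult power_mult_distrib real_sqrt_mult)

lemma norm2_minus_commute: "norm2 M (\<lambda>x. f x - g x) = norm2 M (\<lambda>x. g x - f x)"
  by (simp add: norm2_def norm_minus_commute)

lemma norm2_zero [simp]: "norm2 M (\<lambda>x. 0) = 0"
  by (simp add: norm2_def)

lemma cmod_ip_le:
  assumes "f \<in> sq_int M" "g \<in> sq_int M"
  shows "cmod (ip M f g) \<le> norm2 M f * norm2 M g"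
proof -
  note int = sq_int_prod_integrable[OF assms] 
  have I: "integrable M (\<lambda>x. (cmod (f x))\<^sup>2)" "integrable M (\<lambda>x. (cmod (g x))\<^sup>2)"
    using assms by (auto simp: sq_int_def)
  have "cmod (ip M f g) \<le> (\<integral>x. cmod (f x) * cmod (g x) \<partial>M)"
    unfolding ip_def by (rule order_trans[OF integral_norm_bound]) (simp add: norm_mult)
  also have "\<dots> \<le> norm2 M f * norm2 M g"
  proof (cases "norm2 M f = 0 \<or> norm2 M g = 0")
    case True
    then have "(AE x in M. f x = 0) \<or> (AE x in M. g x = 0)"
      using integral_nonneg_eq_0_iff_AE[OF I(1)] integral_nonneg_eq_0_iff_AE[OF I(2)]
      by (auto simp: norm2_def)
    then have "AE x in M. cmod (f x) * cmod (g x) = 0"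
      by (auto elim: eventually_mono)
    then have "(\<integral>x. cmod (f x) * cmod (g x) \<partial>M) = 0"
      by (rule integral_eq_zero_AE)
    then show ?thesis by simp
  next
    case False
    then have pos: "norm2 M f > 0" "norm2 M g > 0"
      using norm2_nonneg[of M f] norm2_nonneg[of M g] by linarith+
    \<comment> \<open>The weight that makes Young's inequality a b <= c/2 a^2 + b^2/(2 c) sharp
      after integration: each term then contributes half of the product of the norms.\<close>
    define c where "c = norm2 M g / norm2 M f"
    have c: "c > 0" using pos by (simp add: c_def)
    have "cmod (f x) * cmod (g x) \<le> c / 2 * (cmod (f x))\<^sup>2 + 1 / (2 * c) * (cmod (g x))\<^sup>2" for x
    proof -
      have "0 \<le> (c * cmod (f x) - cmod (g x))\<^sup>2 / (2 * c)" using c by simp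
      then show ?thesis using c by (simp add: power2_eq_square field_simps)
    qed
    then have "(\<integral>x. cmod (f x) * cmod (g x) \<partial>M)
        \<le> (\<integral>x. c / 2 * (cmod (f x))\<^sup>2 + 1 / (2 * c) * (cmod (g x))\<^sup>2 \<partial>M)"
      using I int by (intro integral_mono) auto
    also have "\<dots> = c / 2 * (norm2 M f)\<^sup>2 + 1 / (2 * c) * (norm2 M g)\<^sup>2"
      using I by (subst Bochner_Integration.integral_add) (auto simp: norm2_power2)
    also have "\<dots> = norm2 M f * norm2 M g"
      using pos by (simp add: c_def power2_eq_square field_simps)
    finally show ?thesis .
  qed
  finally show ?thesis .
qed

lemma norm2_add_power2:
  assumes "f \<in> sq_int M" "g \<in> sq_int M"
  shows "(norm2 M (\<lambda>x. f x + g x))\<^sup>2 = (norm2 M f)\<^sup>2 + 2 * Re (ip M f g) + (norm2 M g)\<^sup>2"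
proof -
  note c = sq_int_cnj_mult_integrable[OF assms]
  have "(norm2 M (\<lambda>x. f x + g x))\<^sup>2
      = (\<integral>x. (cmod (f x))\<^sup>2 + 2 * Re (cnj (f x) * g x) + (cmod (g x))\<^sup>2 \<partial>M)"
    by (simp only: norm2_power2 cmod_add_power2)
  also have "\<dots> = (norm2 M f)\<^sup>2 + 2 * (\<integral>x. Re (cnj (f x) * g x) \<partial>M) + (norm2 M g)\<^sup>2"
    using assms c
    by (subst Bochner_Integration.integral_add)
       (auto simp: sq_int_def norm2_power2 simp del: times_complex.sel)
  also have "(\<integral>x. Re (cnj (f x) * g x) \<partial>M) = Re (ip M f g)"
    unfolding ip_def by (rule integral_Re[OF c])
  finally show ?thesis .
qed

lemma norm2_triangle:
  assumes "f \<in> sq_int M" "g \<in> sq_int M"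
  shows "norm2 M (\<lambda>x. f x + g x) \<le> norm2 M f + norm2 M g"
proof (rule power2_le_imp_le)
  have "Re (ip M f g) \<le> norm2 M f * norm2 M g"
    using complex_Re_le_cmod cmod_ip_le[OF assms] order_trans by blast
  then show "(norm2 M (\<lambda>x. f x + g x))\<^sup>2 \<le> (norm2 M f + norm2 M g)\<^sup>2"
    unfolding norm2_add_power2[OF assms] by (simp add: power2_sum)
qed simp

lemma norm2_triangle_diff:
  assumes "f \<in> sq_int M" "g \<in> sq_int M" "h \<in> sq_int M"
  shows "norm2 M (\<lambda>x. f x - h x) \<le> norm2 M (\<lambda>x. f x - g x) + norm2 M (\<lambda>x. g x - h x)"
  using norm2_triangle[OF sq_int_diff[OF assms(1,2)] sq_int_diff[OF assms(2,3)]] by simp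

lemma norm2_le_diff:
  assumes "f \<in> sq_int M" "g \<in> sq_int M"
  shows "norm2 M f \<le> norm2 M g + norm2 M (\<lambda>x. f x - g x)"
  using norm2_triangle[OF assms(2) sq_int_diff[OF assms]] by simp

lemma ip_add_right:
  assumes "f \<in> sq_int M" "g \<in> sq_int M" "h \<in> sq_int M"
  shows "ip M f (\<lambda>x. g x + h x) = ip M f g + ip M f h"
  using assms by (simp add: ip_def distrib_left sq_int_cnj_mult_integrable)

lemma ip_diff_right:
  assumes "f \<in> sq_int M" "g \<in> sq_int M" "h \<in> sq_int M"
  shows "ip M f (\<lambda>x. g x - h x) = ip M f g - ip M f h"
  using assms by (simp add: ip_def right_diff_distrib sq_int_cnj_mult_integrable)

lemma ip_scale_right: "ip M f (\<lambda>x. c * g x) = c * ip M f g"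
proof -
  have "(\<lambda>x. cnj (f x) * (c * g x)) = (\<lambda>x. c * (cnj (f x) * g x))" by (simp add: mult_ac)
  then show ?thesis by (simp add: ip_def)
qed

lemma ip_scale_left: "ip M (\<lambda>x. c * f x) g = cnj c * ip M f g"
  by (simp add: ip_def mult.assoc)

lemma ip_cnj: "ip M f g = cnj (ip M g f)"
proof -
  have "cnj (ip M g f) = (\<integral>x. cnj (cnj (g x) * f x) \<partial>M)"
    unfolding ip_def by (rule Bochner_Integration.integral_cnj[symmetric])
  then show ?thesis by (simp add: ip_def mult.commute)
qed

lemma ip_sum_right:
  assumes "f \<in> sq_int M" "\<And>i. i \<in> I \<Longrightarrow> g i \<in> sq_int M"
  shows "ip M f (\<lambda>x. \<Sum>i\<in>I. g i x) = (\<Sum>i\<in>I. ip M f (g i))"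
  using assms by (simp add: ip_def sum_distrib_left sq_int_cnj_mult_integrable)

lemma ip_self: "ip M f f = of_real ((norm2 M f)\<^sup>2)"
proof -
  have "cnj (f x) * f x = of_real ((cmod (f x))\<^sup>2)" for x
    by (metis complex_norm_square mult.commute)
  then show ?thesis by (simp only: ip_def norm2_power2 integral_complex_of_real)
qed

subsection \<open>The sequence space\<close>

abbreviation NN :: "nat measure" where "NN \<equiv> count_space UNIV"

lemma l2_eq_sq_int: "l2 = sq_int NN"
  by (auto simp: l2_def sq_int_def integrable_count_space_nat_iff)

lemma l2_norm_eq: "f \<in> l2 \<Longrightarrow> l2_norm f = norm2 NN f"
  by (simp add: l2_def l2_norm_def norm2_def integral_count_space_nat integrable_count_space_nat_iff)

lemma l2_dist_eq: "f \<in> l2 \<Longrightarrow> g \<in> l2 \<Longrightarrow> l2_dist f g = norm2 NN (\<lambda>n. f n - g n)"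
  unfolding l2_dist_def by (rule l2_norm_eq) (simp add: l2_eq_sq_int sq_int_diff)

lemma norm2_NN: "f \<in> l2 \<Longrightarrow> (\<lambda>n. (cmod (f n))\<^sup>2) sums (norm2 NN f)\<^sup>2"
  unfolding norm2_power2 by (rule sums_integral_count_space_nat)
    (simp add: l2_def integrable_count_space_nat_iff)

lemma ip_NN_sums: "f \<in> l2 \<Longrightarrow> g \<in> l2 \<Longrightarrow> (\<lambda>n. cnj (f n) * g n) sums ip NN f g"
  unfolding ip_def by (rule sums_integral_count_space_nat)
    (simp add: l2_eq_sq_int sq_int_cnj_mult_integrable)

lemma l2_sumsI:
  assumes "(\<lambda>n. (cmod (f n))\<^sup>2) sums S"
  shows "f \<in> l2" "(norm2 NN f)\<^sup>2 = S"
proof -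
  show "f \<in> l2" using assms by (auto simp: l2_def sums_iff)
  from norm2_NN[OF this] assms show "(norm2 NN f)\<^sup>2 = S" by (metis sums_unique2)
qed

lemma l2_partial_sums_le:
  assumes "\<And>N. (\<Sum>n<N. (cmod (f n))\<^sup>2) \<le> C\<^sup>2" "C \<ge> 0"
  shows "f \<in> l2" "norm2 NN f \<le> C"
proof -
  show f: "f \<in> l2" unfolding l2_def mem_Collect_eq
    by (rule summableI_nonneg_bounded[where x = "C\<^sup>2"]) (use assms in auto)
  have "(norm2 NN f)\<^sup>2 \<le> C\<^sup>2"
    using norm2_NN[OF f] assms(1) by (auto simp: sums_def intro: LIMSEQ_le_const2)
  then show "norm2 NN f \<le> C" using assms(2) by (rule power2_le_imp_le)
qed

lemma l2_partial_sum_le: "f \<in> l2 \<Longrightarrow> (\<Sum>n<N. (cmod (f n))\<^sup>2) \<le> (norm2 NN f)\<^sup>2"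
  using norm2_NN[of f] sum_le_suminf[of "\<lambda>n. (cmod (f n))\<^sup>2" "{..<N}"] by (auto simp: sums_iff)

lemma cmod_le_norm2_NN:
  assumes "f \<in> l2" shows "cmod (f n) \<le> norm2 NN f"
proof (rule power2_le_imp_le)
  have "(cmod (f n))\<^sup>2 \<le> (\<Sum>k<Suc n. (cmod (f k))\<^sup>2)" by (simp add: sum_nonneg)
  also have "\<dots> \<le> (norm2 NN f)\<^sup>2" using assms by (rule l2_partial_sum_le)
  finally show "(cmod (f n))\<^sup>2 \<le> (norm2 NN f)\<^sup>2" .
qed simp

definition trunc :: "nat \<Rightarrow> (nat \<Rightarrow> complex) \<Rightarrow> nat \<Rightarrow> complex" where
  "trunc N f n = (if n < N then f n else 0)"

lemma trunc_finite_seqs: "trunc N f \<in> finite_seqs"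
  by (auto simp: finite_seqs_def trunc_def intro: finite_subset[of _ "{..<N}"] split: if_splits)

lemma finite_seqsE:
  assumes "u \<in> finite_seqs" obtains N where "\<And>n. n \<ge> N \<Longrightarrow> u n = 0" "trunc N u = u"
proof -
  obtain N where "\<forall>n\<in>{n. u n \<noteq> 0}. n < N"
    using assms finite_nat_set_iff_bounded by (auto simp: finite_seqs_def)
  then show ?thesis by (intro that[of N]) (auto simp: trunc_def fun_eq_iff)
qed

lemma finite_seqsI: "(\<And>n. n \<ge> N \<Longrightarrow> u n = 0) \<Longrightarrow> u \<in> finite_seqs"
  by (auto simp: finite_seqs_def intro!: finite_subset[of _ "{..<N}"] intro: not_le_imp_less)

lemma norm2_finite_seq:
  assumes "\<And>n. n \<ge> N \<Longrightarrow> u n = 0"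
  shows "u \<in> l2" "(norm2 NN u)\<^sup>2 = (\<Sum>n<N. (cmod (u n))\<^sup>2)"
proof -
  have "(\<lambda>n. (cmod (u n))\<^sup>2) sums (\<Sum>n<N. (cmod (u n))\<^sup>2)"
    by (rule sums_finite) (use assms in \<open>auto simp: not_less\<close>)
  from l2_sumsI[OF this] show "u \<in> l2" "(norm2 NN u)\<^sup>2 = (\<Sum>n<N. (cmod (u n))\<^sup>2)" by auto
qed

lemma finite_seqs_l2: "u \<in> finite_seqs \<Longrightarrow> u \<in> l2"
  by (metis finite_seqsE norm2_finite_seq(1))

lemma trunc_l2: "trunc N f \<in> l2"
  by (rule finite_seqs_l2[OF trunc_finite_seqs])

lemma norm2_trunc: "(norm2 NN (trunc N f))\<^sup>2 = (\<Sum>n<N. (cmod (f n))\<^sup>2)"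
  by (subst norm2_finite_seq(2)[of N]) (auto simp: trunc_def)

lemma norm2_trunc_le: "f \<in> l2 \<Longrightarrow> norm2 NN (trunc N f) \<le> norm2 NN f"
  by (rule power2_le_imp_le) (auto simp: norm2_trunc l2_partial_sum_le)

lemma norm2_sub_trunc:
  assumes "f \<in> l2"
  shows "(norm2 NN (\<lambda>n. f n - trunc N f n))\<^sup>2 = (norm2 NN f)\<^sup>2 - (\<Sum>n<N. (cmod (f n))\<^sup>2)"
proof -
  have "(\<lambda>n. (cmod (f n))\<^sup>2 - (cmod (trunc N f n))\<^sup>2) sums ((norm2 NN f)\<^sup>2 - (norm2 NN (trunc N f))\<^sup>2)"
    by (intro sums_diff norm2_NN assms trunc_l2)
  also have "(\<lambda>n. (cmod (f n))\<^sup>2 - (cmod (trunc N f n))\<^sup>2) = (\<lambda>n. (cmod (f n - trunc N f n))\<^sup>2)"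
    by (auto simp: trunc_def)
  finally show ?thesis using l2_sumsI(2) by (simp add: norm2_trunc)
qed

lemma tendsto_of_power2:
  fixes a :: "'b \<Rightarrow> real"
  assumes "((\<lambda>x. (a x)\<^sup>2) \<longlongrightarrow> 0) F" "\<And>x. a x \<ge> 0"
  shows "(a \<longlongrightarrow> 0) F"
  using tendsto_real_sqrt[OF assms(1)] assms(2) by simp

lemma trunc_tendsto:
  assumes "f \<in> l2"
  shows "(\<lambda>N. norm2 NN (\<lambda>n. f n - trunc N f n)) \<longlonglongrightarrow> 0"
proof (rule tendsto_of_power2)
  have "(\<lambda>N. (norm2 NN f)\<^sup>2 - (\<Sum>n<N. (cmod (f n))\<^sup>2)) \<longlonglongrightarrow> (norm2 NN f)\<^sup>2 - (norm2 NN f)\<^sup>2"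
    using norm2_NN[OF assms] by (intro tendsto_intros) (simp add: sums_def)
  then show "(\<lambda>N. (norm2 NN (\<lambda>n. f n - trunc N f n))\<^sup>2) \<longlonglongrightarrow> 0"
    by (simp add: norm2_sub_trunc[OF assms])
qed simp

section \<open>Integrals over the half-line\<close>

abbreviation PP :: "real measure" where "PP \<equiv> restrict_space lborel {0<..}"

lemma space_PP [simp]: "space PP = {0<..}"
  by (simp add: space_restrict_space)

lemma measurable_PP: "f \<in> borel_measurable borel \<Longrightarrow> f \<in> borel_measurable PP"
  by (rule measurable_restrict_space1) simp

lemma AE_PP_I: "(\<And>x. x > 0 \<Longrightarrow> Q x) \<Longrightarrow> AE x in PP. Q x"
  by (rule AE_I2) simp

lemma L2_pos_eq_sq_int: "L2_pos = sq_int PP"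
proof -
  have "g \<in> borel_measurable PP \<longleftrightarrow> set_borel_measurable lborel {0<..} g" for g :: "real \<Rightarrow> complex"
    by (simp add: borel_measurable_restrict_space_iff set_borel_measurable_def)
  moreover have "integrable PP f \<longleftrightarrow> set_integrable lborel {0<..} f" for f :: "real \<Rightarrow> real"
    by (simp add: integrable_restrict_space set_integrable_def)
  ultimately show ?thesis by (auto simp: L2_pos_def sq_int_def)
qed

lemma L2_pos_dist_eq: "L2_pos_dist f g = norm2 PP (\<lambda>x. f x - g x)"
  by (simp add: L2_pos_dist_def norm2_def integral_restrict_space set_lebesgue_integral_def)

lemma has_bochner_integral_PP_iff:
  fixes f :: "real \<Rightarrow> 'a::{banach, second_countable_topology}"
  shows "has_bochner_integral PP f I \<longleftrightarrow> has_bochner_integral lborel (\<lambda>x. indicator {0<..} x *\<^sub>R f x) I"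
  by (simp add: has_bochner_integral_iff integrable_restrict_space integral_restrict_space)

section \<open>Gamma integrals with real and complex rates\<close>

lemma has_bochner_integral_gamma:
  fixes q a :: real
  assumes q: "q > -1" and a: "a > 0"
  shows "has_bochner_integral PP (\<lambda>x. x powr q * exp (- a * x)) (Gamma (q + 1) * a powr (- (q + 1)))"
proof -
  have nn: "(\<integral>\<^sup>+x. ennreal (indicator {0..} x * (x powr q * exp (- x))) \<partial>lborel) = ennreal (Gamma (q + 1))"
  proof (rule nn_integral_has_integral_lborel)
    have "((\<lambda>x. x powr q * exp (- x)) has_integral Gamma (q + 1)) {0..}"
      using Gamma_integral_real[of "q + 1"] q by (simp add: exp_minus divide_inverse)
    then have "((\<lambda>x. if x \<in> {0..} then x powr q * exp (- x) else 0) has_integral Gamma (q + 1)) UNIV"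
      by (simp only: has_integral_restrict_UNIV)
    also have "(\<lambda>x. if x \<in> {0..} then x powr q * exp (- x) else 0)
        = (\<lambda>x. indicator {0..} x * (x powr q * exp (- x)))"
      by (auto simp: indicator_def)
    finally show "((\<lambda>x. indicator {0..} x * (x powr q * exp (- x))) has_integral Gamma (q + 1)) UNIV" .
  qed auto
  have "has_bochner_integral lborel (\<lambda>x. indicator {0..} x * (x powr q * exp (- x))) (Gamma (q + 1))"
    using q by (intro has_bochner_integral_nn_integral[OF _ _ _ nn]) (auto intro: Gamma_real_pos less_imp_le)
  then have "has_bochner_integral lborel
      (\<lambda>x. indicator {0..} (0 + a * x) * ((0 + a * x) powr q * exp (- (0 + a * x)))) (Gamma (q + 1) /\<^sub>R \<bar>a\<bar>)"
    using a by (subst (asm) lborel_has_bochner_integral_real_affine_iff[where c = a and t = 0]) auto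
  then have "has_bochner_integral lborel
      (\<lambda>x. a powr q * (indicator {0..} (a * x) * (x powr q * exp (- (a * x))))) (Gamma (q + 1) / a)"
    using a by (elim has_bochner_integral_cong[THEN iffD1, rotated -1])
      (auto simp: powr_mult indicator_def zero_le_mult_iff divide_inverse)
  then have "has_bochner_integral lborel
      (\<lambda>x. a powr (- q) * (a powr q * (indicator {0..} (a * x) * (x powr q * exp (- (a * x))))))
      (a powr (- q) * (Gamma (q + 1) / a))"
    by (intro has_bochner_integral_mult_right) auto
  \<comment> \<open>Closed and open half-line give the same function, because
    \<open>0 powr q\<close> is 0.\<close>
  also have "(\<lambda>x. a powr (- q) * (a powr q * (indicator {0..} (a * x) * (x powr q * exp (- (a * x))))))
      = (\<lambda>x. indicator {0<..} x *\<^sub>R (x powr q * exp (- a * x)))"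
    using a by (auto simp: powr_minus indicator_def zero_le_mult_iff fun_eq_iff)
  also have "a powr (- q) * (Gamma (q + 1) / a) = Gamma (q + 1) * a powr (- (q + 1))"
    using a by (simp add: powr_diff powr_minus divide_simps)
  finally show ?thesis by (simp add: has_bochner_integral_PP_iff)
qed

lemma gamma_integrable: "q > -1 \<Longrightarrow> a > 0 \<Longrightarrow> integrable PP (\<lambda>x. x powr q * exp (- a * x))" for q a :: real
  using has_bochner_integral_gamma has_bochner_integral_iff by blast

lemma cmod_exp_ix: "cmod (exp (- \<i> * of_real t * of_real x)) = 1"
  by simp

lemma exp_ix_approx: "cmod (exp (- \<i> * of_real x) - 1 + \<i> * of_real x) \<le> x\<^sup>2 / 2"
  using iexp_approx1[of "-x" 1] by (simp add: power2_eq_square numeral_2_eq_2 algebra_simps)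

lemma exp_ix_approx0: "cmod (exp (- \<i> * of_real x) - 1) \<le> \<bar>x\<bar>"
  using iexp_approx1[of "-x" 0] by simp

text \<open>The Taylor remainder of the exponential is at most (h x)^2/2 for every x, so the second
  moment of \<open>F\<close> bounds the error of the linear approximation by a multiple of h^2; no
  limit theorem for integrals enters. The first moment exists because x <= 1 + x^2.\<close>

lemma fourier_has_vector_derivative:
  fixes F :: "real \<Rightarrow> complex"
  assumes F: "integrable PP F" and F2: "integrable PP (\<lambda>x. of_real (x\<^sup>2) * F x)"
  shows "((\<lambda>t. \<integral>x. exp (- \<i> * of_real t * of_real x) * F x \<partial>PP) has_vector_derivative
           - \<i> * (\<integral>x. exp (- \<i> * of_real t * of_real x) * (of_real x * F x) \<partial>PP)) (at t)"
proof -
  have [measurable]: "F \<in> borel_measurable PP" using F by auto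
  have [measurable]: "(\<lambda>x. x) \<in> borel_measurable PP" by (rule measurable_PP) simp
  have F1: "integrable PP (\<lambda>x. of_real x * F x)"
  proof (rule Bochner_Integration.integrable_bound)
    show "integrable PP (\<lambda>x. cmod (F x) + cmod (of_real (x\<^sup>2) * F x))" using F F2 by auto
    show "AE x in PP. norm (of_real x * F x) \<le> norm (cmod (F x) + cmod (of_real (x\<^sup>2) * F x))"
    proof (rule AE_PP_I)
      fix x :: real assume "x > 0"
      have "x \<le> 1 + x\<^sup>2" using sum_squares_ge_zero[of "x - 1" x] zero_le_power2[of "x - 1"]
        by (simp add: power2_eq_square algebra_simps)
      then have "x * cmod (F x) \<le> (1 + x\<^sup>2) * cmod (F x)" by (rule mult_right_mono) simp
      then have "x * cmod (F x) \<le> cmod (F x) + x\<^sup>2 * cmod (F x)" by (simp add: distrib_right)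
      then show "norm (of_real x * F x) \<le> norm (cmod (F x) + cmod (of_real (x\<^sup>2) * F x))"
        using \<open>x > 0\<close> by (simp add: norm_mult norm_power)
    qed
    show "(\<lambda>x. of_real x * F x) \<in> borel_measurable PP" by measurable
  qed
  have eb: "integrable PP (\<lambda>x. exp (- \<i> * of_real s * of_real x) * G x)"
    if "integrable PP G" for s and G :: "real \<Rightarrow> complex"
    by (rule Bochner_Integration.integrable_bound[OF that]) (use that in \<open>auto simp: norm_mult\<close>)
  define K where "K = (\<integral>x. x\<^sup>2 * cmod (F x) \<partial>PP)"
  have K: "integrable PP (\<lambda>x. x\<^sup>2 * cmod (F x))"
    using integrable_norm[OF F2] by (simp add: norm_mult norm_power)
  define I where "I = (\<lambda>t. \<integral>x. exp (- \<i> * of_real t * of_real x) * F x \<partial>PP)"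
  define I' where "I' = - \<i> * (\<integral>x. exp (- \<i> * of_real t * of_real x) * (of_real x * F x) \<partial>PP)"
  have bound: "cmod (I (t + h) - I t - of_real h * I') \<le> h\<^sup>2 / 2 * K" for h
  proof -
    define d where "d = (\<lambda>x. exp (- \<i> * of_real (t + h) * of_real x) * F x - exp (- \<i> * of_real t * of_real x) * F x
        - (of_real h * - \<i>) * (exp (- \<i> * of_real t * of_real x) * (of_real x * F x)))"
    have *: "I (t + h) - I t - of_real h * I' = (\<integral>x. d x \<partial>PP)"
      unfolding I_def I'_def d_def mult.assoc[of "of_real h" "- \<i>", symmetric]
      by (rule has_bochner_integral_integral_eq[symmetric], rule has_bochner_integral_diff,
          rule has_bochner_integral_diff, rule has_bochner_integral_integrable[OF eb[OF F]],
          rule has_bochner_integral_integrable[OF eb[OF F]], rule has_bochner_integral_mult_right,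
          rule has_bochner_integral_integrable[OF eb[OF F1]])
    have d_le: "cmod (d x) \<le> h\<^sup>2 / 2 * (x\<^sup>2 * cmod (F x))" for x
    proof -
      have e: "exp (- \<i> * of_real (t + h) * of_real x) = exp (- \<i> * of_real t * of_real x) * exp (- \<i> * of_real (h * x))"
        unfolding exp_add[symmetric] by (simp add: algebra_simps)
      have "d x = exp (- \<i> * of_real t * of_real x) * (exp (- \<i> * of_real (h * x)) - 1 + \<i> * of_real (h * x)) * F x"
        unfolding d_def e by (simp add: algebra_simps)
      then have "cmod (d x) = cmod (exp (- \<i> * of_real (h * x)) - 1 + \<i> * of_real (h * x)) * cmod (F x)"
        by (simp only: norm_mult cmod_exp_ix mult_1_left)
      also have "\<dots> \<le> (h * x)\<^sup>2 / 2 * cmod (F x)"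
        by (intro mult_right_mono exp_ix_approx) simp
      finally show ?thesis by (simp add: power_mult_distrib)
    qed
    have "cmod (I (t + h) - I t - of_real h * I') \<le> (\<integral>x. h\<^sup>2 / 2 * (x\<^sup>2 * cmod (F x)) \<partial>PP)"
      unfolding *
    proof (rule order_trans[OF integral_norm_bound], rule integral_mono_AE)
      show "integrable PP (\<lambda>x. cmod (d x))" unfolding d_def
        by (rule integrable_norm, rule Bochner_Integration.integrable_diff, rule Bochner_Integration.integrable_diff,
            rule eb[OF F], rule eb[OF F], rule integrable_mult_right, rule eb[OF F1])
      show "integrable PP (\<lambda>x. h\<^sup>2 / 2 * (x\<^sup>2 * cmod (F x)))" using K by auto
      show "AE x in PP. cmod (d x) \<le> h\<^sup>2 / 2 * (x\<^sup>2 * cmod (F x))" by (rule AE_PP_I) (rule d_le)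
    qed
    also have "\<dots> = h\<^sup>2 / 2 * K" by (simp add: K_def)
    finally show ?thesis .
  qed
  have "(I has_vector_derivative I') (at t)"
    unfolding has_vector_derivative_def has_derivative_at
  proof (intro conjI bounded_linear_scaleR_left)
    show "(\<lambda>h. norm (I (t + h) - I t - h *\<^sub>R I') / norm h) \<midarrow>0\<rightarrow> 0"
    proof (rule tendsto_sandwich[OF _ _ tendsto_const])
      show "\<forall>\<^sub>F h in at 0. 0 \<le> norm (I (t + h) - I t - h *\<^sub>R I') / norm h" by simp
      show "\<forall>\<^sub>F h in at 0. norm (I (t + h) - I t - h *\<^sub>R I') / norm h \<le> \<bar>h\<bar> / 2 * K"
      proof (intro always_eventually allI)
        fix h :: real
        have eq: "h\<^sup>2 / 2 * K = \<bar>h\<bar> / 2 * K * \<bar>h\<bar>" by (simp add: power2_eq_square)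
        show "norm (I (t + h) - I t - h *\<^sub>R I') / norm h \<le> \<bar>h\<bar> / 2 * K"
          using bound[of h] unfolding eq
          by (cases "h = 0") (simp_all add: scaleR_conv_of_real divide_le_eq)
      qed
      have "((\<lambda>h. \<bar>h\<bar> / 2 * K) \<longlongrightarrow> \<bar>0\<bar> / 2 * K) (at 0)" by (intro tendsto_intros) auto
      then show "((\<lambda>h. \<bar>h\<bar> / 2 * K) \<longlongrightarrow> 0) (at 0)" by simp
    qed
  qed
  then show ?thesis unfolding I_def I'_def .
qed

lemma complex_gamma_integrable:
  fixes q a t :: real
  assumes q: "q > -1" and a: "a > 0"
  shows "integrable PP (\<lambda>x. exp (- \<i> * of_real t * of_real x) * of_real (x powr q * exp (- a * x)))"
proof (rule Bochner_Integration.integrable_bound[OF gamma_integrable[OF q a]])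
  show "(\<lambda>x. exp (- \<i> * of_real t * of_real x) * of_real (x powr q * exp (- a * x))) \<in> borel_measurable PP"
    by (rule measurable_PP) measurable
qed (auto simp: norm_mult)

text \<open>Integration by parts: the integral of the derivative of x^(q+1) exp(- w x), with w = a +
  i t, is 0, since this function vanishes at 0 (as q + 1 > 0) and at infinity (as a > 0).\<close>

lemma complex_gamma_recurrence:
  fixes q a t :: real
  assumes q: "q > -1" and a: "a > 0"
  shows "(of_real a + \<i> * of_real t) *
           (\<integral>x. exp (- \<i> * of_real t * of_real x) * of_real (x powr (q + 1) * exp (- a * x)) \<partial>PP)
       = of_real (q + 1) * (\<integral>x. exp (- \<i> * of_real t * of_real x) * of_real (x powr q * exp (- a * x)) \<partial>PP)"
proof -
  define w where "w = of_real a + \<i> * of_real t"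
  define F where "F = (\<lambda>x::real. of_real (x powr (q + 1)) * exp (- w * of_real x))"
  define f where "f = (\<lambda>x::real. of_real ((q + 1) * x powr q) * exp (- w * of_real x)
                         - w * (of_real (x powr (q + 1)) * exp (- w * of_real x)))"
  have e: "exp (- \<i> * of_real t * of_real x) * of_real (x powr r * exp (- a * x))
      = of_real (x powr r) * exp (- w * of_real x)" for x r :: real
  proof -
    have "exp (- w * of_real x) = exp (- \<i> * of_real t * of_real x) * exp (of_real (- a * x))"
      unfolding exp_add[symmetric] by (simp add: w_def algebra_simps)
    then show ?thesis by (simp add: exp_of_real[symmetric] mult_ac)
  qed
  note I = complex_gamma_integrable[OF q a, of t, unfolded e]
  have "q + 1 > -1" using q by simp
  note I1 = complex_gamma_integrable[OF this a, of t, unfolded e]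
  have int_f: "integrable PP f" unfolding f_def of_real_mult mult.assoc
    by (rule Bochner_Integration.integrable_diff, rule integrable_mult_right, rule I,
        rule integrable_mult_right, rule I1)
  have "(LBINT x=0..\<infinity>. f x) = 0 - 0"
  proof (rule interval_integral_FTC_integrable)
    fix x :: real assume x: "0 < ereal x" "ereal x < \<infinity>"
    then have "x > 0" by simp
    then show "(F has_vector_derivative f x) (at x)"
      unfolding F_def f_def
      by (auto intro!: derivative_eq_intros has_vector_derivative_real_field simp: field_simps powr_diff)
    show "isCont f x" unfolding f_def using \<open>x > 0\<close> by (auto intro!: continuous_intros)
  next
    have "set_integrable lborel {0<..} f"
      using int_f by (simp add: integrable_restrict_space set_integrable_def)
    then show "set_integrable lborel (einterval 0 \<infinity>) f"
      by (simp add: einterval_def greaterThan_def flip: zero_ereal_def)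
  next
    have n: "norm (F x) = x powr (q + 1) * exp (- a * x)" for x
      by (simp add: F_def norm_mult w_def)
    have "(F \<longlongrightarrow> 0) (at_right 0)"
    proof (rule tendsto_norm_zero_cancel, unfold n)
      show "((\<lambda>x. x powr (q + 1) * exp (- a * x)) \<longlongrightarrow> 0) (at_right 0)"
        using q a by real_asymp
    qed
    then show "((F \<circ> real_of_ereal) \<longlongrightarrow> 0) (at_right 0)"
      unfolding zero_ereal_def by (rule ereal_tendsto_simps[THEN iffD2])
    have "(F \<longlongrightarrow> 0) at_top"
    proof (rule tendsto_norm_zero_cancel, unfold n)
      show "((\<lambda>x. x powr (q + 1) * exp (- a * x)) \<longlongrightarrow> 0) at_top"
        using q a by real_asymp
    qed
    then show "((F \<circ> real_of_ereal) \<longlongrightarrow> 0) (at_left \<infinity>)"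
      by (rule ereal_tendsto_simps[THEN iffD2])
  qed simp
  then have "(\<integral>x. f x \<partial>PP) = 0"
    by (simp add: integral_restrict_space interval_lebesgue_integral_def set_lebesgue_integral_def
        einterval_def greaterThan_def flip: zero_ereal_def)
  also have "(\<integral>x. f x \<partial>PP) = of_real (q + 1) * (\<integral>x. of_real (x powr q) * exp (- w * of_real x) \<partial>PP)
     - w * (\<integral>x. of_real (x powr (q + 1)) * exp (- w * of_real x) \<partial>PP)"
    unfolding f_def of_real_mult mult.assoc
    by (rule has_bochner_integral_integral_eq, rule has_bochner_integral_diff,
        rule has_bochner_integral_mult_right, rule has_bochner_integral_integrable[OF I],
        rule has_bochner_integral_mult_right, rule has_bochner_integral_integrable[OF I1])
  finally show ?thesis unfolding e w_def[symmetric] by simp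
qed

text \<open>As a function of t the integral K satisfies K' = - i (q + 1)/w K with w = a + i t, by
  the recurrence, so w^(q+1) K is constant; its value is found at t = 0 from the real Gamma
  integral. The line of all w stays in the right half-plane, off the cut of the principal
  branch.\<close>

lemma complex_gamma_integral:
  fixes q a t :: real
  assumes q: "q > -1" and a: "a > 0"
  shows "(\<integral>x. exp (- \<i> * of_real t * of_real x) * of_real (x powr q * exp (- a * x)) \<partial>PP)
       = of_real (Gamma (q + 1)) * (of_real a + \<i> * of_real t) powr (- of_real (q + 1))"
proof -
  define K where "K = (\<lambda>t. \<integral>x. exp (- \<i> * of_real t * of_real x) * complex_of_real (x powr q * exp (- a * x)) \<partial>PP)"
  define w where "w = (\<lambda>t::real. of_real a + \<i> * of_real t)"
  define c where "c = (\<lambda>t. w t powr (of_real (q + 1)) * K t)"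
  have w: "w t \<notin> \<real>\<^sub>\<le>\<^sub>0" "w t \<noteq> 0" for t
    using a by (auto simp: w_def complex_nonpos_Reals_iff complex_eq_iff)
  have K': "(K has_vector_derivative - \<i> * of_real (q + 1) / w t * K t) (at t)" for t
  proof -
    have p: "x * (x powr q * exp (- a * x)) = x powr (q + 1) * exp (- a * x)" if "x > 0" for x
      using that by (simp add: powr_add)
    have i: "integrable PP (\<lambda>x. complex_of_real (x powr q * exp (- a * x)))"
      using complex_gamma_integrable[OF q a, of 0] by simp
    have "integrable PP (\<lambda>x. complex_of_real (x powr (q + 2) * exp (- a * x)))"
      using complex_gamma_integrable[of "q + 2" a 0] q a by simp
    also have "?this \<longleftrightarrow> integrable PP (\<lambda>x. of_real (x\<^sup>2) * complex_of_real (x powr q * exp (- a * x)))"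
      by (rule Bochner_Integration.integrable_cong) (auto simp: powr_add powr_numeral)
    finally have D: "(K has_vector_derivative - \<i> * (\<integral>x. exp (- \<i> * of_real t * of_real x) *
        (of_real x * complex_of_real (x powr q * exp (- a * x))) \<partial>PP)) (at t)"
      unfolding K_def using fourier_has_vector_derivative[OF i] by blast
    have "(\<integral>x. exp (- \<i> * of_real t * of_real x) * (of_real x * complex_of_real (x powr q * exp (- a * x))) \<partial>PP)
      = (\<integral>x. exp (- \<i> * of_real t * of_real x) * of_real (x powr (q + 1) * exp (- a * x)) \<partial>PP)"
      by (rule Bochner_Integration.integral_cong) (simp_all only: of_real_mult[symmetric] space_PP greaterThan_iff p)
    also have "\<dots> = of_real (q + 1) / w t * K t"
    proof -
      have "w t * (\<integral>x. exp (- \<i> * of_real t * of_real x) * of_real (x powr (q + 1) * exp (- a * x)) \<partial>PP)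
          = of_real (q + 1) * K t"
        using complex_gamma_recurrence[OF q a, of t] by (simp only: w_def K_def)
      moreover have "X = y / w t * z" if "w t * X = y * z" for X y z
        using that w(2)[of t] by (simp add: nonzero_eq_divide_eq mult_ac)
      ultimately show ?thesis by blast
    qed
    finally show ?thesis using D by (simp add: mult.assoc)
  qed
  have "(c has_vector_derivative 0) (at t)" for t
  proof -
    have "((\<lambda>t. w t powr of_real (q + 1)) has_vector_derivative
        (\<i> * (of_real (q + 1) * w t powr (of_real (q + 1) - 1)))) (at t)"
    proof -
      have 1: "(w has_vector_derivative \<i>) (at t)"
        unfolding w_def by (auto intro!: derivative_eq_intros)
      have 2: "((\<lambda>z. z powr of_real (q + 1)) has_field_derivative of_real (q + 1) * w t powr (of_real (q + 1) - 1)) (at (w t))"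
        by (rule has_field_derivative_powr[OF w(1)])
      show ?thesis using field_vector_diff_chain_at[OF 1 2] by (simp add: o_def)
    qed
    from has_vector_derivative_mult[OF this K'[of t]] show ?thesis
      unfolding c_def using w(2)[of t] by (simp add: powr_add)
  qed
  then have "c t = c 0"
    by (metis has_vector_derivative_zero_constant convex_UNIV UNIV_I)
  also have "c 0 = of_real (Gamma (q + 1))"
  proof -
    have "K 0 = of_real (\<integral>x. x powr q * exp (- a * x) \<partial>PP)"
      by (simp add: K_def flip: integral_complex_of_real)
    also have "\<dots> = of_real (Gamma (q + 1) * a powr (- (q + 1)))"
      using has_bochner_integral_gamma[OF q a] by (simp add: has_bochner_integral_iff)
    finally have "K 0 = of_real (Gamma (q + 1) * a powr (- (q + 1)))" .
    moreover have "w 0 powr of_real (q + 1) = of_real (a powr (q + 1))"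
      using a by (simp add: w_def flip: powr_of_real)
    ultimately have "c 0 = of_real (a powr (q + 1) * (Gamma (q + 1) * a powr (- (q + 1))))"
      by (simp add: c_def)
    also have "a powr (q + 1) * (Gamma (q + 1) * a powr (- (q + 1))) = Gamma (q + 1)"
      using a by (simp add: powr_add[symmetric] mult.left_commute[of "a powr _"])
    finally show ?thesis .
  qed
  finally have ct: "c t = of_real (Gamma (q + 1))" .
  have "w t powr of_real (q + 1) * w t powr (- of_real (q + 1)) = 1"
    using w(2)[of t] by (simp only: powr_minus) simp
  then have "K t = c t * w t powr (- of_real (q + 1))"
    unfolding c_def by (metis mult.commute mult.left_commute mult_1)
  then have "K t = of_real (Gamma (q + 1)) * w t powr (- of_real (q + 1))"
    by (simp only: ct)
  then show ?thesis by (simp only: K_def w_def)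
qed

section \<open>Laguerre functions\<close>

lemma lag_a_pos: "p > -1 \<Longrightarrow> lag_a p n > 0"
  unfolding lag_a_def by (intro real_sqrt_gt_zero mult_pos_pos) auto

text \<open>The rate must be arbitrary in the induction: in the recurrence the factor z - b consumes
  half of it and leaves the other half for the polynomial of index n + 1.\<close>

lemma laguerre_exp_bound: "\<epsilon> > 0 \<Longrightarrow> \<exists>C. \<forall>x\<ge>0. \<bar>laguerre p n x\<bar> \<le> C * exp (\<epsilon> * x)"
\<comment> \<open>\<open>laguerre.induct\<close> also carries the evaluation point; the dummy 0
  fills that slot, since the claim concerns the whole function.\<close>
proof (induction p n "0::real" arbitrary: \<epsilon> rule: laguerre.induct)
  case (1 p)
  then show ?case by (intro exI[of _ 1]) auto
next
  have lin: "\<bar>x - b\<bar> \<le> (1 / \<epsilon> + \<bar>b\<bar>) * exp (\<epsilon> * x)" if "\<epsilon> > 0" "x \<ge> 0" for x b \<epsilon> :: real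
  proof -
    have "\<epsilon> * x \<le> exp (\<epsilon> * x)" using exp_ge_add_one_self[of "\<epsilon> * x"] by linarith
    then have "x \<le> 1 / \<epsilon> * exp (\<epsilon> * x)" using that by (simp add: field_simps)
    moreover have "\<bar>b\<bar> * 1 \<le> \<bar>b\<bar> * exp (\<epsilon> * x)" using that by (intro mult_left_mono) auto
    ultimately show ?thesis using that by (simp add: distrib_right)
  qed
  {
    case (2 p)
    have "\<bar>(x - lag_b p 0) / lag_a p 0\<bar> \<le> (1 / \<epsilon> + \<bar>lag_b p 0\<bar>) / \<bar>lag_a p 0\<bar> * exp (\<epsilon> * x)" if "x \<ge> 0" for x
      using divide_right_mono[OF lin[OF 2 that, of "lag_b p 0"], of "\<bar>lag_a p 0\<bar>"] by simp
    then show ?case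
      by (intro exI[of _ "(1 / \<epsilon> + \<bar>lag_b p 0\<bar>) / \<bar>lag_a p 0\<bar>"]) (metis laguerre.simps(2))
  next
    case (3 p n)
    from 3(3) have e: "\<epsilon> / 2 > 0" by simp
    obtain C1 where C1: "\<forall>x\<ge>0. \<bar>laguerre p (Suc n) x\<bar> \<le> C1 * exp (\<epsilon> / 2 * x)" using 3(1)[OF e] by auto
    obtain C2 where C2: "\<forall>x\<ge>0. \<bar>laguerre p n x\<bar> \<le> C2 * exp (\<epsilon> * x)" using 3(2)[OF 3(3)] by auto
    define A where "A = 1 / (\<epsilon> / 2) + \<bar>lag_b p (Suc n)\<bar>"
    have "\<bar>laguerre p (Suc (Suc n)) x\<bar> \<le> (A * C1 + \<bar>lag_a p n\<bar> * C2) / \<bar>lag_a p (Suc n)\<bar> * exp (\<epsilon> * x)"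
      if x: "x \<ge> 0" for x
    proof -
      have "\<bar>(x - lag_b p (Suc n)) * laguerre p (Suc n) x\<bar> \<le> (A * exp (\<epsilon> / 2 * x)) * (C1 * exp (\<epsilon> / 2 * x))"
        unfolding abs_mult A_def by (intro mult_mono lin e x C1[rule_format]) (use 3(3) in auto)
      also have "\<dots> = A * C1 * exp (\<epsilon> * x)"
        by (simp add: mult_exp_exp algebra_simps)
      finally have 1: "\<bar>(x - lag_b p (Suc n)) * laguerre p (Suc n) x\<bar> \<le> A * C1 * exp (\<epsilon> * x)" .
      have 2: "\<bar>lag_a p n * laguerre p n x\<bar> \<le> \<bar>lag_a p n\<bar> * (C2 * exp (\<epsilon> * x))"
        unfolding abs_mult using C2 x by (intro mult_left_mono) auto
      have "\<bar>(x - lag_b p (Suc n)) * laguerre p (Suc n) x - lag_a p n * laguerre p n x\<bar>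
          \<le> (A * C1 + \<bar>lag_a p n\<bar> * C2) * exp (\<epsilon> * x)"
        using 1 2 by (simp add: algebra_simps)
      then show ?thesis
        using divide_right_mono[of _ _ "\<bar>lag_a p (Suc n)\<bar>"] by fastforce
    qed
    then show ?case by blast
  }
qed

lemma laguerre_continuous: "continuous_on S (laguerre p n)"
proof (induction p n "0::real" rule: laguerre.induct)
  case (1 p)
  have "laguerre p 0 = (\<lambda>z. 1)" by auto
  then show ?case by simp
next
  case (2 p)
  have "laguerre p (Suc 0) = (\<lambda>z. (z - lag_b p 0) / lag_a p 0)" by auto
  then show ?case by (auto simp: divide_inverse intro!: continuous_intros)
next
  case (3 p n)
  have "laguerre p (Suc (Suc n)) = (\<lambda>z. ((z - lag_b p (Suc n)) * laguerre p (Suc n) z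
      - lag_a p n * laguerre p n z) * inverse (lag_a p (Suc n)))" by (auto simp: divide_inverse)
  then show ?case using 3 by (auto intro!: continuous_intros)
qed

lemma laguerre_measurable [measurable]: "laguerre p n \<in> borel_measurable borel"
  by (rule borel_measurable_continuous_onI) (rule laguerre_continuous)

section \<open>Modulated functions and their Laguerre coefficients\<close>

definition nice :: "real \<Rightarrow> (real \<Rightarrow> complex) \<Rightarrow> bool" where
  "nice p F \<longleftrightarrow> F \<in> borel_measurable borel \<and>
     (\<exists>C. \<forall>x>0. cmod (F x) \<le> C * (x powr (p / 2) * exp (- x / 4)))"

definition lag :: "real \<Rightarrow> nat \<Rightarrow> real \<Rightarrow> complex" where
  "lag p n x = of_real (laguerre_fun p n x)"

definition hfun :: "real \<Rightarrow> real \<Rightarrow> real \<Rightarrow> complex" where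
  "hfun p s x = of_real (x powr (p / 2) * exp (- s * x))"

definition modul :: "real \<Rightarrow> (real \<Rightarrow> complex) \<Rightarrow> real \<Rightarrow> complex" where
  "modul t F x = exp (- \<i> * of_real t * of_real x) * F x"

text \<open>The adjoint of the Laguerre transform, so that \<open>coef p (modul t F)\<close> is the
  candidate for the evolved sequence.\<close>

definition coef :: "real \<Rightarrow> (real \<Rightarrow> complex) \<Rightarrow> nat \<Rightarrow> complex" where
  "coef p F n = ip PP (lag p n) F"

lemma hfun_measurable [measurable]: "hfun p s \<in> borel_measurable borel"
  unfolding hfun_def by measurable

lemma cmod_hfun: "cmod (hfun p s x) = x powr (p / 2) * exp (- s * x)"
  by (simp add: hfun_def norm_mult)

lemma lag_measurable [measurable]: "lag p n \<in> borel_measurable borel"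
  unfolding lag_def laguerre_fun_def laguerre_weight_def by measurable

lemma sq_int_hfun:
  assumes "p > -1" "s > 0"
  shows "hfun p s \<in> sq_int PP" "(norm2 PP (hfun p s))\<^sup>2 = Gamma (p + 1) * (2 * s) powr (- (p + 1))"
proof -
  have eq: "(cmod (hfun p s x))\<^sup>2 = x powr p * exp (- (2 * s) * x)" if "x > 0" for x
    by (simp add: cmod_hfun power_mult_distrib)
       (simp add: power2_eq_square powr_add[symmetric] exp_add[symmetric])
  have hb: "has_bochner_integral PP (\<lambda>x. x powr p * exp (- (2 * s) * x)) (Gamma (p + 1) * (2 * s) powr (- (p + 1)))"
    using assms by (intro has_bochner_integral_gamma) auto
  then have hb': "has_bochner_integral PP (\<lambda>x. (cmod (hfun p s x))\<^sup>2) (Gamma (p + 1) * (2 * s) powr (- (p + 1)))"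
    by (subst has_bochner_integral_cong[OF refl _ refl]) (auto simp: eq)
  then show "hfun p s \<in> sq_int PP"
    by (auto simp: sq_int_def has_bochner_integral_iff intro!: measurable_PP)
  show "(norm2 PP (hfun p s))\<^sup>2 = Gamma (p + 1) * (2 * s) powr (- (p + 1))"
    using hb' by (simp add: norm2_power2 has_bochner_integral_iff)
qed

lemma nice_sq_int:
  assumes "p > -1" "nice p F" shows "F \<in> sq_int PP"
proof -
  obtain C where C: "\<And>x. x > 0 \<Longrightarrow> cmod (F x) \<le> C * (x powr (p / 2) * exp (- x / 4))"
    using assms(2) by (auto simp: nice_def)
  show ?thesis
    by (rule sq_int_dominated(1)[OF sq_int_hfun(1)[of p "1/4"], where C = C])
       (use assms(1) C assms(2)[unfolded nice_def] in \<open>auto simp: cmod_hfun intro: measurable_PP\<close>)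
qed

lemma niceI:
  assumes "F \<in> borel_measurable borel" "\<And>x. x > 0 \<Longrightarrow> cmod (F x) \<le> C * (x powr (p / 2) * exp (- x / 4))"
  shows "nice p F"
  using assms by (auto simp: nice_def)

lemma sqrt_laguerre_weight:
  assumes "p > -1"
  shows "sqrt (laguerre_weight p x) = x powr (p / 2) * exp (- x / 2) / sqrt (Gamma (p + 1))"
proof (rule real_sqrt_unique)
  have G: "Gamma (p + 1) > 0" using assms by (intro Gamma_real_pos) auto
  show "(x powr (p / 2) * exp (- x / 2) / sqrt (Gamma (p + 1)))\<^sup>2 = laguerre_weight p x"
    using G by (simp add: laguerre_weight_def power_divide power_mult_distrib)
       (simp add: power2_eq_square powr_add[symmetric] exp_add[symmetric])
  show "0 \<le> x powr (p / 2) * exp (- x / 2) / sqrt (Gamma (p + 1))" using G by simp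
qed

text \<open>The factor exp(- x/2) of a Laguerre function is shared out: exp(- x/4) is kept as the
  weight, and two factors exp(- x/8) absorb the power x^k and the polynomial.\<close>

lemma nice_lag_power:
  assumes "p > -1"
  shows "nice p (\<lambda>x. of_real (x ^ k) * lag p n x)"
proof -
  obtain C where C: "\<forall>x\<ge>0. \<bar>laguerre p n x\<bar> \<le> C * exp (1/8 * x)"
    using laguerre_exp_bound[of "1/8" p n] by auto
  have G: "Gamma (p + 1) > 0" using assms by (intro Gamma_real_pos) auto
  have "\<exists>D. \<forall>x\<ge>0. x ^ k \<le> D * exp (1/8 * (x::real))"
  \<comment> \<open>The witness comes from the k-th power of y <= exp y at y = x/(8 k). For k = 0 it
    is \<open>0 ^ 0\<close>, which is 1.\<close>
  proof (rule exI[of _ "(8 * real k) ^ k"], intro allI impI)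
    fix x :: real assume x: "x \<ge> 0"
    show "x ^ k \<le> (8 * real k) ^ k * exp (1/8 * x)"
    proof (cases "k = 0")
      case False
      define y where "y = x / (8 * real k)"
      have xy: "x = 8 * real k * y" using False by (simp add: y_def)
      have "y \<le> exp y" using exp_ge_add_one_self[of y] by linarith
      then have "y ^ k \<le> exp y ^ k" using x by (intro power_mono) (auto simp: y_def)
      also have "\<dots> = exp (1/8 * x)" by (simp add: exp_of_nat_mult[symmetric] xy)
      finally have "y ^ k \<le> exp (1/8 * x)" .
      then have "(8 * real k) ^ k * y ^ k \<le> (8 * real k) ^ k * exp (1/8 * x)"
        by (rule mult_left_mono) simp
      moreover have "x ^ k = (8 * real k) ^ k * y ^ k" by (simp add: xy power_mult_distrib)
      ultimately show ?thesis by simp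
    qed (use x in simp)
  qed
  then obtain D where D: "\<forall>x\<ge>0. x ^ k \<le> D * exp (1/8 * (x::real))" ..
  have D0: "0 \<le> D" using D[rule_format, of 0] by (cases k) auto
  show ?thesis
  proof (rule niceI)
    fix x :: real assume x: "x > 0"
    have "cmod (of_real (x ^ k) * lag p n x) = x ^ k * (sqrt (laguerre_weight p x) * \<bar>laguerre p n x\<bar>)"
      using x G by (simp add: lag_def laguerre_fun_def norm_mult norm_power abs_mult laguerre_weight_def)
    also have "sqrt (laguerre_weight p x) = x powr (p / 2) * exp (- x / 2) / sqrt (Gamma (p + 1))"
      by (rule sqrt_laguerre_weight[OF assms])
    also have "x ^ k * (x powr (p / 2) * exp (- x / 2) / sqrt (Gamma (p + 1)) * \<bar>laguerre p n x\<bar>)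
        \<le> (D * exp (1/8 * x)) * (x powr (p / 2) * exp (- x / 2) / sqrt (Gamma (p + 1)) * (C * exp (1/8 * x)))"
      using x G D C by (intro mult_mono) (auto intro!: mult_nonneg_nonneg D0)
    also have "\<dots> = D * C / sqrt (Gamma (p + 1)) * (x powr (p / 2) * (exp (1/8 * x) * exp (1/8 * x) * exp (- x / 2)))"
      by simp
    also have "exp (1/8 * x) * exp (1/8 * x) * exp (- x / 2) = exp (- x / 4)"
      unfolding exp_add[symmetric] by simp
    finally show "cmod (of_real (x ^ k) * lag p n x) \<le> D * C / sqrt (Gamma (p + 1)) * (x powr (p / 2) * exp (- x / 4))" .
  qed measurable
qed

lemma nice_lag: "p > -1 \<Longrightarrow> nice p (lag p n)"
  using nice_lag_power[of p 0 n] by simp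

lemma modul_measurable: "F \<in> borel_measurable borel \<Longrightarrow> modul t F \<in> borel_measurable borel"
  unfolding modul_def by measurable

lemma cmod_modul [simp]: "cmod (modul t F x) = cmod (F x)"
  by (simp add: modul_def norm_mult)

lemma sq_int_modul: "F \<in> sq_int PP \<Longrightarrow> modul t F \<in> sq_int PP"
proof -
  assume F: "F \<in> sq_int PP"
  have "(\<lambda>x::real. exp (- \<i> * of_real t * of_real x)) \<in> borel_measurable PP"
    by (rule measurable_PP) measurable
  then have "(\<lambda>x. exp (- \<i> * of_real t * of_real x) * F x) \<in> borel_measurable PP"
    using F by (intro borel_measurable_times) (auto simp: sq_int_def)
  then show ?thesis using F by (simp add: sq_int_def modul_def[abs_def] norm_mult)
qed

lemma norm2_modul [simp]: "norm2 M (modul t F) = norm2 M F"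
  by (simp add: norm2_def)

lemma sq_int_lag_power: "p > -1 \<Longrightarrow> (\<lambda>x. of_real (x ^ k) * lag p n x) \<in> sq_int PP"
  using nice_sq_int nice_lag_power by blast

lemma sq_int_lag: "p > -1 \<Longrightarrow> lag p n \<in> sq_int PP"
  using nice_sq_int nice_lag by blast

lemma lag_action_lag:
  assumes "p > -1" shows "lag_action p (\<lambda>n. lag p n x) n = of_real x * lag p n x"
proof -
  have "of_real x * lag p n x = of_real (sqrt (laguerre_weight p x) * (x * laguerre p n x))"
    by (simp add: lag_def laguerre_fun_def)
  also have "\<dots> = lag_action p (\<lambda>n. lag p n x) n"
    by (subst laguerre_recurrence[OF assms, symmetric])
       (simp add: lag_action_def lag_def laguerre_fun_def algebra_simps)
  finally show ?thesis ..
qed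

lemma cnj_lag [simp]: "cnj (lag p n x) = lag p n x"
  by (simp add: lag_def)

lemma coef_eq: "coef p F n = (\<integral>x. lag p n x * F x \<partial>PP)"
  by (simp add: coef_def ip_def)

lemma lag_mult_integrable:
  assumes "p > -1" "F \<in> sq_int PP"
  shows "integrable PP (\<lambda>x. lag p n x * F x)" "integrable PP (\<lambda>x. of_real (x ^ k) * lag p n x * F x)"
  using sq_int_cnj_mult_integrable[OF sq_int_lag[OF assms(1), of n] assms(2)]
    sq_int_cnj_mult_integrable[OF sq_int_lag_power[OF assms(1), of k n] assms(2)] by auto

text \<open>The factor x is attached to the Laguerre function, where it preserves square
  integrability and is resolved by the three-term recurrence; hence the formula covers every
  \<open>F\<close> in L2, even if x F leaves L2.\<close>

lemma coef_mult_x: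
  assumes p: "p > -1" and F: "F \<in> sq_int PP"
  shows "(\<integral>x. of_real x * lag p n x * F x \<partial>PP) = lag_action p (coef p F) n"
proof -
  note hb = has_bochner_integral_integrable[OF lag_mult_integrable(1)[OF p F]]
  have "(\<integral>x. of_real x * lag p n x * F x \<partial>PP) =
    (\<integral>x. (if n = 0 then 0 else of_real (lag_a p (n - 1))) * (lag p (n - 1) x * F x)
     + of_real (lag_b p n) * (lag p n x * F x) + of_real (lag_a p n) * (lag p (n + 1) x * F x) \<partial>PP)"
    by (intro Bochner_Integration.integral_cong refl)
       (simp add: lag_action_lag[OF p, symmetric] lag_action_def algebra_simps)
  also have "\<dots> = (if n = 0 then 0 else of_real (lag_a p (n - 1))) * coef p F (n - 1)
     + of_real (lag_b p n) * coef p F n + of_real (lag_a p n) * coef p F (n + 1)"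
    unfolding coef_eq
    by (rule has_bochner_integral_integral_eq, rule has_bochner_integral_add, rule has_bochner_integral_add,
        (rule has_bochner_integral_mult_right, rule hb)+)
  also have "\<dots> = lag_action p (coef p F) n" by (simp add: lag_action_def)
  finally show ?thesis .
qed

text \<open>The Schroedinger equation for each single component. In this pointwise form no question
  of operator domains arises.\<close>

lemma coef_modul_derivative:
  assumes p: "p > -1" and F: "F \<in> sq_int PP"
  shows "((\<lambda>t. coef p (modul t F) n) has_vector_derivative - \<i> * lag_action p (coef p (modul t F)) n) (at t)"
proof -
  have eq: "coef p (modul t F) n = (\<integral>x. exp (- \<i> * of_real t * of_real x) * (lag p n x * F x) \<partial>PP)" for t n
    by (simp add: coef_eq modul_def mult_ac)
  have "((\<lambda>t. coef p (modul t F) n) has_vector_derivative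
      - \<i> * (\<integral>x. exp (- \<i> * of_real t * of_real x) * (of_real x * (lag p n x * F x)) \<partial>PP)) (at t)"
    unfolding eq
    by (rule fourier_has_vector_derivative[OF lag_mult_integrable(1)[OF p F] lag_mult_integrable(2)[OF p F, of 2 n, unfolded mult.assoc]])
  moreover have "(\<integral>x. exp (- \<i> * of_real t * of_real x) * (of_real x * (lag p n x * F x)) \<partial>PP)
     = (\<integral>x. of_real x * lag p n x * modul t F x \<partial>PP)"
    by (simp add: modul_def mult_ac)
  ultimately show ?thesis
    using coef_mult_x[OF p sq_int_modul[OF F]] by simp
qed

text \<open>The Jacobi structure makes the system solvable upwards from the lowest component.\<close>
lemma lag_action_ode_unique:
  fixes X Y :: "real \<Rightarrow> nat \<Rightarrow> complex"
  assumes p: "p > -1"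
    and X: "\<And>t n. ((\<lambda>t. X t n) has_vector_derivative - \<i> * lag_action p (X t) n) (at t)"
    and Y: "\<And>t n. ((\<lambda>t. Y t n) has_vector_derivative - \<i> * lag_action p (Y t) n) (at t)"
    and 0: "\<And>t. X t 0 = Y t 0"
  shows "X t n = Y t n"
proof (induction n arbitrary: t rule: less_induct)
  case (less n)
  show ?case
  proof (cases n)
    case (Suc m)
    have e: "(\<lambda>t. X t m) = (\<lambda>t. Y t m)" using less Suc by auto
    have "- \<i> * lag_action p (X t) m = - \<i> * lag_action p (Y t) m"
      by (rule vector_derivative_unique_at[OF X[of m t] Y[of m t, folded e]])
    moreover have "X t m = Y t m" by (rule less) (simp add: Suc)
    \<comment> \<open>For m = 0 the truncated difference is m itself; the corresponding term of
      \<open>lag_action\<close> is then absent.\<close>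
    moreover have "X t (m - 1) = Y t (m - 1)" by (rule less) (simp add: Suc)
    ultimately have "of_real (lag_a p m) * X t (m + 1) = of_real (lag_a p m) * Y t (m + 1)"
      unfolding lag_action_def by (cases "m = 0") simp_all
    then show ?thesis using Suc lag_a_pos[OF p, of m] by simp
  qed (simp add: 0)
qed

section \<open>Coherent states and the explicit coefficients of the modulated
  \<open>hfun\<close>\<close>

definition nbinom :: "real \<Rightarrow> nat \<Rightarrow> real" where
  "nbinom p n = pochhammer (p + 1) n / fact n"

lemma nbinom_pos: "p > -1 \<Longrightarrow> nbinom p n > 0"
  by (simp add: nbinom_def pochhammer_pos)

lemma nbinom_0 [simp]: "nbinom p 0 = 1" by (simp add: nbinom_def)

text \<open>\<open>nbinom p n\<close> is the coefficient of x^n in (1 - x)^(-p-1). Weighting by its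
  square root removes the square root in \<open>lag_a\<close>, so that the Jacobi matrix acts on
  coherent states with coefficients linear in n.\<close>

lemma lag_a_nbinom:
  assumes "p > -1"
  shows "lag_a p n * sqrt (nbinom p (Suc n)) = (real n + 1 + p) * sqrt (nbinom p n)"
    "lag_a p n * sqrt (nbinom p n) = (real n + 1) * sqrt (nbinom p (Suc n))"
proof -
  have c: "nbinom p (Suc n) = nbinom p n * (real n + 1 + p) / (real n + 1)"
  proof -
    have "nbinom p (Suc n) = (pochhammer (p + 1) n * (p + 1 + real n)) / ((1 + real n) * fact n)"
      by (simp only: nbinom_def pochhammer_Suc fact_Suc of_nat_Suc)
    then show ?thesis unfolding nbinom_def by (simp add: divide_simps add_ac)
  qed
  have pos: "real n + 1 + p > 0" using assms by simp
  have alg: "N * M * (C * M / N) = M\<^sup>2 * C" "N * M * C = N\<^sup>2 * (C * M / N)" if "N > 0" for N M C :: real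
    using that by (auto simp: power2_eq_square)
  have N: "real n + 1 > 0" by simp
  have "lag_a p n * sqrt (nbinom p (Suc n)) = sqrt ((real n + 1 + p)\<^sup>2 * nbinom p n)"
    unfolding lag_a_def c real_sqrt_mult[symmetric] alg(1)[OF N] ..
  then show "lag_a p n * sqrt (nbinom p (Suc n)) = (real n + 1 + p) * sqrt (nbinom p n)"
    using pos by (simp add: real_sqrt_mult)
  have "lag_a p n * sqrt (nbinom p n) = sqrt ((real n + 1)\<^sup>2 * nbinom p (Suc n))"
    unfolding lag_a_def c real_sqrt_mult[symmetric] alg(2)[OF N] ..
  then show "lag_a p n * sqrt (nbinom p n) = (real n + 1) * sqrt (nbinom p (Suc n))"
    by (simp add: real_sqrt_mult)
qed

definition coh :: "real \<Rightarrow> complex \<Rightarrow> nat \<Rightarrow> complex" where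
  "coh p z n = z ^ n * of_real (sqrt (nbinom p n))"

text \<open>The 1/2 is the decay rate of the Laguerre functions: the product of
  \<open>lag p 0\<close> with the modulated \<open>hfun p s\<close> decays at the complex rate
  \<open>wfun s t\<close>.\<close>

definition wfun :: "real \<Rightarrow> real \<Rightarrow> complex" where
  "wfun s t = of_real (s + 1/2) + \<i> * of_real t"

lemma wfun_props:
  assumes "s > 0"
  shows "wfun s t \<notin> \<real>\<^sub>\<le>\<^sub>0" "wfun s t \<noteq> 0" "Re (wfun s t) > 0"
  using assms by (auto simp: wfun_def complex_nonpos_Reals_iff complex_eq_iff)

text \<open>Read n z^(n-1) as the derivative of z^n: on coherent states the Jacobi matrix is the
  first-order operator (1 + z)^2 d/dz + (p + 1)(1 + z). The double zero at z = -1 is the parabolic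
  fixed point to which the states drift.\<close>

lemma lag_action_coh:
  assumes p: "p > -1"
  shows "lag_action p (coh p z) n =
     ((of_nat n * z ^ (n - 1)) * (1 + z)\<^sup>2 + of_real (p + 1) * (1 + z) * z ^ n) * of_real (sqrt (nbinom p n))"
proof -
  have up: "of_real (lag_a p n) * coh p z (n + 1) = of_real (real n + 1 + p) * z ^ (n + 1) * of_real (sqrt (nbinom p n))"
  proof -
    have "of_real (lag_a p n) * coh p z (n + 1) = z ^ (n + 1) * of_real (lag_a p n * sqrt (nbinom p (Suc n)))"
      by (simp add: coh_def)
    then show ?thesis unfolding lag_a_nbinom[OF p] by simp
  qed
  have down: "(if n = 0 then 0 else of_real (lag_a p (n - 1)) * coh p z (n - 1))
      = of_nat n * z ^ (n - 1) * of_real (sqrt (nbinom p n))"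
  proof (cases n)
    case (Suc m)
    have "of_real (lag_a p m) * coh p z m = z ^ m * of_real (lag_a p m * sqrt (nbinom p m))"
      by (simp add: coh_def)
    then show ?thesis unfolding lag_a_nbinom[OF p] using Suc by (simp add: add_ac)
  qed simp
  have z: "of_nat n * z ^ n = of_nat n * z ^ (n - 1) * z" by (cases n) auto
  have "lag_action p (coh p z) n = (of_nat n * z ^ (n - 1) + of_real (2 * real n + p + 1) * z ^ n
       + of_real (real n + 1 + p) * z ^ (n + 1)) * of_real (sqrt (nbinom p n))"
    unfolding lag_action_def up down by (simp add: lag_b_def coh_def algebra_simps)
  also have "of_nat n * z ^ (n - 1) + of_real (2 * real n + p + 1) * z ^ n + of_real (real n + 1 + p) * z ^ (n + 1)
      = of_nat n * z ^ (n - 1) + 2 * (of_nat n * z ^ n) + (of_nat n * z ^ n) * z + of_real (p + 1) * (1 + z) * z ^ n"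
    by (simp add: algebra_simps)
  also have "\<dots> = (of_nat n * z ^ (n - 1)) * (1 + z)\<^sup>2 + of_real (p + 1) * (1 + z) * z ^ n"
    unfolding z by (simp add: algebra_simps power2_eq_square)
  finally show ?thesis .
qed

text \<open>The method of characteristics for this first-order operator: with 1 + z = 1/w the vector
  field (1 + z)^2 becomes a translation, so w moves along a vertical line with derivative i in t;
  the power of w solves the remaining scalar equation.\<close>

definition evol :: "real \<Rightarrow> real \<Rightarrow> real \<Rightarrow> nat \<Rightarrow> complex" where
  "evol p s t n = of_real (sqrt (Gamma (p + 1))) * wfun s t powr (- of_real (p + 1)) * coh p (1 / wfun s t - 1) n"

lemma lag_action_scale: "lag_action p (\<lambda>n. c * f n) n = c * lag_action p f n"
  by (simp add: lag_action_def algebra_simps)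

lemma evol_has_vector_derivative:
  assumes p: "p > -1" and s: "s > 0"
  shows "((\<lambda>t. evol p s t n) has_vector_derivative - \<i> * lag_action p (evol p s t) n) (at t)"
proof -
  define a where "a = - complex_of_real (p + 1)"
  define w where "w = wfun s t"
  define z where "z = 1 / w - 1"
  have w: "w \<notin> \<real>\<^sub>\<le>\<^sub>0" "w \<noteq> 0" using wfun_props[OF s] by (auto simp: w_def)
  have 1: "(wfun s has_vector_derivative \<i>) (at t)"
    unfolding wfun_def by (auto intro!: derivative_eq_intros)
  have d1: "((\<lambda>w. w powr a) has_field_derivative a * w powr (a - 1)) (at w)"
    by (rule has_field_derivative_powr[OF w(1)])
  have d2: "((\<lambda>w. (1 / w - 1) ^ n) has_field_derivative of_nat n * z ^ (n - 1) * (- 1 / w\<^sup>2)) (at w)"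
    using w by (auto intro!: derivative_eq_intros simp: z_def power2_eq_square)
  have "((\<lambda>w. w powr a * (1 / w - 1) ^ n) has_field_derivative
      a * w powr (a - 1) * z ^ n + of_nat n * z ^ (n - 1) * (- 1 / w\<^sup>2) * w powr a) (at w)"
    using DERIV_mult[OF d1 d2] by (simp add: z_def)
  also have "a * w powr (a - 1) * z ^ n + of_nat n * z ^ (n - 1) * (- 1 / w\<^sup>2) * w powr a
      = - (w powr a * ((of_nat n * z ^ (n - 1)) * (1 + z)\<^sup>2 + of_real (p + 1) * (1 + z) * z ^ n))"
    using w by (simp add: a_def z_def powr_diff power_divide algebra_simps del: of_real_add)
  finally have 2: "((\<lambda>w. w powr a * (1 / w - 1) ^ n) has_field_derivative
      - (w powr a * ((of_nat n * z ^ (n - 1)) * (1 + z)\<^sup>2 + of_real (p + 1) * (1 + z) * z ^ n))) (at (wfun s t))"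
    unfolding w_def .
  define k where "k = of_real (sqrt (Gamma (p + 1))) * complex_of_real (sqrt (nbinom p n))"
  have "((\<lambda>t. k * (wfun s t powr a * (1 / wfun s t - 1) ^ n)) has_vector_derivative
      k * (\<i> * - (w powr a * ((of_nat n * z ^ (n - 1)) * (1 + z)\<^sup>2 + of_real (p + 1) * (1 + z) * z ^ n)))) (at t)"
    using field_vector_diff_chain_at[OF 1 2]
    by (intro has_vector_derivative_mult_right) (simp add: o_def)
  moreover have "(\<lambda>t. k * (wfun s t powr a * (1 / wfun s t - 1) ^ n)) = (\<lambda>t. evol p s t n)"
    by (simp add: evol_def coh_def k_def a_def mult_ac)
  moreover have "k * (\<i> * - (w powr a * ((of_nat n * z ^ (n - 1)) * (1 + z)\<^sup>2 + of_real (p + 1) * (1 + z) * z ^ n)))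
      = - \<i> * lag_action p (evol p s t) n"
  proof -
    have "lag_action p (evol p s t) n = of_real (sqrt (Gamma (p + 1))) * w powr a * lag_action p (coh p z) n"
      unfolding evol_def[abs_def] lag_action_scale w_def z_def a_def ..
    then show ?thesis unfolding lag_action_coh[OF p] by (simp only: k_def) (simp only: mult_ac minus_mult_left[symmetric] minus_mult_right[symmetric])
  qed
  ultimately show ?thesis by (simp only:)
qed

lemma lag_0: "p > -1 \<Longrightarrow> lag p 0 x = of_real (1 / sqrt (Gamma (p + 1))) * hfun p (1/2) x"
  by (simp add: lag_def laguerre_fun_def sqrt_laguerre_weight hfun_def)

text \<open>Both sides solve the same Jacobi system, so it is enough to compare the lowest
  components, and there the integral is the complex Gamma integral. No Laguerre polynomial of higher
  degree is ever integrated.\<close>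

lemma coef_modul_hfun:
  assumes p: "p > -1" and s: "s > 0"
  shows "coef p (modul t (hfun p s)) n = evol p s t n"
proof (rule lag_action_ode_unique[OF p])
  show "((\<lambda>t. coef p (modul t (hfun p s)) n) has_vector_derivative
      - \<i> * lag_action p (coef p (modul t (hfun p s))) n) (at t)" for t n
    by (rule coef_modul_derivative[OF p sq_int_hfun(1)[OF p s]])
  show "((\<lambda>t. evol p s t n) has_vector_derivative - \<i> * lag_action p (evol p s t) n) (at t)" for t n
    by (rule evol_has_vector_derivative[OF p s])
  show "coef p (modul t (hfun p s)) 0 = evol p s t 0" for t
  proof -
    have G: "Gamma (p + 1) > 0" using p by (intro Gamma_real_pos) auto
    have e: "x powr (p / 2) * exp (- (1/2) * x) * (x powr (p / 2) * exp (- s * x))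
        = x powr p * exp (- (s + 1/2) * x)" for x
    proof -
      have "x powr (p / 2) * x powr (p / 2) = x powr p" by (simp add: powr_add[symmetric])
      moreover have "exp (- (1/2) * x) * exp (- s * x) = exp (- (s + 1/2) * x)"
        unfolding exp_add[symmetric] by (simp add: algebra_simps)
      ultimately show ?thesis by (metis mult.assoc mult.left_commute)
    qed
    have "coef p (modul t (hfun p s)) 0 = (\<integral>x. of_real (1 / sqrt (Gamma (p + 1))) *
        (exp (- \<i> * of_real t * of_real x) * of_real (x powr p * exp (- (s + 1/2) * x))) \<partial>PP)"
      unfolding coef_eq lag_0[OF p] modul_def hfun_def e[symmetric]
      by (simp add: mult_ac)
    also have "\<dots> = of_real (1 / sqrt (Gamma (p + 1))) * (of_real (Gamma (p + 1)) * wfun s t powr (- of_real (p + 1)))"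
      using complex_gamma_integral[of p "s + 1/2" t] p s by (simp add: wfun_def)
    also have "\<dots> = of_real (Gamma (p + 1) / sqrt (Gamma (p + 1))) * wfun s t powr (- of_real (p + 1))"
      by simp
    also have "Gamma (p + 1) / sqrt (Gamma (p + 1)) = sqrt (Gamma (p + 1))"
      using G by (simp add: real_div_sqrt)
    finally show ?thesis by (simp add: evol_def coh_def)
  qed
qed

lemma modul_0: "modul 0 F = F"
  by (simp add: modul_def fun_eq_iff)

text \<open>Orthonormality by induction on the first index. For index 0 the function is a multiple
  of \<open>hfun p (1/2)\<close>, whose coherent state at t = 0 sits at z = 0 because w = 1. In the
  step, multiplication by x may be expanded on either of the two factors, and the resulting identity
  is solved for the highest index.\<close>

lemma coef_lag:
  assumes p: "p > -1" shows "coef p (lag p m) n = (if m = n then 1 else 0)"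
proof (induction m arbitrary: n rule: less_induct)
  case (less m)
  have sym: "coef p (lag p m) n = coef p (lag p n) m" for m n
    by (simp add: coef_eq mult.commute)
  show ?case
  proof (cases m)
    case 0
    have G: "Gamma (p + 1) > 0" using p by (intro Gamma_real_pos) auto
    have "coef p (lag p 0) n = of_real (1 / sqrt (Gamma (p + 1))) * coef p (modul 0 (hfun p (1/2))) n"
    proof -
      have "lag p 0 = (\<lambda>x. of_real (1 / sqrt (Gamma (p + 1))) * hfun p (1/2) x)"
        by (rule ext) (rule lag_0[OF p])
      then show ?thesis by (simp only: coef_def ip_scale_right modul_0)
    qed
    also have "\<dots> = of_real (1 / sqrt (Gamma (p + 1)) * sqrt (Gamma (p + 1))) * (0 ^ n * of_real (sqrt (nbinom p n)))"
      using coef_modul_hfun[OF p, of "1/2" 0 n] by (simp add: evol_def coh_def wfun_def)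
    finally show ?thesis using 0 G by (cases n) auto
  next
    case (Suc k)
    have x: "(\<integral>x. of_real x * lag p n x * lag p k x \<partial>PP) = lag_action p (coef p (lag p k)) n"
      by (rule coef_mult_x[OF p sq_int_lag[OF p]])
    have y: "(\<integral>x. of_real x * lag p k x * lag p n x \<partial>PP) = lag_action p (coef p (lag p n)) k"
      by (rule coef_mult_x[OF p sq_int_lag[OF p]])
    have f: "(\<lambda>j. coef p (lag p j) n) = coef p (lag p n)" by (rule ext) (rule sym)
    have eq: "lag_action p (\<lambda>j. coef p (lag p j) n) k = lag_action p (coef p (lag p k)) n"
      unfolding f x[symmetric] y[symmetric] mult.assoc mult.commute[of "lag p k _"] ..
    have IH: "coef p (lag p j) n = (if j = n then 1 else 0)" if "j < m" for j n
      by (rule less[OF that])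
    have "of_real (lag_a p k) * coef p (lag p m) n =
        lag_action p (\<lambda>n. if k = n then 1 else 0) n - of_real (lag_b p k) * (if k = n then 1 else 0)
        - (if k = 0 then 0 else of_real (lag_a p (k - 1)) * (if k - 1 = n then 1 else 0))"
    proof -
      have k: "coef p (lag p k) = (\<lambda>n. if k = n then 1 else 0)"
        by (rule ext) (rule IH, simp add: Suc)
      have k1: "coef p (lag p (k - 1)) n = (if k - 1 = n then 1 else 0)"
        by (rule IH) (simp add: Suc)
      have "(if k = 0 then 0 else of_real (lag_a p (k - 1)) * coef p (lag p (k - 1)) n)
          + of_real (lag_b p k) * coef p (lag p k) n + of_real (lag_a p k) * coef p (lag p m) n
          = lag_action p (coef p (lag p k)) n"
        unfolding eq[symmetric] lag_action_def[of _ _ k] by (simp add: Suc)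
      then show ?thesis unfolding k k1 by (simp add: eq_diff_eq add.commute add.left_commute)
    qed
    also have "\<dots> = of_real (lag_a p k) * (if m = n then 1 else 0)"
      using Suc by (auto simp: lag_action_def)
    finally show ?thesis using lag_a_pos[OF p, of k] by simp
  qed
qed

section \<open>Expansion in Laguerre functions\<close>

definition syn :: "real \<Rightarrow> nat \<Rightarrow> (nat \<Rightarrow> complex) \<Rightarrow> real \<Rightarrow> complex" where
  "syn p N u x = (\<Sum>n<N. u n * lag p n x)"

lemma coef_add: "p > -1 \<Longrightarrow> F \<in> sq_int PP \<Longrightarrow> G \<in> sq_int PP \<Longrightarrow>
    coef p (\<lambda>x. F x + G x) n = coef p F n + coef p G n"
  by (simp add: coef_def ip_add_right sq_int_lag)

lemma coef_diff: "p > -1 \<Longrightarrow> F \<in> sq_int PP \<Longrightarrow> G \<in> sq_int PP \<Longrightarrow>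
    coef p (\<lambda>x. F x - G x) n = coef p F n - coef p G n"
  by (simp add: coef_def ip_diff_right sq_int_lag)

lemma coef_scale: "coef p (\<lambda>x. c * F x) n = c * coef p F n"
  by (simp add: coef_def ip_scale_right)

lemma sq_int_syn: "p > -1 \<Longrightarrow> syn p N u \<in> sq_int PP"
  unfolding syn_def[abs_def] by (intro sq_int_sum sq_int_scale sq_int_lag)

lemma coef_syn:
  assumes "p > -1" shows "coef p (syn p N u) m = (if m < N then u m else 0)"
proof -
  have "coef p (syn p N u) m = (\<Sum>n<N. u n * coef p (lag p n) m)"
    unfolding coef_def syn_def[abs_def] using assms
    by (subst ip_sum_right) (auto simp: sq_int_lag sq_int_scale ip_scale_right)
  then show ?thesis by (simp add: coef_lag[OF assms] if_distrib[of "\<lambda>c. _ * c"] cong: if_cong)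
qed

lemma ip_syn_right:
  assumes "p > -1" "G \<in> sq_int PP"
  shows "ip PP G (syn p N u) = (\<Sum>n<N. cnj (coef p G n) * u n)"
proof -
  have "ip PP G (syn p N u) = (\<Sum>n<N. u n * ip PP G (lag p n))"
    unfolding syn_def[abs_def] using assms
    by (subst ip_sum_right) (auto simp: sq_int_lag sq_int_scale ip_scale_right)
  also have "\<dots> = (\<Sum>n<N. cnj (coef p G n) * u n)"
    unfolding coef_def by (subst ip_cnj) (simp add: mult.commute)
  finally show ?thesis .
qed

lemma norm2_syn:
  assumes "p > -1" shows "(norm2 PP (syn p N u))\<^sup>2 = (\<Sum>n<N. (cmod (u n))\<^sup>2)"
proof -
  have "complex_of_real ((norm2 PP (syn p N u))\<^sup>2) = (\<Sum>n<N. cnj (u n) * u n)"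
    unfolding ip_self[symmetric] ip_syn_right[OF assms sq_int_syn[OF assms]] coef_syn[OF assms] by simp
  also have "\<dots> = complex_of_real (\<Sum>n<N. (cmod (u n))\<^sup>2)"
    by (simp add: complex_norm_square mult.commute del: of_real_power)
  finally show ?thesis by (simp only: of_real_eq_iff)
qed

definition resid :: "real \<Rightarrow> nat \<Rightarrow> (real \<Rightarrow> complex) \<Rightarrow> real \<Rightarrow> complex" where
  "resid p N F x = F x - syn p N (coef p F) x"

lemma sq_int_resid: "p > -1 \<Longrightarrow> F \<in> sq_int PP \<Longrightarrow> resid p N F \<in> sq_int PP"
  unfolding resid_def[abs_def] by (intro sq_int_diff sq_int_syn)

text \<open>Pythagoras: the coefficients of the residual below N vanish by orthonormality, hence it
  is orthogonal to the partial sum.\<close>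

lemma norm2_resid:
  assumes p: "p > -1" and F: "F \<in> sq_int PP"
  shows "(norm2 PP (resid p N F))\<^sup>2 = (norm2 PP F)\<^sup>2 - (\<Sum>n<N. (cmod (coef p F n))\<^sup>2)"
proof -
  note R = sq_int_resid[OF p F, of N] and S = sq_int_syn[OF p, of N "coef p F"]
  have c: "coef p (resid p N F) n = 0" if "n < N" for n
    unfolding resid_def[abs_def] coef_diff[OF p F S] using that by (simp add: coef_syn[OF p])
  have "ip PP (resid p N F) (syn p N (coef p F)) = 0"
    by (simp add: ip_syn_right[OF p R] c)
  then have "(norm2 PP (\<lambda>x. resid p N F x + syn p N (coef p F) x))\<^sup>2
      = (norm2 PP (resid p N F))\<^sup>2 + (norm2 PP (syn p N (coef p F)))\<^sup>2"
    by (simp add: norm2_add_power2[OF R S])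
  moreover have "(\<lambda>x. resid p N F x + syn p N (coef p F) x) = F" by (simp add: resid_def fun_eq_iff)
  ultimately show ?thesis by (simp add: norm2_syn[OF p])
qed

lemma bessel:
  assumes "p > -1" "F \<in> sq_int PP"
  shows "coef p F \<in> l2" "norm2 NN (coef p F) \<le> norm2 PP F"
proof -
  have "(\<Sum>n<N. (cmod (coef p F n))\<^sup>2) \<le> (norm2 PP F)\<^sup>2" for N
  proof -
    have "0 \<le> (norm2 PP F)\<^sup>2 - (\<Sum>n<N. (cmod (coef p F n))\<^sup>2)"
      unfolding norm2_resid[OF assms, symmetric] by (rule zero_le_power2)
    then show ?thesis by simp
  qed
  then show "coef p F \<in> l2" "norm2 NN (coef p F) \<le> norm2 PP F"
    by (rule l2_partial_sums_le[OF _ norm2_nonneg])+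
qed

lemma norm2_resid_le:
  assumes "p > -1" "F \<in> sq_int PP" shows "norm2 PP (resid p N F) \<le> norm2 PP F"
proof (rule power2_le_imp_le)
  show "(norm2 PP (resid p N F))\<^sup>2 \<le> (norm2 PP F)\<^sup>2"
    unfolding norm2_resid[OF assms] by (simp add: sum_nonneg)
qed simp

text \<open>Membership in the closed span of the Laguerre functions. It is established function by
  function, in place of a completeness theorem for the whole of L2.\<close>

definition expands :: "real \<Rightarrow> (real \<Rightarrow> complex) \<Rightarrow> bool" where
  "expands p F \<longleftrightarrow> F \<in> sq_int PP \<and> (\<lambda>N. norm2 PP (resid p N F)) \<longlonglongrightarrow> 0"

lemma expandsI_parseval:
  assumes "p > -1" "F \<in> sq_int PP" "norm2 NN (coef p F) = norm2 PP F"
  shows "expands p F"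
  unfolding expands_def
proof (rule conjI[OF assms(2)], rule tendsto_of_power2)
  have "(\<lambda>N. (norm2 PP F)\<^sup>2 - (\<Sum>n<N. (cmod (coef p F n))\<^sup>2)) \<longlonglongrightarrow> (norm2 PP F)\<^sup>2 - (norm2 NN (coef p F))\<^sup>2"
    using norm2_NN[OF bessel(1)[OF assms(1,2)]] by (intro tendsto_intros) (simp add: sums_def)
  then show "(\<lambda>N. (norm2 PP (resid p N F))\<^sup>2) \<longlonglongrightarrow> 0"
    by (simp add: norm2_resid[OF assms(1,2)] assms(3))
qed simp

lemma resid_add:
  assumes "p > -1" "F \<in> sq_int PP" "G \<in> sq_int PP"
  shows "resid p N (\<lambda>x. F x + G x) = (\<lambda>x. resid p N F x + resid p N G x)"
  using assms by (simp add: resid_def syn_def coef_add fun_eq_iff distrib_right sum.distrib)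

lemma resid_scale: "resid p N (\<lambda>x. c * F x) = (\<lambda>x. c * resid p N F x)"
  by (simp add: resid_def syn_def coef_scale fun_eq_iff right_diff_distrib sum_distrib_left mult.assoc)

lemma expands_add:
  assumes p: "p > -1" and "expands p F" "expands p G"
  shows "expands p (\<lambda>x. F x + G x)"
proof -
  have sq: "F \<in> sq_int PP" "G \<in> sq_int PP"
    and lim: "(\<lambda>N. norm2 PP (resid p N F)) \<longlonglongrightarrow> 0" "(\<lambda>N. norm2 PP (resid p N G)) \<longlonglongrightarrow> 0"
    using assms by (auto simp: expands_def)
  have "(\<lambda>N. norm2 PP (resid p N (\<lambda>x. F x + G x))) \<longlonglongrightarrow> 0"
  proof (rule tendsto_sandwich[OF _ _ tendsto_const])
    show "(\<lambda>N. norm2 PP (resid p N F) + norm2 PP (resid p N G)) \<longlonglongrightarrow> 0"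
      using tendsto_add[OF lim] by simp
    show "\<forall>\<^sub>F N in sequentially. norm2 PP (resid p N (\<lambda>x. F x + G x)) \<le> norm2 PP (resid p N F) + norm2 PP (resid p N G)"
      unfolding resid_add[OF p sq] by (intro always_eventually allI norm2_triangle sq_int_resid p sq)
  qed simp
  then show ?thesis using sq by (simp add: expands_def sq_int_add)
qed

lemma expands_scale:
  assumes "expands p F" shows "expands p (\<lambda>x. c * F x)"
proof -
  have "(\<lambda>N. cmod c * norm2 PP (resid p N F)) \<longlonglongrightarrow> cmod c * 0"
    using assms by (intro tendsto_intros) (simp add: expands_def)
  then show ?thesis using assms by (simp add: expands_def sq_int_scale resid_scale norm2_scale)
qed

lemma expands_zero: "expands p (\<lambda>x. 0)"
proof -
  have "resid p N (\<lambda>x. 0) = (\<lambda>x. 0)" for N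
    by (simp add: resid_def syn_def coef_def ip_def fun_eq_iff)
  then show ?thesis by (simp add: expands_def sq_int_zero)
qed

lemma expands_sum:
  assumes "p > -1" "\<And>i. i \<in> I \<Longrightarrow> expands p (F i)"
  shows "expands p (\<lambda>x. \<Sum>i\<in>I. F i x)"
  using assms(2) by (induction I rule: infinite_finite_induct) (auto intro: expands_zero expands_add assms(1))

text \<open>Taking the residual is linear and does not increase the norm, so the property passes to
  limits in L2.\<close>

lemma expands_approx:
  assumes p: "p > -1" and F: "F \<in> sq_int PP"
    and app: "\<And>\<epsilon>. \<epsilon> > 0 \<Longrightarrow> \<exists>G. expands p G \<and> norm2 PP (\<lambda>x. F x - G x) \<le> \<epsilon>"
  shows "expands p F"
  unfolding expands_def
proof (intro conjI F LIMSEQ_I)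
  fix r :: real assume "r > 0"
  then obtain G where G: "expands p G" "norm2 PP (\<lambda>x. F x - G x) \<le> r / 2"
    using app[of "r / 2"] by auto
  have Gs: "G \<in> sq_int PP" using G by (simp add: expands_def)
  obtain N0 where N0: "\<And>N. N \<ge> N0 \<Longrightarrow> norm2 PP (resid p N G) < r / 2"
    using G(1) \<open>r > 0\<close> by (force simp: expands_def dest!: LIMSEQ_D[where r = "r / 2"])
  have "norm2 PP (resid p N F) < r" if "N \<ge> N0" for N
  proof -
    have D: "(\<lambda>x. F x - G x) \<in> sq_int PP" by (intro sq_int_diff F Gs)
    have "resid p N F = resid p N (\<lambda>x. G x + (F x - G x))" by simp
    also have "\<dots> = (\<lambda>x. resid p N G x + resid p N (\<lambda>x. F x - G x) x)"
      by (rule resid_add[OF p Gs D])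
    finally have "norm2 PP (resid p N F) \<le> norm2 PP (resid p N G) + norm2 PP (resid p N (\<lambda>x. F x - G x))"
      using norm2_triangle[OF sq_int_resid[OF p Gs] sq_int_resid[OF p D]] by simp
    then show ?thesis using norm2_resid_le[OF p D, of N] N0[OF that] G(2) by linarith
  qed
  then show "\<exists>N0. \<forall>N\<ge>N0. norm (norm2 PP (resid p N F) - 0) < r" by auto
qed

text \<open>The residual of \<open>F\<close> is paired with the fixed function \<open>G\<close> and
  disappears by Cauchy-Schwarz. The expansion of one factor carries the whole argument.\<close>

lemma parseval_sums:
  assumes p: "p > -1" and F: "expands p F" and G: "G \<in> sq_int PP"
  shows "(\<lambda>n. cnj (coef p G n) * coef p F n) sums ip PP G F"
proof -
  have Fs: "F \<in> sq_int PP" using F by (simp add: expands_def)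
  have eq: "ip PP G F - (\<Sum>n<N. cnj (coef p G n) * coef p F n) = ip PP G (resid p N F)" for N
    unfolding resid_def[abs_def] ip_diff_right[OF G Fs sq_int_syn[OF p]] ip_syn_right[OF p G] ..
  have "(\<lambda>N. ip PP G (resid p N F)) \<longlonglongrightarrow> 0"
  proof (rule Lim_null_comparison)
    show "\<forall>\<^sub>F N in sequentially. norm (ip PP G (resid p N F)) \<le> norm2 PP G * norm2 PP (resid p N F)"
      by (intro always_eventually allI cmod_ip_le G sq_int_resid p Fs)
    have "(\<lambda>N. norm2 PP G * norm2 PP (resid p N F)) \<longlonglongrightarrow> norm2 PP G * 0"
      using F by (intro tendsto_intros) (simp add: expands_def)
    then show "(\<lambda>N. norm2 PP G * norm2 PP (resid p N F)) \<longlonglongrightarrow> 0" by simp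
  qed
  then have "(\<lambda>N. ip PP G F - (ip PP G F - (\<Sum>n<N. cnj (coef p G n) * coef p F n))) \<longlonglongrightarrow> ip PP G F - 0"
    unfolding eq by (intro tendsto_intros)
  then show ?thesis by (simp add: sums_def)
qed

section \<open>Binomial series, inner products of coherent states, completeness\<close>

lemma nbinom_sums:
  fixes x :: complex
  assumes "cmod x < 1"
  shows "(\<lambda>n. of_real (nbinom p n) * x ^ n) sums (1 - x) powr (- of_real (p + 1))"
proof -
  have "(\<lambda>n. ((- of_real (p + 1)) gchoose n) * (- x) ^ n) sums (1 + - x) powr (- of_real (p + 1))"
    using assms by (intro gen_binomial_complex) simp
  moreover have "((- of_real (p + 1)) gchoose n) * (- x) ^ n = of_real (nbinom p n) * x ^ n" for n
  proof -
    have "((- complex_of_real (p + 1)) gchoose n) * (- x) ^ n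
        = ((-1) ^ n * pochhammer (of_real (p + 1)) n / fact n) * ((-1) ^ n * x ^ n)"
      by (simp only: gbinomial_pochhammer minus_minus power_minus[of x])
    also have "\<dots> = ((-1) ^ n * (-1) ^ n) * (pochhammer (of_real (p + 1)) n / fact n * x ^ n)"
      by (simp only: mult_ac times_divide_eq_left times_divide_eq_right)
    also have "(-1) ^ n * (-1) ^ n = (1::complex)" by (simp flip: power_mult_distrib)
    finally show ?thesis by (simp add: nbinom_def pochhammer_of_real[symmetric])
  qed
  ultimately show ?thesis by simp
qed

lemma coh_inner_sums:
  assumes p: "p > -1" and "cmod z < 1" "cmod w < 1"
  shows "(\<lambda>n. cnj (coh p z n) * coh p w n) sums (1 - cnj z * w) powr (- of_real (p + 1))"
proof -
  have "cmod (cnj z * w) < 1"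
    using mult_strict_mono'[OF assms(2,3)] by (simp add: norm_mult)
  from nbinom_sums[OF this, of p]
  show ?thesis
  proof (rule sums_cong[THEN iffD1, rotated])
    fix n
    have "complex_of_real (sqrt (nbinom p n)) * complex_of_real (sqrt (nbinom p n)) = of_real (nbinom p n)"
      using nbinom_pos[OF p, of n] by (simp flip: of_real_mult)
    then show "of_real (nbinom p n) * (cnj z * w) ^ n = cnj (coh p z n) * coh p w n"
      by (simp add: coh_def power_mult_distrib mult_ac)
  qed
qed

lemma coh_l2:
  assumes p: "p > -1" and z: "cmod z < 1"
  shows "coh p z \<in> l2" "(norm2 NN (coh p z))\<^sup>2 = (1 - (cmod z)\<^sup>2) powr (- (p + 1))"
proof -
  have pos: "0 \<le> 1 - (cmod z)\<^sup>2" using z by (simp add: power_le_one)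
  have "(\<lambda>n. complex_of_real ((cmod (coh p z n))\<^sup>2)) sums (1 - cnj z * z) powr (- of_real (p + 1))"
    using coh_inner_sums[OF p z z] by (simp add: complex_norm_square mult.commute del: of_real_power)
  also have "(1 - cnj z * z) powr (- of_real (p + 1)) = of_real ((1 - (cmod z)\<^sup>2) powr (- (p + 1)))"
  proof -
    have "1 - cnj z * z = of_real (1 - (cmod z)\<^sup>2)" by (simp add: complex_norm_square mult.commute del: of_real_power)
    then show ?thesis using powr_of_real[OF pos, of "- (p + 1)"] by simp
  qed
  finally have "(\<lambda>n. (cmod (coh p z n))\<^sup>2) sums (1 - (cmod z)\<^sup>2) powr (- (p + 1))"
    by (simp only: sums_of_real_iff)
  from l2_sumsI[OF this] show "coh p z \<in> l2" "(norm2 NN (coh p z))\<^sup>2 = (1 - (cmod z)\<^sup>2) powr (- (p + 1))"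
    by auto
qed

text \<open>The map w -> 1/w - 1 takes the half-plane Re w > 1/2 to the unit disc; for w =
  \<open>wfun s t\<close> the numerator is 2 s.\<close>

lemma norm_cayley:
  fixes w :: complex
  assumes "w \<noteq> 0" shows "1 - (cmod (1 / w - 1))\<^sup>2 = (2 * Re w - 1) / (cmod w)\<^sup>2"
proof -
  have "1 / w - 1 = (1 - w) / w" using assms by (simp add: diff_divide_distrib)
  then have "(cmod (1 / w - 1))\<^sup>2 = (cmod (1 - w))\<^sup>2 / (cmod w)\<^sup>2" by (simp add: norm_divide power_divide)
  also have "(cmod (1 - w))\<^sup>2 = (cmod w)\<^sup>2 - (2 * Re w - 1)"
    unfolding cmod_power2 by (simp add: power2_eq_square algebra_simps)
  finally show ?thesis using assms by (simp add: field_simps)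
qed

lemma cayley_less_1:
  assumes "s > 0" shows "cmod (1 / wfun s t - 1) < 1"
proof -
  have "1 - (cmod (1 / wfun s t - 1))\<^sup>2 > 0"
    unfolding norm_cayley[OF wfun_props(2)[OF assms]] using assms wfun_props(2)[OF assms, of t]
    by (intro divide_pos_pos) (auto simp: wfun_def)
  then show ?thesis by (simp add: power_less_one_iff abs_square_less_1)
qed

lemma evol_l2: "p > -1 \<Longrightarrow> s > 0 \<Longrightarrow> evol p s t \<in> l2"
  unfolding evol_def[abs_def] l2_eq_sq_int
  by (intro sq_int_scale) (simp add: coh_l2(1) cayley_less_1 flip: l2_eq_sq_int)

text \<open>Equality in Bessel's inequality, checked by evaluating both norms: the binomial series
  at the coherent point on one side, a Gamma integral on the other. With a = s + 1/2 the powers of a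
  cancel. Completeness statements below all go back to this computation.\<close>

lemma hfun_expands:
  assumes p: "p > -1" and s: "s > 0" shows "expands p (hfun p s)"
proof (rule expandsI_parseval[OF p sq_int_hfun(1)[OF p s]])
  define a where "a = s + 1/2"
  have a: "a > 0" "wfun s 0 = of_real a" using s by (simp_all add: a_def wfun_def)
  have G: "Gamma (p + 1) > 0" using p by (intro Gamma_real_pos) auto
  have c: "coef p (hfun p s) = evol p s 0"
    by (rule ext) (rule coef_modul_hfun[OF p s, of 0, unfolded modul_0])
  have "wfun s 0 powr (- of_real (p + 1)) = of_real (a powr (- (p + 1)))"
    unfolding a(2) using powr_of_real[of a "- (p + 1)"] a(1) by (simp only: of_real_minus less_imp_le)
  then have e: "evol p s 0 = (\<lambda>n. of_real (sqrt (Gamma (p + 1)) * a powr (- (p + 1))) * coh p (1 / wfun s 0 - 1) n)"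
    by (simp add: evol_def fun_eq_iff)
  have r: "2 * Re (wfun s 0) - 1 = 2 * s" "cmod (wfun s 0) = a"
    unfolding a(2) norm_of_real using a(1) by (simp_all add: a_def)
  have "(norm2 NN (evol p s 0))\<^sup>2 = (sqrt (Gamma (p + 1)) * a powr (- (p + 1)))\<^sup>2 * (2 * s / a\<^sup>2) powr (- (p + 1))"
    unfolding e norm2_scale power_mult_distrib coh_l2(2)[OF p cayley_less_1[OF s]]
      norm_cayley[OF wfun_props(2)[OF s]] r norm_of_real power2_abs ..
  also have "\<dots> = Gamma (p + 1) * ((a powr (- (p + 1)))\<^sup>2 * (2 * s / a\<^sup>2) powr (- (p + 1)))"
    using G by (simp add: power_mult_distrib)
  also have "(a powr (- (p + 1)))\<^sup>2 * (2 * s / a\<^sup>2) powr (- (p + 1)) = (2 * s) powr (- (p + 1))"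
  proof -
    have "(a powr (- (p + 1)))\<^sup>2 = (a\<^sup>2) powr (- (p + 1))"
      using a by (simp add: power2_eq_square powr_mult)
    then show ?thesis using a s by (simp add: powr_mult[symmetric])
  qed
  finally have "(norm2 NN (coef p (hfun p s)))\<^sup>2 = (norm2 PP (hfun p s))\<^sup>2"
    unfolding c sq_int_hfun(2)[OF p s] .
  then show "norm2 NN (coef p (hfun p s)) = norm2 PP (hfun p s)"
    by (rule power2_eq_imp_eq) simp_all
qed

lemma polynomial_function_complex_sum:
  fixes g :: "real \<Rightarrow> complex"
  assumes "polynomial_function g"
  shows "\<exists>c N. \<forall>y. g y = (\<Sum>j\<le>N. c j * of_real y ^ j)"
proof -
  have "real_polynomial_function (Re \<circ> g)" "real_polynomial_function (Im \<circ> g)"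
    using assms bounded_linear_Re bounded_linear_Im by (auto simp: polynomial_function_def)
  then obtain a n b m where ab: "Re \<circ> g = (\<lambda>x. \<Sum>i\<le>n. a i * x ^ i)" "Im \<circ> g = (\<lambda>x. \<Sum>i\<le>m. b i * x ^ i)"
    by (auto simp: real_polynomial_function_iff_sum)
  define a' where "a' = (\<lambda>i::nat. if i \<le> n then a i else (0::real))"
  define b' where "b' = (\<lambda>i::nat. if i \<le> m then b i else (0::real))"
  have "(\<Sum>i\<le>n. a i * x ^ i) = (\<Sum>i\<le>n + m. a' i * x ^ i)" for x
    by (rule sum.mono_neutral_cong_left) (auto simp: a'_def)
  moreover have "(\<Sum>i\<le>m. b i * x ^ i) = (\<Sum>i\<le>n + m. b' i * x ^ i)" for x
    by (rule sum.mono_neutral_cong_left) (auto simp: b'_def)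
  ultimately have *: "Re (g x) = (\<Sum>i\<le>n + m. a' i * x ^ i)" "Im (g x) = (\<Sum>i\<le>n + m. b' i * x ^ i)" for x
    using ab by (auto simp: o_def fun_eq_iff)
  have "g y = (\<Sum>j\<le>n + m. Complex (a' j) (b' j) * of_real y ^ j)" for y
    by (rule complex_eqI) (auto simp: * Re_sum Im_sum simp flip: of_real_power)
  then show ?thesis by (intro exI[of _ "\<lambda>j. Complex (a' j) (b' j)"] exI[of _ "n + m"]) simp
qed

text \<open>Weierstrass approximation in the variable \<open>exp (- x)\<close>.\<close>
lemma hfun_approx:
  fixes Q :: "real \<Rightarrow> complex"
  assumes Q: "continuous_on {0..} Q" and lim: "(Q \<longlongrightarrow> 0) at_top" and \<epsilon>: "\<epsilon> > 0"
  shows "\<exists>c N. \<forall>x>0. cmod (of_real (x powr (p / 2) * exp (- x / 4)) * Q x - (\<Sum>j\<le>N. c j * hfun p (1/4 + real j) x))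
            \<le> \<epsilon> * (x powr (p / 2) * exp (- x / 4))"
proof -
  \<comment> \<open>\<open>Q\<close> pulled back along x = - ln y. The value 0 at y = 0 is the limit
    of \<open>Q\<close> at infinity, which is what makes the function continuous up to that
    endpoint.\<close>
  define G where "G = (\<lambda>y. if y \<le> 0 then 0 else Q (- ln y))"
  have "continuous_on {0..1} G"
    unfolding continuous_on_def
  proof
    fix y :: real assume y: "y \<in> {0..1}"
    show "(G \<longlongrightarrow> G y) (at y within {0..1})"
    proof (cases "y = 0")
      case True
      have l: "filterlim (\<lambda>y. - ln y) at_top (at_right (0::real))"
        using ln_at_0 by (simp add: filterlim_uminus_at_top)
      have "((\<lambda>y. Q (- ln y)) \<longlongrightarrow> 0) (at_right 0)"
        by (rule filterlim_compose[OF lim l])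
      then have "(G \<longlongrightarrow> 0) (at_right 0)"
        by (rule Lim_transform_eventually) (auto simp: G_def eventually_at_right_less eventually_at_filter)
      then show ?thesis using True by (simp add: G_def at_within_Icc_at_right)
    next
      case False
      then have "y \<in> {0<..1}" using y by auto
      moreover have "continuous_on {0<..1} (\<lambda>y. Q (- ln y))"
        by (rule continuous_on_compose2[OF Q]) (auto intro!: continuous_intros)
      ultimately have "((\<lambda>y. Q (- ln y)) \<longlongrightarrow> Q (- ln y)) (at y within {0<..1})"
        by (simp add: continuous_on_def)
      also have "at y within {0<..1} = at y within {0..1}"
        by (rule at_within_nhd[of y "{0<..}"]) (use False y in auto)
      finally have "((\<lambda>y. Q (- ln y)) \<longlongrightarrow> G y) (at y within {0..1})" using False y by (simp add: G_def)
      moreover have "\<forall>\<^sub>F x in at y within {0..1}. Q (- ln x) = G x"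
        unfolding eventually_at_topological
        by (rule exI[of _ "{0<..}"]) (use False y in \<open>auto simp: G_def\<close>)
      ultimately show ?thesis by (rule Lim_transform_eventually)
    qed
  qed
  from Stone_Weierstrass_polynomial_function[OF _ this \<epsilon>]
  obtain g where g: "polynomial_function g" "\<And>y. y \<in> {0..1} \<Longrightarrow> cmod (G y - g y) < \<epsilon>" by auto
  from polynomial_function_complex_sum[OF g(1)] obtain c N
    where c: "\<And>y. g y = (\<Sum>j\<le>N. c j * of_real y ^ j)" by blast
  show ?thesis
  proof (intro exI allI impI)
    fix x :: real assume x: "x > 0"
    define k where "k = x powr (p / 2) * exp (- x / 4)"
    \<comment> \<open>Each power of y = exp(- x) raises the rate by one; this is the origin of the
      rates 1/4 + j.\<close>
    have h: "hfun p (1/4 + real j) x = of_real k * of_real (exp (- x)) ^ j" for j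
    proof -
      have "exp (- (1/4 + real j) * x) = exp (- x / 4) * exp (- x) ^ j"
        unfolding exp_of_nat_mult[symmetric] exp_add[symmetric] by (simp add: algebra_simps)
      then show ?thesis by (simp add: hfun_def k_def)
    qed
    have s: "(\<Sum>j\<le>N. c j * hfun p (1/4 + real j) x) = of_real k * g (exp (- x))"
      unfolding c h sum_distrib_left by (simp add: mult_ac)
    have "of_real k * Q x - (\<Sum>j\<le>N. c j * hfun p (1/4 + real j) x) = of_real k * (G (exp (- x)) - g (exp (- x)))"
      unfolding s by (simp add: G_def algebra_simps not_le)
    then have "cmod (of_real k * Q x - (\<Sum>j\<le>N. c j * hfun p (1/4 + real j) x)) = k * cmod (G (exp (- x)) - g (exp (- x)))"
      by (simp add: norm_mult k_def)
    also have "\<dots> \<le> k * \<epsilon>" using g(2)[of "exp (- x)"] x by (intro mult_left_mono) (auto simp: k_def)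
    finally show "cmod (of_real (x powr (p / 2) * exp (- x / 4)) * Q x - (\<Sum>j\<le>N. c j * hfun p (1/4 + real j) x))
            \<le> \<epsilon> * (x powr (p / 2) * exp (- x / 4))"
      by (simp add: k_def mult_ac)
  qed
qed

lemma expands_weighted:
  assumes p: "p > -1" and Q: "continuous_on {0..} Q" "(Q \<longlongrightarrow> 0) at_top" and F: "F \<in> sq_int PP"
    and FQ: "\<And>x. x > 0 \<Longrightarrow> F x = of_real (x powr (p / 2) * exp (- x / 4)) * Q x"
  shows "expands p F"
proof (rule expands_approx[OF p F])
  fix \<epsilon> :: real assume \<epsilon>: "\<epsilon> > 0"
  define H where "H = norm2 PP (hfun p (1/4))"
  have H: "H \<ge> 0" by (simp add: H_def)
  define \<delta> where "\<delta> = \<epsilon> / (H + 1)"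
  have \<delta>: "\<delta> > 0" using \<epsilon> H by (simp add: \<delta>_def)
  from hfun_approx[OF Q \<delta>, of p] obtain c N where cN: "\<And>x. x > 0 \<Longrightarrow>
      cmod (of_real (x powr (p / 2) * exp (- x / 4)) * Q x - (\<Sum>j\<le>N. c j * hfun p (1/4 + real j) x))
            \<le> \<delta> * (x powr (p / 2) * exp (- x / 4))" by blast
  define G where "G = (\<lambda>x. \<Sum>j\<le>N. c j * hfun p (1/4 + real j) x)"
  have G: "expands p G"
    unfolding G_def by (intro expands_sum expands_scale hfun_expands p) auto
  have "norm2 PP (\<lambda>x. F x - G x) \<le> \<delta> * norm2 PP (hfun p (1/4))"
  proof (rule sq_int_dominated(2)[OF sq_int_hfun(1)[OF p]])
    show "(\<lambda>x. F x - G x) \<in> borel_measurable PP"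
      using F G by (intro sq_int_measurable sq_int_diff) (auto simp: expands_def)
    show "cmod (F x - G x) \<le> \<delta> * cmod (hfun p (1/4) x)" if "x \<in> space PP" for x
      using cN[of x] that by (simp add: FQ G_def cmod_hfun)
  qed (use \<delta> in auto)
  also have "\<dots> \<le> \<epsilon>"
    using \<epsilon> H unfolding H_def[symmetric] \<delta>_def by (simp add: divide_le_eq)
  finally show "\<exists>G. expands p G \<and> norm2 PP (\<lambda>x. F x - G x) \<le> \<epsilon>" using G by blast
qed

text \<open>Divided by the weight of rate 1/4, the Laguerre function still decays: of the rate 1/2,
  another 1/8 pays for the polynomial and 1/8 is left. The unimodular factor affects neither
  continuity nor decay, so the approximation theorem applies.\<close>

lemma expands_modul_lag:
  assumes p: "p > -1" shows "expands p (modul t (lag p n))"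
proof (rule expands_weighted[OF p])
  define Q where "Q = (\<lambda>x. exp (- \<i> * of_real t * of_real x) * of_real (exp (- x / 4) * laguerre p n x / sqrt (Gamma (p + 1))))"
  show "continuous_on {0..} Q"
    unfolding Q_def divide_inverse by (intro continuous_intros laguerre_continuous)
  obtain C where C: "\<forall>x\<ge>0. \<bar>laguerre p n x\<bar> \<le> C * exp (1/8 * x)"
    using laguerre_exp_bound[of "1/8" p n] by auto
  have G: "Gamma (p + 1) > 0" using p by (intro Gamma_real_pos) auto
  have Qb: "norm (Q x) \<le> C / sqrt (Gamma (p + 1)) * exp (- x / 8)" if "x \<ge> 0" for x
  proof -
    have "norm (Q x) = exp (- x / 4) * \<bar>laguerre p n x\<bar> / sqrt (Gamma (p + 1))"
      unfolding Q_def norm_mult cmod_exp_ix norm_of_real using G by (simp add: abs_mult)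
    also have "\<dots> \<le> exp (- x / 4) * (C * exp (1/8 * x)) / sqrt (Gamma (p + 1))"
      using C that G by (intro divide_right_mono mult_left_mono) auto
    also have "exp (- x / 4) * (C * exp (1/8 * x)) = C * exp (- x / 8)"
    proof -
      have "exp (- x / 4) * exp (1/8 * x) = exp (- x / 8)" unfolding exp_add[symmetric] by simp
      then show ?thesis by (simp add: mult.left_commute)
    qed
    finally show ?thesis by simp
  qed
  show "(Q \<longlongrightarrow> 0) at_top"
  proof (rule Lim_null_comparison)
    show "\<forall>\<^sub>F x in at_top. norm (Q x) \<le> C / sqrt (Gamma (p + 1)) * exp (- x / 8)"
      by (rule eventually_mono[OF eventually_ge_at_top[of 0]]) (rule Qb)
    have "((\<lambda>x::real. exp (- x / 8)) \<longlongrightarrow> 0) at_top" by real_asymp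
    from tendsto_mult_left[OF this, of "C / sqrt (Gamma (p + 1))"]
    show "((\<lambda>x. C / sqrt (Gamma (p + 1)) * exp (- x / 8)) \<longlongrightarrow> 0) at_top" by simp
  qed
  show "modul t (lag p n) \<in> sq_int PP" by (intro sq_int_modul sq_int_lag p)
  fix x :: real assume "x > 0"
  have "exp (- x / 2) = exp (- x / 4) * exp (- x / 4)" unfolding exp_add[symmetric] by simp
  then show "modul t (lag p n) x = of_real (x powr (p / 2) * exp (- x / 4)) * Q x"
    by (simp add: modul_def lag_def laguerre_fun_def sqrt_laguerre_weight[OF p] Q_def)
qed

section \<open>The unitary group\<close>

text \<open>Row m of the matrix of exp(- i J t): \<open>ip\<close> conjugates its first argument,
  and as the Laguerre functions are real this turns the coefficients of \<open>modul (- t)\<close>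
  into those of \<open>modul t\<close>. Working with rows avoids summing an infinite series in L2 of
  the half-line.\<close>

definition evo :: "real \<Rightarrow> real \<Rightarrow> (nat \<Rightarrow> complex) \<Rightarrow> nat \<Rightarrow> complex" where
  "evo p t f m = ip NN (coef p (modul (- t) (lag p m))) f"

lemma row_l2: "p > -1 \<Longrightarrow> coef p (modul t (lag p m)) \<in> l2"
  by (intro bessel(1) sq_int_modul sq_int_lag)

lemma evo_linear:
  assumes "p > -1" "f \<in> l2" "g \<in> l2"
  shows "evo p t (\<lambda>n. a * f n + b * g n) = (\<lambda>n. a * evo p t f n + b * evo p t g n)"
  using assms row_l2[OF assms(1)] unfolding l2_eq_sq_int
  by (simp add: evo_def ip_add_right ip_scale_right sq_int_scale fun_eq_iff)

lemma evo_diff: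
  assumes "p > -1" "f \<in> l2" "g \<in> l2"
  shows "evo p t (\<lambda>n. f n - g n) m = evo p t f m - evo p t g m"
  using assms row_l2[OF assms(1)] unfolding l2_eq_sq_int
  by (simp add: evo_def ip_diff_right)

text \<open>Parseval's identity turns the row-wise definition into multiplication by exp(- i t x);
  the group law and the computation of the generator both rest on this.\<close>

lemma evo_coef:
  assumes p: "p > -1" and F: "expands p F"
  shows "evo p t (coef p F) = coef p (modul t F)"
proof
  fix m
  have Fs: "F \<in> sq_int PP" using F by (simp add: expands_def)
  have "(\<lambda>n. cnj (coef p (modul (- t) (lag p m)) n) * coef p F n) sums ip PP (modul (- t) (lag p m)) F"
    by (rule parseval_sums[OF p F sq_int_modul[OF sq_int_lag[OF p]]])
  moreover have "(\<lambda>n. cnj (coef p (modul (- t) (lag p m)) n) * coef p F n) sums evo p t (coef p F) m"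
    unfolding evo_def by (rule ip_NN_sums[OF row_l2[OF p] bessel(1)[OF p Fs]])
  ultimately have "evo p t (coef p F) m = ip PP (modul (- t) (lag p m)) F" by (rule sums_unique2[symmetric])
  also have "\<dots> = coef p (modul t F) m"
    unfolding coef_eq ip_def by (rule Bochner_Integration.integral_cong) (auto simp: modul_def exp_cnj mult_ac)
  finally show "evo p t (coef p F) m = coef p (modul t F) m" .
qed

lemma expands_modul_syn: "p > -1 \<Longrightarrow> expands p (modul t (syn p N u))"
proof -
  assume p: "p > -1"
  have "modul t (syn p N u) = (\<lambda>x. \<Sum>n<N. u n * modul t (lag p n) x)"
    by (simp add: modul_def syn_def sum_distrib_left mult_ac fun_eq_iff)
  then show ?thesis using p by (auto intro!: expands_sum expands_scale expands_modul_lag)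
qed

lemma expands_syn: "p > -1 \<Longrightarrow> expands p (syn p N u)"
  using expands_modul_syn[of p 0] by (simp add: modul_0)

lemma coef_syn_trunc: "p > -1 \<Longrightarrow> coef p (syn p N u) = trunc N u"
  by (simp add: coef_syn trunc_def fun_eq_iff)

lemma evo_trunc: "p > -1 \<Longrightarrow> evo p t (trunc N u) = coef p (modul t (syn p N u))"
  using evo_coef[OF _ expands_syn, of p t N u] by (simp add: coef_syn_trunc)

lemma norm2_syn_trunc: "p > -1 \<Longrightarrow> norm2 PP (syn p N u) = norm2 NN (trunc N u)"
  by (rule power2_eq_imp_eq) (simp_all add: norm2_syn norm2_trunc)

lemma evo_pointwise:
  assumes p: "p > -1" and f: "f \<in> l2"
  shows "(\<lambda>N. evo p t (trunc N f) m) \<longlonglongrightarrow> evo p t f m"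
proof -
  have d: "(\<lambda>n. f n - trunc N f n) \<in> l2" for N
    using f trunc_l2 unfolding l2_eq_sq_int by (intro sq_int_diff)
  have "(\<lambda>N. evo p t f m - evo p t (trunc N f) m) \<longlonglongrightarrow> 0"
  proof (rule Lim_null_comparison)
    define r where "r = norm2 NN (coef p (modul (- t) (lag p m)))"
    show "\<forall>\<^sub>F N in sequentially. norm (evo p t f m - evo p t (trunc N f) m) \<le> r * norm2 NN (\<lambda>n. f n - trunc N f n)"
      unfolding evo_diff[OF p f trunc_l2, symmetric]
      unfolding r_def evo_def using d row_l2[OF p] unfolding l2_eq_sq_int
      by (intro always_eventually allI cmod_ip_le) auto
    show "(\<lambda>N. r * norm2 NN (\<lambda>n. f n - trunc N f n)) \<longlonglongrightarrow> 0"
      using tendsto_mult_left[OF trunc_tendsto[OF f], of r] by simp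
  qed
  from tendsto_diff[OF tendsto_const[of "evo p t f m"] this] show ?thesis by simp
qed

text \<open>A Fatou argument: for truncations the bound is Bessel's inequality, and for fixed M the
  first M components are continuous along truncations, so the bound survives in the partial sums and
  then in the norm.\<close>

lemma evo_contraction:
  assumes p: "p > -1" and f: "f \<in> l2"
  shows "evo p t f \<in> l2" "norm2 NN (evo p t f) \<le> norm2 NN f"
proof -
  have "(\<Sum>m<M. (cmod (evo p t f m))\<^sup>2) \<le> (norm2 NN f)\<^sup>2" for M
  proof (rule LIMSEQ_le_const2)
    show "(\<lambda>N. \<Sum>m<M. (cmod (evo p t (trunc N f) m))\<^sup>2) \<longlonglongrightarrow> (\<Sum>m<M. (cmod (evo p t f m))\<^sup>2)"
      by (intro tendsto_intros evo_pointwise p f)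
    have "(\<Sum>m<M. (cmod (evo p t (trunc N f) m))\<^sup>2) \<le> (norm2 NN f)\<^sup>2" for N
    proof -
      note S = sq_int_modul[OF sq_int_syn[OF p], of t N f]
      have "(\<Sum>m<M. (cmod (evo p t (trunc N f) m))\<^sup>2) \<le> (norm2 NN (coef p (modul t (syn p N f))))\<^sup>2"
        unfolding evo_trunc[OF p] by (rule l2_partial_sum_le[OF bessel(1)[OF p S]])
      also have "\<dots> \<le> (norm2 NN f)\<^sup>2"
        using order_trans[OF bessel(2)[OF p S]] norm2_trunc_le[OF f, of N]
        by (intro power_mono) (simp_all add: norm2_syn_trunc[OF p])
      finally show ?thesis .
    qed
    then show "\<exists>N0. \<forall>N\<ge>N0. (\<Sum>m<M. (cmod (evo p t (trunc N f) m))\<^sup>2) \<le> (norm2 NN f)\<^sup>2" by blast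
  qed
  note * = l2_partial_sums_le[OF this norm2_nonneg]
  show "evo p t f \<in> l2" "norm2 NN (evo p t f) \<le> norm2 NN f" by (rule *)+
qed

lemma l2_eqI:
  assumes "f \<in> l2" "g \<in> l2" "\<And>\<epsilon>. \<epsilon> > 0 \<Longrightarrow> norm2 NN (\<lambda>n. f n - g n) \<le> \<epsilon>"
  shows "f = g"
proof
  fix n
  have d: "(\<lambda>n. f n - g n) \<in> l2" using assms(1,2) unfolding l2_eq_sq_int by (rule sq_int_diff)
  have "norm2 NN (\<lambda>n. f n - g n) \<le> 0" by (rule field_le_epsilon) (use assms(3) in auto)
  then have "cmod (f n - g n) \<le> 0" using cmod_le_norm2_NN[OF d, of n] by linarith
  then show "f n = g n" by simp
qed

lemma modul_modul: "modul s (modul t F) = modul (s + t) F"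
  by (simp add: modul_def fun_eq_iff algebra_simps flip: exp_add)

lemma l2_diff: "f \<in> l2 \<Longrightarrow> g \<in> l2 \<Longrightarrow> (\<lambda>n. f n - g n) \<in> l2"
  unfolding l2_eq_sq_int by (rule sq_int_diff)

text \<open>For truncations both sides are multiplication operators; since the intermediate sequence
  is no longer finite, this requires that modulated partial sums expand. The general case follows
  because each factor is a contraction.\<close>

lemma evo_group:
  assumes p: "p > -1" and f: "f \<in> l2"
  shows "evo p s (evo p t f) = evo p (s + t) f"
proof
  fix m
  have tr: "evo p s (evo p t (trunc N f)) = evo p (s + t) (trunc N f)" for N
    unfolding evo_trunc[OF p] evo_coef[OF p expands_modul_syn[OF p]] modul_modul ..
  have "(\<lambda>N. evo p s (evo p t f) m - evo p s (evo p t (trunc N f)) m) \<longlonglongrightarrow> 0"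
  proof (rule Lim_null_comparison)
    show "\<forall>\<^sub>F N in sequentially. norm (evo p s (evo p t f) m - evo p s (evo p t (trunc N f)) m)
        \<le> norm2 NN (\<lambda>n. f n - trunc N f n)"
    proof (intro always_eventually allI)
      fix N
      note d = l2_diff[OF f trunc_l2[of N f]]
      note e = evo_contraction[OF p d, of t]
      have eq: "evo p s (evo p t f) m - evo p s (evo p t (trunc N f)) m = evo p s (evo p t (\<lambda>n. f n - trunc N f n)) m"
        unfolding evo_diff[OF p evo_contraction(1)[OF p f] evo_contraction(1)[OF p trunc_l2], symmetric]
          evo_diff[OF p f trunc_l2, symmetric] ..
      show "norm (evo p s (evo p t f) m - evo p s (evo p t (trunc N f)) m) \<le> norm2 NN (\<lambda>n. f n - trunc N f n)"
        unfolding eq using cmod_le_norm2_NN[OF evo_contraction(1)[OF p e(1)], of s m]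
          evo_contraction(2)[OF p e(1), of s] e(2) by linarith
    qed
    show "(\<lambda>N. norm2 NN (\<lambda>n. f n - trunc N f n)) \<longlonglongrightarrow> 0" by (rule trunc_tendsto[OF f])
  qed
  from tendsto_diff[OF tendsto_const[of "evo p s (evo p t f) m"] this]
  have "(\<lambda>N. evo p (s + t) (trunc N f) m) \<longlonglongrightarrow> evo p s (evo p t f) m" by (simp add: tr)
  then show "evo p s (evo p t f) m = evo p (s + t) f m"
    using evo_pointwise[OF p f] LIMSEQ_unique by blast
qed

lemma ip_single: "ip NN (\<lambda>n. if n = k then 1 else 0) f = f k"
proof -
  have "integrable NN (\<lambda>n. cnj (if n = k then 1 else 0) * f n)"
    unfolding integrable_count_space_nat_iff by (rule summable_finite[of "{k}"]) auto
  then have "(\<lambda>n. cnj (if n = k then 1 else 0) * f n) sums ip NN (\<lambda>n. if n = k then 1 else 0) f"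
    unfolding ip_def by (rule sums_integral_count_space_nat)
  moreover have "(\<lambda>n. cnj (if n = k then 1 else 0) * f n) sums (\<Sum>n\<in>{k}. cnj (if n = k then 1 else 0) * f n)"
    by (rule sums_finite) auto
  ultimately show ?thesis using sums_unique2 by fastforce
qed

lemma evo_0: "p > -1 \<Longrightarrow> evo p 0 f = f"
proof
  fix m assume p: "p > -1"
  have "coef p (lag p m) = (\<lambda>n. if n = m then 1 else 0)" by (auto simp: coef_lag[OF p])
  then show "evo p 0 f m = f m" by (simp add: evo_def modul_0 ip_single)
qed

text \<open>A contraction whose inverse, the evolution for time - t, is a contraction as
  well.\<close>

lemma evo_isometry:
  assumes p: "p > -1" and f: "f \<in> l2" shows "norm2 NN (evo p t f) = norm2 NN f"
proof (rule antisym)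
  have "evo p (- t) (evo p t f) = f" using evo_group[OF p f, of "- t" t] by (simp add: evo_0[OF p])
  then show "norm2 NN f \<le> norm2 NN (evo p t f)"
    using evo_contraction(2)[OF p evo_contraction(1)[OF p f, of t], of "- t"] by simp
qed (rule evo_contraction(2)[OF p f])

lemma expands_norm:
  assumes p: "p > -1" and F: "expands p F" shows "norm2 NN (coef p F) = norm2 PP F"
proof -
  have Fs: "F \<in> sq_int PP" using F by (simp add: expands_def)
  note c = bessel(1)[OF p Fs]
  have "ip NN (coef p F) (coef p F) = ip PP F F"
    by (rule sums_unique2[OF ip_NN_sums[OF c(1) c(1)] parseval_sums[OF p F Fs]])
  then have "(norm2 NN (coef p F))\<^sup>2 = (norm2 PP F)\<^sup>2"
    unfolding ip_self of_real_eq_iff .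
  then show ?thesis by (rule power2_eq_imp_eq) simp_all
qed

section \<open>The generator of the group\<close>

lemma sq_int_power_syn: "p > -1 \<Longrightarrow> (\<lambda>x. of_real (x ^ k) * syn p N u x) \<in> sq_int PP"
proof -
  assume p: "p > -1"
  have "(\<lambda>x. of_real (x ^ k) * syn p N u x) = (\<lambda>x. \<Sum>n<N. u n * (of_real (x ^ k) * lag p n x))"
    by (simp add: syn_def sum_distrib_left mult_ac)
  then show ?thesis using sq_int_lag_power[OF p] by (auto intro!: sq_int_sum sq_int_scale)
qed

lemma expands_lag: "p > -1 \<Longrightarrow> expands p (lag p n)"
  using expands_modul_lag[of p 0 n] by (simp add: modul_0)

lemma mult_x_syn:
  assumes p: "p > -1" and u: "trunc N u = u"
  shows "coef p (\<lambda>x. of_real x * syn p N u x) = lag_action p u"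
    "expands p (\<lambda>x. of_real x * syn p N u x)"
proof -
  have c: "coef p (syn p N u) = u" using coef_syn_trunc[OF p] u by simp
  show "coef p (\<lambda>x. of_real x * syn p N u x) = lag_action p u"
  proof
    fix n
    have "coef p (\<lambda>x. of_real x * syn p N u x) n = (\<integral>x. of_real x * lag p n x * syn p N u x \<partial>PP)"
      by (simp add: coef_eq mult_ac)
    also have "\<dots> = lag_action p u n"
      using coef_mult_x[OF p sq_int_syn[OF p], of n N u] by (simp only: c)
    finally show "coef p (\<lambda>x. of_real x * syn p N u x) n = lag_action p u n" .
  qed
  have eq: "(\<lambda>x. of_real x * syn p N u x) = (\<lambda>x. \<Sum>n<N. u n * (
      (if n = 0 then 0 else of_real (lag_a p (n - 1))) * lag p (n - 1) x
      + of_real (lag_b p n) * lag p n x + of_real (lag_a p n) * lag p (n + 1) x))"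
  proof
    fix x
    have "of_real x * syn p N u x = (\<Sum>n<N. u n * lag_action p (\<lambda>n. lag p n x) n)"
      unfolding lag_action_lag[OF p] by (simp add: syn_def sum_distrib_left mult_ac)
    also have "\<dots> = (\<Sum>n<N. u n * (
      (if n = 0 then 0 else of_real (lag_a p (n - 1))) * lag p (n - 1) x
      + of_real (lag_b p n) * lag p n x + of_real (lag_a p n) * lag p (n + 1) x))"
      by (intro sum.cong refl) (simp add: lag_action_def)
    finally show "of_real x * syn p N u x = (\<Sum>n<N. u n * (
      (if n = 0 then 0 else of_real (lag_a p (n - 1))) * lag p (n - 1) x
      + of_real (lag_b p n) * lag p n x + of_real (lag_a p n) * lag p (n + 1) x))" .
  qed
  show "expands p (\<lambda>x. of_real x * syn p N u x)"
    unfolding eq by (intro expands_sum expands_scale expands_add expands_lag p)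
qed

lemma lag_action_finite:
  assumes p: "p > -1" and u: "u \<in> finite_seqs" shows "lag_action p u \<in> l2"
proof -
  obtain N where N: "trunc N u = u" using u finite_seqsE by blast
  have "expands p (\<lambda>x. of_real x * syn p N u x)" by (rule mult_x_syn(2)[OF p N])
  then show ?thesis
    using bessel(1)[OF p] mult_x_syn(1)[OF p N] by (metis expands_def)
qed

text \<open>On the half-line the error is the second-order Taylor remainder of exp(- i t x) divided
  by t, at most |t|/2 x^2 times the function; for a finite combination of Laguerre functions the
  second moment is square integrable.\<close>

lemma evo_diff_quotient:
  assumes p: "p > -1" and u: "u \<in> finite_seqs"
  shows "((\<lambda>t. norm2 NN (\<lambda>n. \<i> * (evo p t u n - u n) / of_real t - lag_action p u n)) \<longlongrightarrow> 0) (at 0)"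
proof -
  obtain N where N: "trunc N u = u" using u finite_seqsE by blast
  define S where "S = syn p N u"
  define Y where "Y = norm2 PP (\<lambda>x. of_real (x ^ 2) * S x)"
  have S: "S \<in> sq_int PP" "\<And>k. (\<lambda>x. of_real (x ^ k) * S x) \<in> sq_int PP" "coef p S = u"
    using sq_int_syn[OF p] sq_int_power_syn[OF p] coef_syn_trunc[OF p] N by (auto simp: S_def)
  have xS: "(\<lambda>x. of_real x * S x) \<in> sq_int PP" using S(2)[of 1] by simp
  have bound: "norm2 NN (\<lambda>n. \<i> * (evo p t u n - u n) / of_real t - lag_action p u n) \<le> \<bar>t\<bar> / 2 * Y"
    if t: "t \<noteq> 0" for t
  proof -
    define F where "F = (\<lambda>x. \<i> / of_real t * (modul t S x - S x) - of_real x * S x)"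
    have d: "(\<lambda>x. modul t S x - S x) \<in> sq_int PP" by (intro sq_int_diff sq_int_modul S)
    have Fs: "F \<in> sq_int PP" unfolding F_def by (intro sq_int_diff sq_int_scale d xS)
    have e: "evo p t u = coef p (modul t S)" using evo_trunc[OF p, of t N u] by (simp add: N S_def)
    have "(\<lambda>n. \<i> * (evo p t u n - u n) / of_real t - lag_action p u n) = coef p F"
      unfolding F_def coef_diff[OF p sq_int_scale[OF d] xS, abs_def] coef_scale[abs_def]
        coef_diff[OF p sq_int_modul[OF S(1)] S(1), abs_def] e S(3)
      using mult_x_syn(1)[OF p N] by (simp add: S_def)
    then have "norm2 NN (\<lambda>n. \<i> * (evo p t u n - u n) / of_real t - lag_action p u n) \<le> norm2 PP F"
      using bessel(2)[OF p Fs] by simp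
    also have "\<dots> \<le> \<bar>t\<bar> / 2 * norm2 PP (\<lambda>x. of_real (x ^ 2) * S x)"
    proof (rule sq_int_dominated(2)[OF S(2)])
      show "F \<in> borel_measurable PP" using Fs by (rule sq_int_measurable)
      fix x :: real
      have "F x = \<i> / of_real t * (exp (- \<i> * of_real (t * x)) - 1 + \<i> * of_real (t * x)) * S x"
        using t by (simp add: F_def modul_def field_simps)
      then have "cmod (F x) = cmod (exp (- \<i> * of_real (t * x)) - 1 + \<i> * of_real (t * x)) / \<bar>t\<bar> * cmod (S x)"
        by (simp only: norm_mult norm_divide norm_of_real) simp
      also have "\<dots> \<le> ((t * x)\<^sup>2 / 2) / \<bar>t\<bar> * cmod (S x)"
        by (intro mult_right_mono divide_right_mono exp_ix_approx) auto
      also have "\<dots> = \<bar>t\<bar> / 2 * (x\<^sup>2 * cmod (S x))"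
      proof -
        have "t\<^sup>2 / \<bar>t\<bar> = \<bar>t\<bar>" using t by (simp add: power2_eq_square divide_eq_eq)
        then show ?thesis by (simp add: power_mult_distrib) (metis (no_types) mult.commute mult.left_commute times_divide_eq_right)
      qed
      also have "x\<^sup>2 * cmod (S x) = cmod (of_real (x ^ 2) * S x)" by (simp add: norm_mult norm_power)
      finally show "cmod (F x) \<le> \<bar>t\<bar> / 2 * cmod (of_real (x ^ 2) * S x)" .
    qed simp
    finally show ?thesis by (simp add: Y_def)
  qed
  show ?thesis
  proof (rule tendsto_sandwich[OF _ _ tendsto_const])
    show "\<forall>\<^sub>F t in at 0. norm2 NN (\<lambda>n. \<i> * (evo p t u n - u n) / of_real t - lag_action p u n) \<le> \<bar>t\<bar> / 2 * Y"
      using bound by (auto simp: eventually_at_filter)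
    have "((\<lambda>t. \<bar>t\<bar> / 2 * Y) \<longlongrightarrow> \<bar>0\<bar> / 2 * Y) (at 0)" by (intro tendsto_intros) auto
    then show "((\<lambda>t. \<bar>t\<bar> / 2 * Y) \<longlongrightarrow> 0) (at 0)" by simp
  qed simp
qed

text \<open>The constant is the norm of the Jacobi action on \<open>u\<close>, not a second moment;
  only such a bound can be carried over to the operator closure.\<close>

lemma evo_lipschitz:
  assumes p: "p > -1" and u: "u \<in> finite_seqs"
  shows "norm2 NN (\<lambda>n. evo p t u n - u n) \<le> \<bar>t\<bar> * norm2 NN (lag_action p u)"
proof -
  obtain N where N: "trunc N u = u" using u finite_seqsE by blast
  define S where "S = syn p N u"
  have S: "S \<in> sq_int PP" "(\<lambda>x. of_real x * S x) \<in> sq_int PP" "coef p S = u"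
    using sq_int_syn[OF p] sq_int_power_syn[OF p, of 1] coef_syn_trunc[OF p] N by (auto simp: S_def)
  have d: "(\<lambda>x. modul t S x - S x) \<in> sq_int PP" by (intro sq_int_diff sq_int_modul S)
  have e: "evo p t u = coef p (modul t S)" using evo_trunc[OF p, of t N u] by (simp add: N S_def)
  have "(\<lambda>n. evo p t u n - u n) = coef p (\<lambda>x. modul t S x - S x)"
    unfolding coef_diff[OF p sq_int_modul[OF S(1)] S(1), abs_def] e S(3) ..
  then have "norm2 NN (\<lambda>n. evo p t u n - u n) \<le> norm2 PP (\<lambda>x. modul t S x - S x)"
    using bessel(2)[OF p d] by simp
  also have "\<dots> \<le> \<bar>t\<bar> * norm2 PP (\<lambda>x. of_real x * S x)"
  proof (rule sq_int_dominated(2)[OF S(2)])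
    show "(\<lambda>x. modul t S x - S x) \<in> borel_measurable PP" using d by (rule sq_int_measurable)
    fix x :: real
    have "modul t S x - S x = (exp (- \<i> * of_real (t * x)) - 1) * S x" by (simp add: modul_def algebra_simps)
    then have "cmod (modul t S x - S x) = cmod (exp (- \<i> * of_real (t * x)) - 1) * cmod (S x)"
      by (simp only: norm_mult)
    also have "\<dots> \<le> \<bar>t * x\<bar> * cmod (S x)" by (intro mult_right_mono exp_ix_approx0) simp
    also have "\<dots> = \<bar>t\<bar> * cmod (of_real x * S x)" by (simp add: abs_mult norm_mult)
    finally show "cmod (modul t S x - S x) \<le> \<bar>t\<bar> * cmod (of_real x * S x)" .
  qed simp
  also have "norm2 PP (\<lambda>x. of_real x * S x) = norm2 NN (lag_action p u)"
    unfolding S_def expands_norm[OF p mult_x_syn(2)[OF p N], symmetric] mult_x_syn(1)[OF p N] ..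
  finally show ?thesis .
qed

lemma lag_action_diff: "lag_action p (\<lambda>n. f n - g n) n = lag_action p f n - lag_action p g n"
  by (simp add: lag_action_def algebra_simps)

lemma finite_seqs_diff: "u \<in> finite_seqs \<Longrightarrow> v \<in> finite_seqs \<Longrightarrow> (\<lambda>n. u n - v n) \<in> finite_seqs"
  unfolding finite_seqs_def mem_Collect_eq
  by (rule finite_subset[of _ "{n. u n \<noteq> 0} \<union> {n. v n \<noteq> 0}"]) auto

lemma laguerre_opD:
  assumes p: "p > -1" and "(f, g) \<in> laguerre_op p"
  obtains u where "\<And>k. u k \<in> finite_seqs" "f \<in> l2" "g \<in> l2"
    "(\<lambda>k. norm2 NN (\<lambda>n. u k n - f n)) \<longlonglongrightarrow> 0" "(\<lambda>k. norm2 NN (\<lambda>n. lag_action p (u k) n - g n)) \<longlonglongrightarrow> 0"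
proof -
  from assms(2) obtain u v where fg: "f \<in> l2" "g \<in> l2"
    and uv: "\<And>k. (u k, v k) \<in> {(f, lag_action p f) | f. f \<in> finite_seqs}"
    and lim: "(\<lambda>k. l2_dist (u k) f) \<longlonglongrightarrow> 0" "(\<lambda>k. l2_dist (v k) g) \<longlonglongrightarrow> 0"
    unfolding laguerre_op_def op_closure_def by blast
  have u: "u k \<in> finite_seqs" "v k = lag_action p (u k)" for k using uv[of k] by auto
  have 1: "l2_dist (u k) f = norm2 NN (\<lambda>n. u k n - f n)" for k
    by (rule l2_dist_eq[OF finite_seqs_l2[OF u(1)] fg(1)])
  have 2: "l2_dist (v k) g = norm2 NN (\<lambda>n. lag_action p (u k) n - g n)" for k
    unfolding u(2) by (rule l2_dist_eq[OF lag_action_finite[OF p u(1)] fg(2)])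
  show ?thesis by (rule that[OF u(1) fg lim[unfolded 1 2]])
qed

lemma laguerre_opI:
  assumes p: "p > -1" and "f \<in> l2" "g \<in> l2" and u: "\<And>k. u k \<in> finite_seqs"
    "(\<lambda>k. norm2 NN (\<lambda>n. u k n - f n)) \<longlonglongrightarrow> 0" "(\<lambda>k. norm2 NN (\<lambda>n. lag_action p (u k) n - g n)) \<longlonglongrightarrow> 0"
  shows "(f, g) \<in> laguerre_op p"
proof -
  have 1: "l2_dist (u k) f = norm2 NN (\<lambda>n. u k n - f n)" for k
    by (rule l2_dist_eq[OF finite_seqs_l2[OF u(1)] assms(2)])
  have 2: "l2_dist (lag_action p (u k)) g = norm2 NN (\<lambda>n. lag_action p (u k) n - g n)" for k
    by (rule l2_dist_eq[OF lag_action_finite[OF p u(1)] assms(3)])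
  show ?thesis
    unfolding laguerre_op_def op_closure_def mem_Collect_eq case_prod_conv
    using u(1) u(2,3)[folded 1 2]
    by (intro conjI assms(2,3) exI[of _ u] exI[of _ "\<lambda>k. lag_action p (u k)"]) auto
qed

text \<open>The difference quotients of \<open>evo\<close> are bounded by the graph norm, so its generator is closed.\<close>
lemma laguerre_op_diff_quotient:
  assumes p: "p > -1" and fg: "(f, g) \<in> laguerre_op p"
  shows "((\<lambda>t. norm2 NN (\<lambda>n. \<i> * (evo p t f n - f n) / of_real t - g n)) \<longlongrightarrow> 0) (at 0)"
proof -
  from laguerre_opD[OF p fg] obtain u where u: "\<And>k. u k \<in> finite_seqs" and f: "f \<in> l2" and g: "g \<in> l2"
    and lim: "(\<lambda>k. norm2 NN (\<lambda>n. u k n - f n)) \<longlonglongrightarrow> 0" "(\<lambda>k. norm2 NN (\<lambda>n. lag_action p (u k) n - g n)) \<longlonglongrightarrow> 0"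
    by blast
  note ul = finite_seqs_l2[OF u] and vl = lag_action_finite[OF p u]
  define A where "A = (\<lambda>k. norm2 NN (\<lambda>n. u k n - f n))"
  define B where "B = (\<lambda>k. norm2 NN (\<lambda>n. lag_action p (u k) n - g n))"
  have el: "evo p t h \<in> l2" if "h \<in> l2" for t h by (rule evo_contraction(1)[OF p that])
  define D where "D = (\<lambda>t h n. evo p t h n - h n)"
  have Dl: "D t h \<in> l2" if "h \<in> l2" for t h unfolding D_def by (intro l2_diff el that)
  have D_diff: "D t (\<lambda>n. h n - h' n) = (\<lambda>n. D t h n - D t h' n)" if "h \<in> l2" "h' \<in> l2" for t h h'
    using that by (simp add: D_def evo_diff[OF p] fun_eq_iff)
  have D_norm: "norm2 NN (D t h) \<le> 2 * norm2 NN h" if h: "h \<in> l2" for t h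
    using norm2_triangle_diff[of "evo p t h" NN "\<lambda>n. 0" h] el[OF h] h evo_contraction(2)[OF p h, of t]
      norm2_minus_commute[of NN "\<lambda>n. 0" h]
    by (simp add: D_def l2_eq_sq_int sq_int_zero)
  \<comment> \<open>\<open>f\<close> minus \<open>u k\<close> lies only in the closure. The
    Lipschitz bound is applied to the finite sequence \<open>u j\<close> minus \<open>u k\<close>,
    and j tends to infinity; what is left is |t| times B k, which remains small uniformly in t after
    division by |t|.\<close>
  have key: "norm2 NN (D t (\<lambda>n. f n - u k n)) \<le> \<bar>t\<bar> * B k" for t k
  proof (rule LIMSEQ_le_const)
    show "(\<lambda>j. (2 * A j + \<bar>t\<bar> * (B j + B k))) \<longlonglongrightarrow> \<bar>t\<bar> * B k"
      using tendsto_add[OF tendsto_mult_left[OF lim(1), of 2]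
          tendsto_mult_left[OF tendsto_add[OF lim(2) tendsto_const[of "B k"]], of "\<bar>t\<bar>"]]
      by (simp add: A_def B_def)
    have "norm2 NN (D t (\<lambda>n. f n - u k n)) \<le> 2 * A j + \<bar>t\<bar> * (B j + B k)" for j
    proof -
      have a: "(\<lambda>n. u j n - f n) \<in> l2" "(\<lambda>n. f n - u k n) \<in> l2" "(\<lambda>n. u j n - u k n) \<in> l2"
        by (intro l2_diff ul f)+
      have "(\<lambda>n. f n - u k n) = (\<lambda>n. (u j n - u k n) - (u j n - f n))" by simp
      then have "D t (\<lambda>n. f n - u k n) = (\<lambda>n. D t (\<lambda>n. u j n - u k n) n - D t (\<lambda>n. u j n - f n) n)"
        using D_diff[OF a(3,1), of t] by simp
      then have "norm2 NN (D t (\<lambda>n. f n - u k n)) \<le> norm2 NN (D t (\<lambda>n. u j n - u k n)) + norm2 NN (D t (\<lambda>n. u j n - f n))"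
        using norm2_triangle_diff[of "D t (\<lambda>n. u j n - u k n)" NN "\<lambda>n. 0" "D t (\<lambda>n. u j n - f n)"] Dl[OF a(1)] Dl[OF a(3)]
          norm2_minus_commute[of NN "\<lambda>n. 0" "D t (\<lambda>n. u j n - f n)"]
        by (simp add: l2_eq_sq_int sq_int_zero)
      also have "norm2 NN (D t (\<lambda>n. u j n - f n)) \<le> 2 * A j" using D_norm[OF a(1)] by (simp add: A_def)
      also have "norm2 NN (D t (\<lambda>n. u j n - u k n)) \<le> \<bar>t\<bar> * norm2 NN (lag_action p (\<lambda>n. u j n - u k n))"
        unfolding D_def by (rule evo_lipschitz[OF p finite_seqs_diff[OF u u]])
      also have "norm2 NN (lag_action p (\<lambda>n. u j n - u k n)) \<le> B j + B k"
      proof -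
        have "lag_action p (\<lambda>n. u j n - u k n) = (\<lambda>n. lag_action p (u j) n - lag_action p (u k) n)"
          by (rule ext) (rule lag_action_diff)
        then show ?thesis
          using norm2_triangle_diff[of "lag_action p (u j)" NN g "lag_action p (u k)"] vl g
            norm2_minus_commute[of NN g "lag_action p (u k)"]
          by (simp add: B_def l2_eq_sq_int)
      qed
      finally show ?thesis by (simp add: mult_left_mono)
    qed
    then show "\<exists>N. \<forall>j\<ge>N. norm2 NN (D t (\<lambda>n. f n - u k n)) \<le> 2 * A j + \<bar>t\<bar> * (B j + B k)" by blast
  qed
  have bound: "norm2 NN (\<lambda>n. \<i> * D t f n / of_real t - g n)
      \<le> 2 * B k + norm2 NN (\<lambda>n. \<i> * D t (u k) n / of_real t - lag_action p (u k) n)" if t: "t \<noteq> 0" for t k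
  proof -
    define X where "X = (\<lambda>n. \<i> / of_real t * D t (\<lambda>n. f n - u k n) n)"
    define Y where "Y = (\<lambda>n. \<i> * D t (u k) n / of_real t - lag_action p (u k) n)"
    define Z where "Z = (\<lambda>n. lag_action p (u k) n - g n)"
    have Xl: "X \<in> sq_int NN" unfolding X_def by (rule sq_int_scale[OF Dl[OF l2_diff[OF f ul], unfolded l2_eq_sq_int]])
    have Yl: "Y \<in> sq_int NN" unfolding Y_def
      using sq_int_diff[OF sq_int_scale[OF Dl[OF ul, unfolded l2_eq_sq_int], of "\<i> / of_real t"] vl[unfolded l2_eq_sq_int]] by simp
    have Zl: "Z \<in> sq_int NN" unfolding Z_def using l2_diff[OF vl g] by (simp add: l2_eq_sq_int)
    have "(\<lambda>n. \<i> * D t f n / of_real t - g n) = (\<lambda>n. X n + (Y n + Z n))"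
      unfolding X_def Y_def Z_def D_diff[OF f ul] by (simp add: diff_divide_distrib right_diff_distrib)
    then have "norm2 NN (\<lambda>n. \<i> * D t f n / of_real t - g n) \<le> norm2 NN X + (norm2 NN Y + norm2 NN Z)"
      using norm2_triangle[OF Xl sq_int_add[OF Yl Zl]] norm2_triangle[OF Yl Zl] by simp
    also have "norm2 NN X \<le> B k"
      unfolding X_def norm2_scale using key[of t k] t by (simp add: norm_divide field_simps)
    also have "norm2 NN Z = B k" by (simp add: Z_def B_def)
    finally show ?thesis by (simp add: Y_def)
  qed
  have "((\<lambda>t. norm2 NN (\<lambda>n. \<i> * D t f n / of_real t - g n)) \<longlongrightarrow> 0) (at 0)"
  proof (rule tendstoI)
    fix e :: real assume e: "e > 0"
    have "B \<longlonglongrightarrow> 0" using lim(2) by (simp add: B_def)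
    then obtain k where "norm (B k - 0) < e / 4" using LIMSEQ_D[of B 0 "e / 4"] e by auto
    then have k: "2 * B k < e / 2" by simp
    have "\<forall>\<^sub>F t in at 0. norm2 NN (\<lambda>n. \<i> * D t (u k) n / of_real t - lag_action p (u k) n) < e / 2"
      using order_tendstoD(2)[OF evo_diff_quotient[OF p u[of k]], of "e / 2"] e by (simp add: D_def)
    moreover have "\<forall>\<^sub>F t in at 0. (t::real) \<noteq> 0" by (simp add: eventually_at_filter)
    ultimately show "\<forall>\<^sub>F t in at 0. dist (norm2 NN (\<lambda>n. \<i> * D t f n / of_real t - g n)) 0 < e"
    proof eventually_elim
      case (elim t)
      then show ?case using bound[OF elim(2), of k] k by simp
    qed
  qed
  then show ?thesis by (simp add: D_def)
qed

lemma ip_diff_left: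
  assumes "f \<in> sq_int M" "g \<in> sq_int M" "h \<in> sq_int M"
  shows "ip M (\<lambda>x. f x - g x) h = ip M f h - ip M g h"
  using ip_diff_right[OF assms(3,1,2)] by (metis complex_cnj_diff ip_cnj)

lemma ip_add_left:
  assumes "f \<in> sq_int M" "g \<in> sq_int M" "h \<in> sq_int M"
  shows "ip M (\<lambda>x. f x + g x) h = ip M f h + ip M g h"
  using ip_add_right[OF assms(3,1,2)] by (metis complex_cnj_add ip_cnj)

abbreviation unit_seq :: "nat \<Rightarrow> nat \<Rightarrow> complex" where
  "unit_seq m \<equiv> (\<lambda>n. if n = m then 1 else 0)"

lemma unit_seq_finite: "unit_seq m \<in> finite_seqs"
  by (rule finite_seqsI[of "Suc m"]) auto

lemma ip_lag_action_unit:
  assumes f: "f \<in> l2" shows "ip NN (lag_action p (unit_seq m)) f = lag_action p f m"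
proof -
  have eq: "lag_action p (unit_seq m) = (\<lambda>n. (if m = 0 then 0 else of_real (lag_a p (m - 1))) * unit_seq (m - 1) n
      + of_real (lag_b p m) * unit_seq m n + of_real (lag_a p m) * unit_seq (m + 1) n)"
    by (rule ext) (auto simp: lag_action_def)
  have u: "(\<lambda>n. c * unit_seq k n) \<in> sq_int NN" for c k
    using finite_seqs_l2[OF unit_seq_finite] unfolding l2_eq_sq_int by (rule sq_int_scale)
  have fs: "f \<in> sq_int NN" using f by (simp add: l2_eq_sq_int)
  show ?thesis
    unfolding eq ip_add_left[OF sq_int_add[OF u u] u fs] ip_add_left[OF u u fs] ip_scale_left ip_single
    by (simp add: lag_action_def)
qed

text \<open>Weak argument against unit sequences: each component of the difference quotient of
  \<open>f\<close> equals the pairing of \<open>f\<close> with the difference quotient of a unit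
  sequence at time - t, and the limit of the latter is known. So the generator acts as the formal
  Jacobi matrix on its whole domain.\<close>

lemma diff_quotient_eq_lag_action:
  assumes p: "p > -1" and f: "f \<in> l2" and g: "g \<in> l2"
    and lim: "((\<lambda>t. norm2 NN (\<lambda>n. \<i> * (evo p t f n - f n) / of_real t - g n)) \<longlongrightarrow> 0) (at 0)"
  shows "g = lag_action p f"
proof
  fix m
  define e where "e = unit_seq m"
  have ef: "e \<in> finite_seqs" and el: "e \<in> l2" "e \<in> sq_int NN"
    using unit_seq_finite finite_seqs_l2[OF unit_seq_finite] by (auto simp: e_def l2_eq_sq_int)
  have ce: "coef p (lag p m) = e" by (auto simp: coef_lag[OF p] e_def)
  have fs: "f \<in> sq_int NN" using f by (simp add: l2_eq_sq_int)
  define W where "W = (\<lambda>t n. \<i> * (evo p t e n - e n) / of_real t - lag_action p e n)"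
  have Wlim: "((\<lambda>t. norm2 NN (W (- t))) \<longlongrightarrow> 0) (at 0)"
  proof -
    have fl: "filterlim (\<lambda>t. - t) (at 0) (at (0::real))"
      by (auto simp: filterlim_at eventually_at_filter intro!: tendsto_eq_intros)
    show ?thesis unfolding W_def by (rule filterlim_compose[OF evo_diff_quotient[OF p ef] fl])
  qed
  have ve: "evo p t e \<in> sq_int NN" for t using evo_contraction(1)[OF p el(1)] by (simp add: l2_eq_sq_int)
  have qe: "(\<lambda>n. c * (evo p t e n - e n)) \<in> sq_int NN" for c t
    by (intro sq_int_scale sq_int_diff ve el)
  have Je: "lag_action p e \<in> sq_int NN" using lag_action_finite[OF p ef] by (simp add: l2_eq_sq_int)
  have W_alt: "W t = (\<lambda>n. \<i> / of_real t * (evo p t e n - e n) - lag_action p e n)" for t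
    by (simp add: W_def)
  have Ws: "W t \<in> sq_int NN" for t unfolding W_alt by (intro sq_int_diff qe Je)
  have key: "\<i> * (evo p t f m - f m) / of_real t - lag_action p f m = ip NN (W (- t)) f" for t
  proof -
    have 1: "evo p t f m = ip NN (evo p (- t) e) f"
      using evo_coef[OF p expands_lag[OF p], of "- t" m] by (simp add: evo_def ce)
    have 2: "f m = ip NN e f" by (simp add: e_def ip_single)
    have 3: "lag_action p f m = ip NN (lag_action p e) f" by (simp add: e_def ip_lag_action_unit[OF f])
    have "ip NN (W (- t)) f = cnj (\<i> / of_real (- t)) * (evo p t f m - f m) - lag_action p f m"
      unfolding W_alt ip_diff_left[OF qe Je fs] ip_scale_left ip_diff_left[OF ve el(2) fs] 1 2 3 ..
    also have "cnj (\<i> / of_real (- t)) = \<i> / of_real t" by simp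
    finally show ?thesis by simp
  qed
  have "((\<lambda>t. ip NN (W (- t)) f) \<longlongrightarrow> 0) (at 0)"
  proof (rule Lim_null_comparison)
    show "\<forall>\<^sub>F t in at 0. norm (ip NN (W (- t)) f) \<le> norm2 NN (W (- t)) * norm2 NN f"
      by (intro always_eventually allI cmod_ip_le Ws fs)
    show "((\<lambda>t. norm2 NN (W (- t)) * norm2 NN f) \<longlongrightarrow> 0) (at 0)"
      using tendsto_mult_right[OF Wlim, of "norm2 NN f"] by simp
  qed
  moreover have "((\<lambda>t. \<i> * (evo p t f m - f m) / of_real t - g m) \<longlongrightarrow> 0) (at 0)"
  proof (rule Lim_null_comparison[OF _ lim])
    have "(\<lambda>n. \<i> / of_real t * (evo p t f n - f n) - g n) \<in> sq_int NN" for t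
      using evo_contraction(1)[OF p f] f g unfolding l2_eq_sq_int by (intro sq_int_diff sq_int_scale)
    then have "(\<lambda>n. \<i> * (evo p t f n - f n) / of_real t - g n) \<in> l2" for t by (simp add: l2_eq_sq_int)
    then show "\<forall>\<^sub>F t in at 0. norm (\<i> * (evo p t f m - f m) / of_real t - g m)
        \<le> norm2 NN (\<lambda>n. \<i> * (evo p t f n - f n) / of_real t - g n)"
      by (intro always_eventually allI cmod_le_norm2_NN)
  qed
  ultimately have "((\<lambda>t::real. g m - lag_action p f m) \<longlongrightarrow> 0 - 0) (at 0)"
    unfolding key[symmetric] using tendsto_diff by fastforce
  then show "g m = lag_action p f m" by (simp add: tendsto_const_iff)
qed

subsection \<open>Essential self-adjointness\<close>

definition cutoff :: "nat \<Rightarrow> nat \<Rightarrow> real" where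
  "cutoff k n = max 0 (min 1 (2 - real n / real k))"

lemma cutoff_props:
  assumes k: "k > 0"
  shows "0 \<le> cutoff k n" "cutoff k n \<le> 1" "n \<le> k \<Longrightarrow> cutoff k n = 1" "n \<ge> 2 * k \<Longrightarrow> cutoff k n = 0"
    "\<bar>cutoff k (Suc n) - cutoff k n\<bar> \<le> 1 / real k"
proof -
  show "0 \<le> cutoff k n" "cutoff k n \<le> 1" by (auto simp: cutoff_def)
  show "cutoff k n = 1" if "n \<le> k"
  proof -
    have "real n / real k \<le> 1" using that k by simp
    then show ?thesis by (simp add: cutoff_def)
  qed
  show "cutoff k n = 0" if "n \<ge> 2 * k"
  proof -
    have "real n \<ge> 2 * real k" using that by linarith
    then have "real n / real k \<ge> 2" using k by (simp add: le_divide_eq)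
    then show ?thesis by (simp add: cutoff_def)
  qed
  have eq: "real (Suc n) / real k = real n / real k + 1 / real k" by (simp add: add_divide_distrib)
  have gen: "\<bar>max 0 (min 1 (2 - (y + z))) - max 0 (min 1 (2 - y))\<bar> \<le> z" if "z > 0" for y z :: real
    using that by (auto simp: max_def min_def abs_if)
  show "\<bar>cutoff k (Suc n) - cutoff k n\<bar> \<le> 1 / real k"
    unfolding cutoff_def eq by (rule gen) (use k in simp)
qed

text \<open>The increments of the cutoff live on k <= n < 2 k, where \<open>lag_a p n\<close> is at
  most (3 + |p|) k, and the slope 1/k cancels the k. The value 0 for n < k matters as much as the
  bound: it leaves only the tail of the sequence in the commutator.\<close>

lemma lag_a_cutoff_bound:
  assumes p: "p > -1" and k: "k > 0"
  shows "lag_a p n * \<bar>cutoff k (Suc n) - cutoff k n\<bar> \<le> (if n < k then 0 else 3 + \<bar>p\<bar>)"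
proof (cases "n < k \<or> n \<ge> 2 * k")
  case True
  then show ?thesis using cutoff_props(3,4)[OF k, of n] cutoff_props(3,4)[OF k, of "Suc n"] by auto
next
  case False
  have "lag_a p n \<le> real n + 1 + \<bar>p\<bar>"
    unfolding lag_a_def
  proof (rule real_le_lsqrt)
    show "(real n + 1) * (real n + 1 + p) \<le> (real n + 1 + \<bar>p\<bar>)\<^sup>2"
      unfolding power2_eq_square using p by (intro mult_mono) auto
  qed auto
  also have "\<dots> \<le> (3 + \<bar>p\<bar>) * real k"
  proof -
    have "real n + 1 \<le> 2 * real k" using False by linarith
    moreover have "\<bar>p\<bar> * 1 \<le> \<bar>p\<bar> * real k" using k by (intro mult_left_mono) auto
    ultimately show ?thesis unfolding distrib_right using k by linarith
  qed
  finally have "lag_a p n * \<bar>cutoff k (Suc n) - cutoff k n\<bar> \<le> (3 + \<bar>p\<bar>) * real k * (1 / real k)"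
    using cutoff_props(5)[OF k, of n] lag_a_pos[OF p, of n] by (intro mult_mono) auto
  then show ?thesis using False k by simp
qed

lemma l2_shift:
  assumes "r \<in> l2"
  shows "(\<lambda>n. if n = 0 then 0 else r (n - 1)) \<in> l2" "norm2 NN (\<lambda>n. if n = 0 then 0 else r (n - 1)) = norm2 NN r"
    "(\<lambda>n. r (n + 1)) \<in> l2" "norm2 NN (\<lambda>n. r (n + 1)) \<le> norm2 NN r"
proof -
  have "(\<lambda>n. (cmod (if Suc n = 0 then 0 else r (Suc n - 1)))\<^sup>2) sums (norm2 NN r)\<^sup>2"
    using norm2_NN[OF assms] by simp
  from sums_Suc[OF this] have 1: "(\<lambda>n. (cmod (if n = 0 then 0 else r (n - 1)))\<^sup>2) sums (norm2 NN r)\<^sup>2" by simp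
  show "(\<lambda>n. if n = 0 then 0 else r (n - 1)) \<in> l2" by (rule l2_sumsI(1)[OF 1])
  show "norm2 NN (\<lambda>n. if n = 0 then 0 else r (n - 1)) = norm2 NN r"
    by (rule power2_eq_imp_eq[OF l2_sumsI(2)[OF 1]]) simp_all
  have "(\<lambda>n. (cmod (r (n + 1)))\<^sup>2) sums ((norm2 NN r)\<^sup>2 - (cmod (r 0))\<^sup>2)"
    using norm2_NN[OF assms] sums_Suc_iff[of "\<lambda>n. (cmod (r n))\<^sup>2"] by simp
  note 2 = l2_sumsI[OF this]
  show "(\<lambda>n. r (n + 1)) \<in> l2" by (rule 2(1))
  show "norm2 NN (\<lambda>n. r (n + 1)) \<le> norm2 NN r"
    by (rule power2_le_imp_le) (simp_all only: 2(2) norm2_nonneg, simp)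
qed

lemma norm2_cutoff:
  assumes k: "k > 0" and f: "f \<in> l2"
  shows "(\<lambda>n. of_real (cutoff k n) * f n - f n) \<in> sq_int NN"
    "norm2 NN (\<lambda>n. of_real (cutoff k n) * f n - f n) \<le> norm2 NN (\<lambda>n. f n - trunc k f n)"
proof -
  have d: "(\<lambda>n. f n - trunc k f n) \<in> sq_int NN" using l2_diff[OF f trunc_l2] by (simp add: l2_eq_sq_int)
  have b: "cmod (of_real (cutoff k n) * f n - f n) \<le> 1 * cmod (f n - trunc k f n)" for n
  proof (cases "n < k")
    case False
    have "cmod (of_real (cutoff k n) * f n - f n) = \<bar>cutoff k n - 1\<bar> * cmod (f n)"
      unfolding norm_of_real[of "_ - _", where 'a = complex, symmetric] norm_mult[symmetric] by (simp add: algebra_simps)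
    also have "\<dots> \<le> 1 * cmod (f n)" using cutoff_props(1,2)[OF k, of n] by (intro mult_right_mono) auto
    finally show ?thesis using False by (simp add: trunc_def)
  qed (simp add: trunc_def cutoff_props(3)[OF k])
  show "(\<lambda>n. of_real (cutoff k n) * f n - f n) \<in> sq_int NN"
    by (rule sq_int_dominated(1)[OF d _ b]) simp
  show "norm2 NN (\<lambda>n. of_real (cutoff k n) * f n - f n) \<le> norm2 NN (\<lambda>n. f n - trunc k f n)"
    using sq_int_dominated(2)[OF d _ b] by simp
qed

text \<open>Since \<open>lag_a p n\<close> grows linearly, linear cutoffs have uniformly bounded commutators with the
  Jacobi matrix.\<close>
lemma laguerre_op_maximal:
  assumes p: "p > -1" and f: "f \<in> l2" and g: "lag_action p f \<in> l2"
  shows "(f, lag_action p f) \<in> laguerre_op p"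
proof (rule laguerre_opI[OF p f g])
  define u where "u = (\<lambda>k n. of_real (cutoff (Suc k) n) * f n)"
  show u: "u k \<in> finite_seqs" for k
    by (rule finite_seqsI[of "2 * Suc k"]) (simp add: u_def cutoff_props(4))
  have lim_r: "(\<lambda>k. norm2 NN (\<lambda>n. h n - trunc (Suc k) h n)) \<longlonglongrightarrow> 0" if "h \<in> l2" for h
    using trunc_tendsto[OF that] by (rule LIMSEQ_Suc)
  show "(\<lambda>k. norm2 NN (\<lambda>n. u k n - f n)) \<longlonglongrightarrow> 0"
  proof (rule tendsto_sandwich[OF _ _ tendsto_const lim_r[OF f]])
    show "\<forall>\<^sub>F k in sequentially. norm2 NN (\<lambda>n. u k n - f n) \<le> norm2 NN (\<lambda>n. f n - trunc (Suc k) f n)"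
      unfolding u_def by (intro always_eventually allI norm2_cutoff f) simp
  qed simp
  define C where "C = 3 + \<bar>p\<bar>"
  define r where "r = (\<lambda>k n. f n - trunc (Suc k) f n)"
  have r: "r k \<in> l2" for k unfolding r_def by (rule l2_diff[OF f trunc_l2])
  have bound: "norm2 NN (\<lambda>n. lag_action p (u k) n - lag_action p f n)
      \<le> norm2 NN (\<lambda>n. lag_action p f n - trunc (Suc k) (lag_action p f) n) + 2 * C * norm2 NN (r k)" for k
  proof -
    define K where "K = Suc k"
    have K: "K > 0" by (simp add: K_def)
    \<comment> \<open>\<open>E1\<close> and \<open>E2\<close> are the lower and upper parts of the
      commutator of the Jacobi matrix with the cutoff; the diagonal commutes. Both are bounded by
      the constant \<open>C\<close> times a shifted tail of \<open>f\<close>.\<close>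
    define E1 where "E1 = (\<lambda>n. if n = 0 then 0 else
        of_real (lag_a p (n - 1) * (cutoff K (n - 1) - cutoff K n)) * f (n - 1))"
    define E2 where "E2 = (\<lambda>n. of_real (lag_a p n * (cutoff K (Suc n) - cutoff K n)) * f (n + 1))"
    define X where "X = (\<lambda>n. of_real (cutoff K n) * lag_action p f n - lag_action p f n)"
    have dec: "(\<lambda>n. lag_action p (u k) n - lag_action p f n) = (\<lambda>n. X n + (E1 n + E2 n))"
      by (rule ext) (simp add: X_def E1_def E2_def u_def lag_action_def K_def algebra_simps)
    have S: "(\<lambda>n. if n = 0 then 0 else r k (n - 1)) \<in> sq_int NN" "(\<lambda>n. r k (n + 1)) \<in> sq_int NN"
      using l2_shift(1,3)[OF r] by (auto simp: l2_eq_sq_int)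
    have b1: "cmod (E1 n) \<le> C * cmod (if n = 0 then 0 else r k (n - 1))" for n
    proof (cases n)
      case (Suc m)
      have "cmod (E1 n) = lag_a p m * \<bar>cutoff K (Suc m) - cutoff K m\<bar> * cmod (f m)"
        using Suc lag_a_pos[OF p, of m]
        by (simp add: E1_def norm_mult abs_mult abs_minus_commute del: of_real_diff of_real_mult)
      also have "\<dots> \<le> (if m < K then 0 else C) * cmod (f m)"
        unfolding C_def by (intro mult_right_mono lag_a_cutoff_bound p K) simp
      also have "\<dots> = C * cmod (r k m)" by (simp add: r_def trunc_def K_def)
      finally show ?thesis using Suc by simp
    qed (simp add: E1_def)
    have b2: "cmod (E2 n) \<le> C * cmod (r k (n + 1))" for n
    proof -
      have "cmod (E2 n) = lag_a p n * \<bar>cutoff K (Suc n) - cutoff K n\<bar> * cmod (f (n + 1))"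
        using lag_a_pos[OF p, of n] by (simp add: E2_def norm_mult abs_mult del: of_real_diff of_real_mult)
      also have "\<dots> \<le> (if n < K then 0 else C) * cmod (f (n + 1))"
        unfolding C_def by (intro mult_right_mono lag_a_cutoff_bound p K) simp
      also have "\<dots> \<le> C * cmod (r k (n + 1))" by (simp add: r_def trunc_def K_def C_def)
      finally show ?thesis .
    qed
    have C0: "C \<ge> 0" by (simp add: C_def)
    have E1: "E1 \<in> sq_int NN" "norm2 NN E1 \<le> C * norm2 NN (r k)"
      using sq_int_dominated[OF S(1) _ b1] C0 l2_shift(2)[OF r] by auto
    have E2: "E2 \<in> sq_int NN" by (rule sq_int_dominated(1)[OF S(2) _ b2]) simp
    have "norm2 NN E2 \<le> C * norm2 NN (\<lambda>n. r k (n + 1))" by (rule sq_int_dominated(2)[OF S(2) _ b2 C0]) simp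
    also have "\<dots> \<le> C * norm2 NN (r k)" by (intro mult_left_mono l2_shift(4) r C0)
    finally have E2': "norm2 NN E2 \<le> C * norm2 NN (r k)" .
    note X = norm2_cutoff[OF K g, folded X_def]
    have "norm2 NN (\<lambda>n. X n + (E1 n + E2 n)) \<le> norm2 NN X + (norm2 NN E1 + norm2 NN E2)"
      using norm2_triangle[OF X(1) sq_int_add[OF E1(1) E2]] norm2_triangle[OF E1(1) E2] by linarith
    then show ?thesis using X(2) E1(2) E2' unfolding dec K_def by linarith
  qed
  show "(\<lambda>k. norm2 NN (\<lambda>n. lag_action p (u k) n - lag_action p f n)) \<longlonglongrightarrow> 0"
  proof (rule tendsto_sandwich[OF _ always_eventually[OF allI[OF bound]] tendsto_const])
    show "(\<lambda>k. norm2 NN (\<lambda>n. lag_action p f n - trunc (Suc k) (lag_action p f) n) + 2 * C * norm2 NN (r k)) \<longlonglongrightarrow> 0"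
      using tendsto_add[OF lim_r[OF g] tendsto_mult_left[OF lim_r[OF f], of "2 * C"]] by (simp add: r_def)
  qed simp
qed

subsection \<open>Uniqueness of the group\<close>

lemma unitary_l2D:
  assumes "unitary_l2 T"
  shows "f \<in> l2 \<Longrightarrow> T f \<in> l2" "f \<in> l2 \<Longrightarrow> norm2 NN (T f) = norm2 NN f"
    "f \<in> l2 \<Longrightarrow> g \<in> l2 \<Longrightarrow> T (\<lambda>n. f n - g n) = (\<lambda>n. T f n - T g n)"
    "f \<in> l2 \<Longrightarrow> g \<in> l2 \<Longrightarrow> T (\<lambda>n. \<alpha> * f n + \<beta> * g n) = (\<lambda>n. \<alpha> * T f n + \<beta> * T g n)"
proof -
  have lin: "\<And>f g \<alpha> \<beta>. f \<in> l2 \<Longrightarrow> g \<in> l2 \<Longrightarrow> T (\<lambda>n. \<alpha> * f n + \<beta> * g n) = (\<lambda>n. \<alpha> * T f n + \<beta> * T g n)"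
    and im: "T ` l2 = l2" and iso: "\<And>f. f \<in> l2 \<Longrightarrow> l2_norm (T f) = l2_norm f"
    using assms unfolding unitary_l2_def by auto
  show mem: "f \<in> l2 \<Longrightarrow> T f \<in> l2" for f using im by blast
  show "f \<in> l2 \<Longrightarrow> norm2 NN (T f) = norm2 NN f"
    using iso[of f] mem[of f] by (simp add: l2_norm_eq)
  show "f \<in> l2 \<Longrightarrow> g \<in> l2 \<Longrightarrow> T (\<lambda>n. f n - g n) = (\<lambda>n. T f n - T g n)"
    using lin[of f g 1 "-1"] by simp
  show "f \<in> l2 \<Longrightarrow> g \<in> l2 \<Longrightarrow> T (\<lambda>n. \<alpha> * f n + \<beta> * g n) = (\<lambda>n. \<alpha> * T f n + \<beta> * T g n)"
    by (rule lin)
qed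

lemma hamiltonian_iff:
  assumes V: "\<And>t. V t f \<in> l2"
  shows "(f, g) \<in> hamiltonian V \<longleftrightarrow> f \<in> l2 \<and> g \<in> l2 \<and>
    ((\<lambda>t. norm2 NN (\<lambda>n. \<i> * (V t f n - f n) / of_real t - g n)) \<longlongrightarrow> 0) (at 0)"
proof (cases "f \<in> l2 \<and> g \<in> l2")
  case True
  have "(\<lambda>n. \<i> / of_real t * (V t f n - f n)) \<in> sq_int NN" for t
    using l2_diff[OF V] True by (intro sq_int_scale) (simp add: l2_eq_sq_int)
  then have q: "(\<lambda>n. \<i> * (V t f n - f n) / of_real t) \<in> l2" for t by (simp add: l2_eq_sq_int)
  have "l2_dist (\<lambda>n. \<i> * (V t f n - f n) / of_real t) g = norm2 NN (\<lambda>n. \<i> * (V t f n - f n) / of_real t - g n)" for t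
    by (rule l2_dist_eq[OF q]) (use True in simp)
  then show ?thesis using True by (simp add: hamiltonian_def)
qed (auto simp: hamiltonian_def)

text \<open>The vector V(- t) W(t) f is constant in t. This uses that W(t) keeps the domain of the
  generator invariant, so that V can be differentiated along the orbit of W.\<close>

lemma group_unique_on_domain:
  assumes V: "unitary_group V" and W: "unitary_group W" and H: "hamiltonian V = hamiltonian W"
    and fg: "(f, g) \<in> hamiltonian W"
  shows "W t f = V t f"
proof -
  note uV = unitary_l2D[OF V[unfolded unitary_group_def, THEN conjunct1, rule_format]]
  note uW = unitary_l2D[OF W[unfolded unitary_group_def, THEN conjunct1, rule_format]]
  have V0: "\<And>f. f \<in> l2 \<Longrightarrow> V 0 f = f" and Vg: "\<And>s t f. f \<in> l2 \<Longrightarrow> V s (V t f) = V (s + t) f"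
    using V by (auto simp: unitary_group_def)
  have W0: "\<And>f. f \<in> l2 \<Longrightarrow> W 0 f = f" and Wg: "\<And>s t f. f \<in> l2 \<Longrightarrow> W s (W t f) = W (s + t) f"
    using W by (auto simp: unitary_group_def)
  have f: "f \<in> l2" and g: "g \<in> l2" using fg by (auto simp: hamiltonian_def)
  define d where "d = (\<lambda>t. V (- t) (W t f))"
  have dl: "d t \<in> l2" for t unfolding d_def by (intro uV uW f)
  have "((\<lambda>t. d t n) has_vector_derivative 0) (at t)" for t n
  proof -
    define x y where "x = W t f" and "y = W t g"
    have x: "x \<in> l2" and y: "y \<in> l2" by (auto simp: x_def y_def uW f g)
    define err where "err = (\<lambda>V h n. \<i> * (V h x n - x n) / of_real h - y n)" for V :: "real \<Rightarrow> (nat \<Rightarrow> complex) \<Rightarrow> nat \<Rightarrow> complex"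
    \<comment> \<open>The difference quotient at W(t) f is the image under the isometry W(t) of the
      one at f, so its error has the same norm.\<close>
    have W_lim: "((\<lambda>h. norm2 NN (err W h)) \<longlongrightarrow> 0) (at 0)"
    proof -
      have "norm2 NN (err W h)
          = norm2 NN (\<lambda>n. \<i> * (W h f n - f n) / of_real h - g n)" for h
      proof -
        define q where "q = (\<lambda>n. W h f n - f n)"
        have q: "q \<in> l2" unfolding q_def by (intro l2_diff uW f)
        have "W t (\<lambda>n. \<i> / of_real h * q n + (- 1) * g n) = (\<lambda>n. \<i> / of_real h * W t q n + (- 1) * W t g n)"
          by (rule uW(4)[OF q g])
        moreover have "W t q = (\<lambda>n. W h x n - x n)"
          unfolding q_def uW(3)[OF uW(1)[OF f] f] x_def Wg[OF f] by (simp add: add.commute)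
        ultimately have "W t (\<lambda>n. \<i> / of_real h * q n + (- 1) * g n) = err W h"
          by (simp add: y_def err_def)
        moreover have "(\<lambda>n. \<i> / of_real h * q n + (- 1) * g n) \<in> l2"
          using q g unfolding l2_eq_sq_int by (intro sq_int_add sq_int_scale)
        ultimately have "norm2 NN (err W h) = norm2 NN (\<lambda>n. \<i> / of_real h * q n + (- 1) * g n)"
          using uW(2) by metis
        then show ?thesis by (simp add: q_def)
      qed
      then show ?thesis using fg hamiltonian_iff[of W f g, OF uW(1)[OF f]] by (simp only:)
    qed
    then have "(x, y) \<in> hamiltonian W" using hamiltonian_iff[of W x y, OF uW(1)[OF x]] x y by (simp add: err_def)
    then have "(x, y) \<in> hamiltonian V" by (simp add: H)
    then have V_lim: "((\<lambda>h. norm2 NN (err V h)) \<longlongrightarrow> 0) (at 0)"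
      using hamiltonian_iff[of V x y, OF uV(1)[OF x]] by (simp add: err_def)
    \<comment> \<open>After the isometries V(- t) V(- h) are factored out, the increment is W(h) x -
      V(h) x. The linear terms agree, and only the two errors remain.\<close>
    have step: "norm (d (t + h) n - d t n) / \<bar>h\<bar>
        \<le> norm2 NN (err W h) + norm2 NN (err V h)"
      if h: "h \<noteq> 0" for h
    proof -
      have Wx: "W h x \<in> l2" "V h x \<in> l2" by (auto intro: uV uW x)
      define z where "z = (\<lambda>n. W h x n - V h x n)"
      have z: "z \<in> l2" unfolding z_def by (rule l2_diff[OF Wx])
      have 1: "d (t + h) = V (- t) (V (- h) (W h x))"
        unfolding d_def x_def Vg[OF uW(1)[OF f]] Wg[OF f] by (simp only: minus_add_distrib add.commute[of h t])
      have "V (- h) (V h x) = x" using Vg[OF x, of "- h" h] V0[OF x] by simp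
      then have 2: "d t = V (- t) (V (- h) (V h x))" by (simp add: d_def x_def)
      have "(\<lambda>n. d (t + h) n - d t n) = V (- t) (V (- h) z)"
        unfolding 1 2 z_def uV(3)[OF Wx] uV(3)[OF uV(1)[OF Wx(1)] uV(1)[OF Wx(2)]] ..
      then have "norm2 NN (\<lambda>n. d (t + h) n - d t n) = norm2 NN z"
        using uV(2)[OF uV(1)[OF z]] uV(2)[OF z] by simp
      then have "norm (d (t + h) n - d t n) \<le> norm2 NN z"
        using cmod_le_norm2_NN[OF l2_diff[OF dl dl], of "t + h" n t] by simp
      then have "norm (d (t + h) n - d t n) / \<bar>h\<bar> \<le> norm2 NN (\<lambda>n. \<i> / of_real h * z n)"
        unfolding norm2_scale using h by (simp add: norm_divide divide_right_mono)
      also have "(\<lambda>n. \<i> / of_real h * z n) = (\<lambda>n. err W h n - err V h n)"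
        by (simp add: err_def z_def right_diff_distrib diff_divide_distrib)
      also have "norm2 NN \<dots> \<le> norm2 NN (err W h) + norm2 NN (err V h)"
      proof -
        have q: "err Z h \<in> sq_int NN" if "Z h x \<in> l2" for Z
          using sq_int_diff[OF sq_int_scale[of _ _ "\<i> / of_real h"]] l2_diff[OF that x] y by (simp add: err_def l2_eq_sq_int)
        show ?thesis
          using norm2_triangle_diff[OF q[of W, OF Wx(1)] sq_int_zero q[of V, OF Wx(2)]]
            norm2_minus_commute[of NN "\<lambda>n. 0" "err V h"] by simp
      qed
      finally show ?thesis .
    qed
    show ?thesis
      unfolding has_vector_derivative_def has_derivative_at
    proof (intro conjI bounded_linear_scaleR_left)
      show "(\<lambda>h. norm (d (t + h) n - d t n - h *\<^sub>R 0) / norm h) \<midarrow>0\<rightarrow> 0"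
      proof (rule tendsto_sandwich[OF _ _ tendsto_const])
        show "\<forall>\<^sub>F h in at 0. norm (d (t + h) n - d t n - h *\<^sub>R 0) / norm h \<le>
          norm2 NN (err W h) + norm2 NN (err V h)"
          using step by (simp add: eventually_at_filter)
        show "((\<lambda>h. norm2 NN (err W h) + norm2 NN (err V h)) \<longlongrightarrow> 0) (at 0)"
          using tendsto_add[OF W_lim V_lim] by simp
      qed simp
    qed
  qed
  then have "d t n = d 0 n" for n
    by (metis has_vector_derivative_zero_constant convex_UNIV UNIV_I)
  then have "V (- t) (W t f) = f" by (simp add: d_def fun_eq_iff W0[OF f] V0[OF f])
  then have "V t f = V t (V (- t) (W t f))" by simp
  also have "\<dots> = W t f" using Vg[OF uW(1)[OF f], of t "- t"] V0[OF uW(1)[OF f]] by simp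
  finally show ?thesis ..
qed

section \<open>Identification of \<open>evo\<close> with the exponential of the Laguerre
  operator\<close>

lemma unitary_group_evo:
  assumes p: "p > -1" shows "unitary_group (\<lambda>t. restrict (evo p t) l2)"
  unfolding unitary_group_def
proof (intro conjI allI ballI)
  show "unitary_l2 (restrict (evo p t) l2)" for t
    unfolding unitary_l2_def
  proof (intro conjI ballI allI)
    fix f g \<alpha> \<beta> assume "f \<in> l2" "g \<in> l2"
    moreover from this have "(\<lambda>n. \<alpha> * f n + \<beta> * g n) \<in> l2"
      unfolding l2_eq_sq_int by (intro sq_int_add sq_int_scale)
    ultimately show "restrict (evo p t) l2 (\<lambda>n. \<alpha> * f n + \<beta> * g n)
        = (\<lambda>n. \<alpha> * restrict (evo p t) l2 f n + \<beta> * restrict (evo p t) l2 g n)"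
      using evo_linear[OF p] by simp
  next
    have "f \<in> evo p t ` l2" if f: "f \<in> l2" for f
      using evo_group[OF p f, of t "- t"] evo_contraction(1)[OF p f, of "- t"]
      by (simp add: evo_0[OF p] image_iff) metis
    then show "restrict (evo p t) l2 ` l2 = l2" using evo_contraction(1)[OF p] by auto
  next
    fix f assume "f \<in> l2"
    then show "l2_norm (restrict (evo p t) l2 f) = l2_norm f"
      using evo_contraction(1)[OF p] evo_isometry[OF p] by (simp add: l2_norm_eq)
  qed
  show "restrict (evo p 0) l2 f = f" if "f \<in> l2" for f using that evo_0[OF p] by simp
  show "restrict (evo p (s + t)) l2 f = restrict (evo p s) l2 (restrict (evo p t) l2 f)" if "f \<in> l2" for f s t
    using that evo_group[OF p that] evo_contraction(1)[OF p that] by simp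
  show "((\<lambda>t. l2_dist (restrict (evo p t) l2 f) f) \<longlongrightarrow> 0) (at 0)" if f: "f \<in> l2" for f
  proof -
    have "((\<lambda>t. norm2 NN (\<lambda>n. evo p t f n - f n)) \<longlongrightarrow> 0) (at 0)"
    proof (rule tendstoI)
      fix e :: real assume e: "e > 0"
      obtain N where N: "norm2 NN (\<lambda>n. f n - trunc N f n) < e / 4"
        using LIMSEQ_D[OF trunc_tendsto[OF f], of "e / 4"] e by auto
      define u where "u = trunc N f"
      have u: "u \<in> finite_seqs" "u \<in> l2" by (auto simp: u_def trunc_finite_seqs trunc_l2)
      define K where "K = norm2 NN (lag_action p u)"
      have lim: "((\<lambda>t. \<bar>t\<bar> * K) \<longlongrightarrow> 0) (at 0)" by (auto intro!: tendsto_eq_intros)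
      have "\<forall>\<^sub>F t in at 0. \<bar>t\<bar> * K < e / 2" by (rule order_tendstoD(2)[OF lim]) (use e in simp)
      then show "\<forall>\<^sub>F t in at 0. dist (norm2 NN (\<lambda>n. evo p t f n - f n)) 0 < e"
      proof eventually_elim
        case (elim t)
        have d: "(\<lambda>n. f n - u n) \<in> l2" by (rule l2_diff[OF f u(2)])
        note v = evo_contraction[OF p f, of t] evo_contraction[OF p u(2), of t]
        have "norm2 NN (\<lambda>n. evo p t f n - f n) \<le> norm2 NN (\<lambda>n. evo p t f n - evo p t u n) + norm2 NN (\<lambda>n. evo p t u n - f n)"
          using norm2_triangle_diff[of "evo p t f" NN "evo p t u" f] v f by (simp add: l2_eq_sq_int)
        also have "norm2 NN (\<lambda>n. evo p t u n - f n) \<le> norm2 NN (\<lambda>n. evo p t u n - u n) + norm2 NN (\<lambda>n. u n - f n)"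
          using norm2_triangle_diff[of "evo p t u" NN u f] v f u by (simp add: l2_eq_sq_int)
        also have "norm2 NN (\<lambda>n. evo p t u n - u n) \<le> \<bar>t\<bar> * K" unfolding K_def by (rule evo_lipschitz[OF p u(1)])
        also have "(\<lambda>n. evo p t f n - evo p t u n) = evo p t (\<lambda>n. f n - u n)"
          using evo_diff[OF p f u(2)] by (simp add: fun_eq_iff)
        also have "norm2 NN (evo p t (\<lambda>n. f n - u n)) \<le> norm2 NN (\<lambda>n. f n - u n)"
          by (rule evo_contraction(2)[OF p d])
        also have "norm2 NN (\<lambda>n. u n - f n) = norm2 NN (\<lambda>n. f n - u n)" by (rule norm2_minus_commute)
        finally show ?case using N elim by (simp add: u_def)
      qed
    qed
    moreover have "l2_dist (restrict (evo p t) l2 f) f = norm2 NN (\<lambda>n. evo p t f n - f n)" for t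
      using f evo_contraction(1)[OF p f] by (simp add: l2_dist_eq)
    ultimately show ?thesis by simp
  qed
qed

text \<open>Equality of graphs, domains included. The generator is contained in the maximal Jacobi
  operator, which coincides with the closure from finite sequences by the cutoff argument;
  conversely the difference quotients converge on that closure.\<close>

lemma hamiltonian_evo:
  assumes p: "p > -1" shows "hamiltonian (\<lambda>t. restrict (evo p t) l2) = laguerre_op p"
proof -
  have "(f, g) \<in> hamiltonian (\<lambda>t. restrict (evo p t) l2) \<longleftrightarrow> (f, g) \<in> laguerre_op p" for f g
  proof (cases "f \<in> l2")
    case True
    have V: "restrict (evo p t) l2 f \<in> l2" for t using True evo_contraction(1)[OF p True] by simp
    have "(f, g) \<in> hamiltonian (\<lambda>t. restrict (evo p t) l2) \<longleftrightarrow> f \<in> l2 \<and> g \<in> l2 \<and>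
        ((\<lambda>t. norm2 NN (\<lambda>n. \<i> * (evo p t f n - f n) / of_real t - g n)) \<longlongrightarrow> 0) (at 0)"
      using hamiltonian_iff[of "\<lambda>t. restrict (evo p t) l2" f g, OF V] True by simp
    also have "\<dots> \<longleftrightarrow> (f, g) \<in> laguerre_op p"
    proof
      assume *: "f \<in> l2 \<and> g \<in> l2 \<and> ((\<lambda>t. norm2 NN (\<lambda>n. \<i> * (evo p t f n - f n) / of_real t - g n)) \<longlongrightarrow> 0) (at 0)"
      then have "g = lag_action p f" using diff_quotient_eq_lag_action[OF p] by blast
      then show "(f, g) \<in> laguerre_op p" using laguerre_op_maximal[OF p] * by blast
    next
      assume *: "(f, g) \<in> laguerre_op p"
      then have "g \<in> l2" by (auto simp: laguerre_op_def op_closure_def)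
      with True laguerre_op_diff_quotient[OF p *]
      show "f \<in> l2 \<and> g \<in> l2 \<and> ((\<lambda>t. norm2 NN (\<lambda>n. \<i> * (evo p t f n - f n) / of_real t - g n)) \<longlongrightarrow> 0) (at 0)"
        by blast
    qed
    finally show ?thesis .
  qed (auto simp: hamiltonian_def laguerre_op_def op_closure_def)
  then show ?thesis by auto
qed

text \<open>Both obligations of \<open>THE\<close>: \<open>evo\<close> is such a group, and any
  other one agrees with it first on finite sequences, which lie in the common generator domain, and
  then everywhere by density and isometry. Restricting to \<open>l2\<close> fixes the values
  elsewhere.\<close>

lemma exp_minus_i_laguerre_op:
  assumes p: "p > -1" and f: "f \<in> l2"
  shows "exp_minus_i (laguerre_op p) t f = evo p t f"
proof -
  define E where "E = (\<lambda>t. restrict (evo p t) l2)"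
  have E: "unitary_group E" "hamiltonian E = laguerre_op p"
    unfolding E_def by (rule unitary_group_evo[OF p], rule hamiltonian_evo[OF p])
  have "exp_minus_i (laguerre_op p) = E"
    unfolding exp_minus_i_def
  proof (rule the_equality)
    show "(\<forall>t. E t \<in> extensional l2) \<and> unitary_group E \<and> hamiltonian E = laguerre_op p"
      using E by (auto simp: E_def)
  next
    fix V assume V: "(\<forall>t. V t \<in> extensional l2) \<and> unitary_group V \<and> hamiltonian V = laguerre_op p"
    note uV = unitary_l2D[OF V[THEN conjunct2, THEN conjunct1, unfolded unitary_group_def, THEN conjunct1, rule_format]]
    show "V = E"
    proof (intro ext)
      fix t h n
      show "V t h n = E t h n"
      proof (cases "h \<in> l2")
        case True
        have "V t h = evo p t h"
        proof (rule l2_eqI[OF uV(1)[OF True] evo_contraction(1)[OF p True]])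
          fix e :: real assume e: "e > 0"
          obtain N where N: "norm2 NN (\<lambda>n. h n - trunc N h n) < e / 2"
            using LIMSEQ_D[OF trunc_tendsto[OF True], of "e / 2"] e by auto
          define u where "u = trunc N h"
          have u: "u \<in> finite_seqs" "u \<in> l2" by (auto simp: u_def trunc_finite_seqs trunc_l2)
          have "(u, lag_action p u) \<in> hamiltonian V"
            using laguerre_op_maximal[OF p u(2) lag_action_finite[OF p u(1)]] V by simp
          then have "V t u = E t u"
            using group_unique_on_domain[of E V u "lag_action p u" t] E V by simp
          then have eq: "V t u = evo p t u" using u by (simp add: E_def)
          have d: "(\<lambda>n. h n - u n) \<in> l2" by (rule l2_diff[OF True u(2)])
          have "(\<lambda>n. V t h n - evo p t h n) = (\<lambda>n. V t (\<lambda>n. h n - u n) n - evo p t (\<lambda>n. h n - u n) n)"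
            unfolding uV(3)[OF True u(2)] evo_diff[OF p True u(2)] eq by simp
          then have "norm2 NN (\<lambda>n. V t h n - evo p t h n) \<le> norm2 NN (V t (\<lambda>n. h n - u n)) + norm2 NN (evo p t (\<lambda>n. h n - u n))"
            using norm2_triangle_diff[of "V t (\<lambda>n. h n - u n)" NN "\<lambda>n. 0" "evo p t (\<lambda>n. h n - u n)"]
              uV(1)[OF d] evo_contraction(1)[OF p d] norm2_minus_commute[of NN "\<lambda>n. 0" "evo p t (\<lambda>n. h n - u n)"]
            by (simp add: l2_eq_sq_int sq_int_zero)
          also have "\<dots> \<le> e" using uV(2)[OF d] evo_contraction(2)[OF p d, of t] N by (simp add: u_def)
          finally show "norm2 NN (\<lambda>n. V t h n - evo p t h n) \<le> e" .
        qed
        then show ?thesis using True by (simp add: E_def)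
      next
        case False
        then show ?thesis using V by (simp add: E_def extensional_def)
      qed
    qed
  qed
  then show ?thesis using f by (simp add: E_def)
qed

section \<open>Asymptotics of the coherent states\<close>

text \<open>Complex powers are not multiplicative in general; a positive real factor leaves the
  argument unchanged, so that the principal logarithms add.\<close>

lemma powr_times_of_real_left:
  fixes z :: complex
  assumes "r > 0"
  shows "(of_real r * z) powr of_real a = of_real (r powr a) * z powr of_real a"
proof (cases "z = 0")
  case False
  then have "(of_real r * z) powr of_real a = exp (of_real a * of_real (ln r)) * exp (of_real a * Ln z)"
    using assms by (simp add: powr_def Ln_times_of_real Ln_of_real exp_add[symmetric] distrib_left)
  also have "exp (of_real a * of_real (ln r)) = complex_of_real (r powr a)"
    using assms by (simp add: powr_def exp_of_real mult.commute flip: of_real_mult)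
  finally show ?thesis using False by (simp add: powr_def)
qed simp

lemma tendsto_powr_fixed:
  fixes a :: complex
  assumes "(f \<longlongrightarrow> l) F" "l \<notin> \<real>\<^sub>\<le>\<^sub>0"
  shows "((\<lambda>x. f x powr a) \<longlongrightarrow> l powr a) F"
  by (rule tendsto_powr_complex[OF assms(2,1) tendsto_const])

text \<open>The inner product is the conjugate of a, times b, times (1 - cnj z w)^(-p-1). Moving t^2
  into the base costs t^(2(p+1)), which is shared equally by the two amplitudes; the limit c is
  positive, where the principal power is continuous.\<close>

lemma coh_ip_tendsto:
  assumes p: "p > -1" and zw: "\<forall>\<^sub>F t in at_top. cmod (z t) < 1" "\<forall>\<^sub>F t in at_top. cmod (w t) < 1"
    and a: "((\<lambda>t. of_real (t powr (p + 1)) * a t) \<longlongrightarrow> k) at_top"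
    and b: "((\<lambda>t. of_real (t powr (p + 1)) * b t) \<longlongrightarrow> k') at_top"
    and c: "((\<lambda>t::real. of_real (t\<^sup>2) * (1 - cnj (z t) * w t)) \<longlongrightarrow> of_real c) at_top" "c > 0"
  shows "((\<lambda>t. ip NN (\<lambda>n. a t * coh p (z t) n) (\<lambda>n. b t * coh p (w t) n))
           \<longlongrightarrow> cnj k * k' * of_real (c powr (- (p + 1)))) at_top"
proof (rule Lim_transform_eventually)
  have "((\<lambda>t::real. (of_real (t\<^sup>2) * (1 - cnj (z t) * w t)) powr of_real (- (p + 1))) \<longlongrightarrow> of_real c powr of_real (- (p + 1))) at_top"
    by (rule tendsto_powr_fixed[OF c(1)]) (use c(2) in \<open>simp add: complex_nonpos_Reals_iff\<close>)
  also have "complex_of_real c powr of_real (- (p + 1)) = of_real (c powr (- (p + 1)))"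
    using c(2) powr_of_real[of c "- (p + 1)"] by simp
  finally show "((\<lambda>t::real. cnj (of_real (t powr (p + 1)) * a t) * (of_real (t powr (p + 1)) * b t)
        * (of_real (t\<^sup>2) * (1 - cnj (z t) * w t)) powr of_real (- (p + 1)))
      \<longlongrightarrow> cnj k * k' * of_real (c powr (- (p + 1)))) at_top"
    by (intro tendsto_mult tendsto_cnj a b)
  show "\<forall>\<^sub>F t in at_top. cnj (of_real (t powr (p + 1)) * a t) * (of_real (t powr (p + 1)) * b t)
        * (of_real (t\<^sup>2) * (1 - cnj (z t) * w t)) powr of_real (- (p + 1))
      = ip NN (\<lambda>n. a t * coh p (z t) n) (\<lambda>n. b t * coh p (w t) n)"
    using zw eventually_gt_at_top[of "0::real"]
  proof eventually_elim
    case (elim t)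
    have ip: "ip NN (coh p (z t)) (coh p (w t)) = (1 - cnj (z t) * w t) powr (- of_real (p + 1))"
      by (rule sums_unique2[OF ip_NN_sums[OF coh_l2(1)[OF p elim(1)] coh_l2(1)[OF p elim(2)]]
            coh_inner_sums[OF p elim(1,2)]])
    have t2: "t powr (p + 1) * t powr (p + 1) * (t\<^sup>2) powr (- (p + 1)) = 1"
    proof -
      have "(t\<^sup>2) powr (- (p + 1)) = t powr (- (p + 1)) * t powr (- (p + 1))"
        using elim(3) by (simp add: power2_eq_square powr_mult)
      moreover have "t powr (p + 1) * t powr (- (p + 1)) = 1"
        using elim(3) by (simp add: powr_add[symmetric])
      ultimately show ?thesis by (metis mult.assoc mult.commute mult_1)
    qed
    have "cnj (of_real (t powr (p + 1)) * a t) * (of_real (t powr (p + 1)) * b t)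
        * (of_real (t\<^sup>2) * (1 - cnj (z t) * w t)) powr of_real (- (p + 1))
        = of_real (t powr (p + 1) * t powr (p + 1) * (t\<^sup>2) powr (- (p + 1))) * (cnj (a t) * b t * (1 - cnj (z t) * w t) powr of_real (- (p + 1)))"
      using elim(3) by (subst powr_times_of_real_left) (simp_all add: mult_ac)
    also have "\<dots> = cnj (a t) * b t * ip NN (coh p (z t)) (coh p (w t))"
      unfolding t2 ip by simp
    also have "\<dots> = ip NN (\<lambda>n. a t * coh p (z t) n) (\<lambda>n. b t * coh p (w t) n)"
      unfolding ip_scale_left ip_scale_right by simp
    finally show ?case .
  qed
qed

text \<open>The point of the disc whose coherent state has the modulus and phase of \<open>free_evol\<close>.\<close>
definition wpt :: "real \<Rightarrow> real \<Rightarrow> complex" where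
  "wpt s t = - exp (Complex (- s / t\<^sup>2) (1 / t))"

definition kap :: "real \<Rightarrow> complex" where
  "kap p = of_real (sqrt (Gamma (p + 1))) * exp (- \<i> * of_real ((p + 1) * pi / 2))"

definition model :: "real \<Rightarrow> real \<Rightarrow> real \<Rightarrow> nat \<Rightarrow> complex" where
  "model p s t n = kap p * of_real (t powr (- (p + 1))) * coh p (wpt s t) n"

lemma cmod_wpt: "cmod (wpt s t) = exp (- s / t\<^sup>2)"
  by (simp add: wpt_def)

lemma cmod_wpt_less: "s > 0 \<Longrightarrow> t > 0 \<Longrightarrow> cmod (wpt s t) < 1"
  by (simp add: cmod_wpt)

text \<open>\<open>wfun s t\<close> divided by t tends to i, off the branch cut, and i to the power
  -p-1 is the phase of the theorem.\<close>

lemma evol_scaled_tendsto: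
  assumes s: "s > 0"
  shows "((\<lambda>t. of_real (t powr (p + 1)) * (of_real (sqrt (Gamma (p + 1))) * wfun s t powr (- of_real (p + 1)))) \<longlongrightarrow> kap p) at_top"
proof (rule Lim_transform_eventually)
  have "((\<lambda>t::real. Complex ((s + 1/2) / t) 1) \<longlongrightarrow> Complex 0 1) at_top"
    by (intro tendsto_Complex tendsto_const) real_asymp
  then have "((\<lambda>t::real. Complex ((s + 1/2) / t) 1 powr (- of_real (p + 1))) \<longlongrightarrow> Complex 0 1 powr (- of_real (p + 1))) at_top"
    by (rule tendsto_powr_fixed) (simp add: complex_nonpos_Reals_iff)
  also have "Complex 0 1 powr (- of_real (p + 1)) = exp (- \<i> * of_real ((p + 1) * pi / 2))"
    unfolding powr_def imaginary_unit.code[symmetric] by (simp add: algebra_simps)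
  finally show "((\<lambda>t::real. of_real (sqrt (Gamma (p + 1))) * Complex ((s + 1/2) / t) 1 powr (- of_real (p + 1))) \<longlongrightarrow> kap p) at_top"
    unfolding kap_def by (rule tendsto_mult_left)
  show "\<forall>\<^sub>F t in at_top. of_real (sqrt (Gamma (p + 1))) * Complex ((s + 1/2) / t) 1 powr (- of_real (p + 1))
     = of_real (t powr (p + 1)) * (of_real (sqrt (Gamma (p + 1))) * wfun s t powr (- of_real (p + 1)))"
    using eventually_gt_at_top[of "0::real"]
  proof eventually_elim
    case (elim t)
    have "Complex ((s + 1/2) / t) 1 = of_real (1 / t) * wfun s t"
      using elim by (simp add: wfun_def complex_eq_iff)
    then have "Complex ((s + 1/2) / t) 1 powr of_real (- (p + 1)) = of_real ((1 / t) powr (- (p + 1))) * wfun s t powr of_real (- (p + 1))"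
      using powr_times_of_real_left[of "1 / t" "wfun s t" "- (p + 1)"] elim by simp
    moreover have "(1 / t) powr (- (p + 1)) = t powr (p + 1)"
      unfolding powr_minus using elim by (simp add: powr_divide)
    ultimately show ?case by (simp add: mult_ac)
  qed
qed

lemma model_scaled: "t > 0 \<Longrightarrow> of_real (t powr (p + 1)) * (kap p * of_real (t powr (- (p + 1)))) = kap p"
proof -
  assume t: "t > 0"
  have "t powr (p + 1) * t powr (- (p + 1)) = 1" using t by (simp add: powr_add[symmetric])
  then show ?thesis by (metis mult.left_commute mult.right_neutral of_real_1 of_real_mult)
qed

lemma model_scaled_tendsto: "((\<lambda>t. of_real (t powr (p + 1)) * (kap p * of_real (t powr (- (p + 1))))) \<longlongrightarrow> kap p) at_top"
proof (rule Lim_transform_eventually[OF tendsto_const])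
  show "\<forall>\<^sub>F t in at_top. kap p = of_real (t powr (p + 1)) * (kap p * of_real (t powr (- (p + 1))))"
    using eventually_gt_at_top[of "0::real"] by eventually_elim (simp only: model_scaled)
qed

lemma inverse_wfun:
  assumes "s > 0"
  shows "1 / wfun s t = Complex ((s + 1/2) / ((s + 1/2)\<^sup>2 + t\<^sup>2)) (- t / ((s + 1/2)\<^sup>2 + t\<^sup>2))"
proof -
  have w: "wfun s t = Complex (s + 1/2) t" by (simp add: wfun_def complex_eq_iff)
  show ?thesis unfolding w by (simp add: complex_eq_iff Re_divide Im_divide)
qed

text \<open>Both points are -1 - i/t + (s + 1/2)/t^2 up to order t^(-3). In z the 1/2 is the decay
  rate of the Laguerre functions; in \<open>wpt\<close> it arises from the square of i/t in the
  expansion of the exponential. An agreement to this order is what gives all four pairs the same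
  limit.\<close>

lemma disc_limits:
  assumes s: "s > 0"
  defines "z \<equiv> (\<lambda>t. 1 / wfun s t - 1)"
  shows "((\<lambda>t::real. of_real (t\<^sup>2) * (1 - cnj (z t) * z t)) \<longlongrightarrow> of_real (2 * s)) at_top"
    "((\<lambda>t::real. of_real (t\<^sup>2) * (1 - cnj (wpt s t) * wpt s t)) \<longlongrightarrow> of_real (2 * s)) at_top"
    "((\<lambda>t::real. of_real (t\<^sup>2) * (1 - cnj (z t) * wpt s t)) \<longlongrightarrow> of_real (2 * s)) at_top"
    "((\<lambda>t::real. of_real (t\<^sup>2) * (1 - cnj (wpt s t) * z t)) \<longlongrightarrow> of_real (2 * s)) at_top"
proof -
  have sq: "1 - cnj x * x = complex_of_real (1 - (cmod x)\<^sup>2)" for x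
    by (simp add: complex_norm_square mult.commute del: of_real_power)
  have "1 - cnj (z t) * z t = of_real (2 * s / ((s + 1/2)\<^sup>2 + t\<^sup>2))" for t
    unfolding sq z_def norm_cayley[OF wfun_props(2)[OF s]]
    by (simp add: cmod_power2 wfun_def)
  moreover have "((\<lambda>t::real. t\<^sup>2 * (2 * s / ((s + 1/2)\<^sup>2 + t\<^sup>2))) \<longlongrightarrow> 2 * s) at_top"
    by real_asymp
  ultimately show "((\<lambda>t::real. of_real (t\<^sup>2) * (1 - cnj (z t) * z t)) \<longlongrightarrow> of_real (2 * s)) at_top"
    by (simp only: of_real_mult[symmetric] tendsto_of_real_iff)
  have "1 - cnj (wpt s t) * wpt s t = of_real (1 - exp (- 2 * s / t\<^sup>2))" for t
    unfolding sq cmod_wpt power2_eq_square exp_add[symmetric] by simp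
  moreover have "((\<lambda>t::real. t\<^sup>2 * (1 - exp (- 2 * s / t\<^sup>2))) \<longlongrightarrow> 2 * s) at_top"
    using s by real_asymp
  ultimately show "((\<lambda>t::real. of_real (t\<^sup>2) * (1 - cnj (wpt s t) * wpt s t)) \<longlongrightarrow> of_real (2 * s)) at_top"
    by (simp only: of_real_mult[symmetric] tendsto_of_real_iff)
  define a where "a = s + 1/2"
  have eq: "of_real (t\<^sup>2) * (1 - cnj (z t) * wpt s t) =
     Complex (t\<^sup>2 * (1 + exp (- s / t\<^sup>2) * ((a / (a\<^sup>2 + t\<^sup>2) - 1) * cos (1/t) - t / (a\<^sup>2 + t\<^sup>2) * sin (1/t))))
       (t\<^sup>2 * (exp (- s / t\<^sup>2) * ((a / (a\<^sup>2 + t\<^sup>2) - 1) * sin (1/t) + t / (a\<^sup>2 + t\<^sup>2) * cos (1/t))))" for t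
    unfolding z_def inverse_wfun[OF s] a_def[symmetric] wpt_def
    by (simp add: complex_eq_iff Re_exp Im_exp algebra_simps)
  have l1: "((\<lambda>t::real. t\<^sup>2 * (1 + exp (- s / t\<^sup>2) * ((a / (a\<^sup>2 + t\<^sup>2) - 1) * cos (1/t) - t / (a\<^sup>2 + t\<^sup>2) * sin (1/t)))) \<longlongrightarrow> s + a - 1/2) at_top"
    using s by real_asymp
  have l2: "((\<lambda>t::real. t\<^sup>2 * (exp (- s / t\<^sup>2) * ((a / (a\<^sup>2 + t\<^sup>2) - 1) * sin (1/t) + t / (a\<^sup>2 + t\<^sup>2) * cos (1/t)))) \<longlongrightarrow> 0) at_top"
    using s by real_asymp
  have "Complex (s + a - 1/2) 0 = of_real (2 * s)" by (simp add: complex_eq_iff a_def)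
  then show 3: "((\<lambda>t::real. of_real (t\<^sup>2) * (1 - cnj (z t) * wpt s t)) \<longlongrightarrow> of_real (2 * s)) at_top"
    unfolding eq using tendsto_Complex[OF l1 l2] by simp
  have "cnj (of_real (t\<^sup>2) * (1 - cnj (z t) * wpt s t)) = of_real (t\<^sup>2) * (1 - cnj (wpt s t) * z t)" for t
    by (simp add: mult.commute)
  then show "((\<lambda>t::real. of_real (t\<^sup>2) * (1 - cnj (wpt s t) * z t)) \<longlongrightarrow> of_real (2 * s)) at_top"
    using tendsto_cnj[OF 3] by (simp only: complex_cnj_complex_of_real)
qed

lemma model_sq_int: "p > -1 \<Longrightarrow> s > 0 \<Longrightarrow> t > 0 \<Longrightarrow> model p s t \<in> sq_int NN"
  unfolding model_def[abs_def] using coh_l2(1)[OF _ cmod_wpt_less] by (intro sq_int_scale) (simp add: l2_eq_sq_int)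

lemma evol_alt: "evol p s t = (\<lambda>n. (of_real (sqrt (Gamma (p + 1))) * wfun s t powr (- of_real (p + 1))) * coh p (1 / wfun s t - 1) n)"
  by (simp add: evol_def fun_eq_iff)

lemma model_alt: "model p s t = (\<lambda>n. (kap p * of_real (t powr (- (p + 1)))) * coh p (wpt s t) n)"
  by (simp add: model_def fun_eq_iff)

lemma model_norm_tendsto:
  assumes p: "p > -1" and s: "s > 0"
  shows "((\<lambda>t. ip NN (model p s t) (model p s t)) \<longlongrightarrow> cnj (kap p) * kap p * of_real ((2 * s) powr (- (p + 1)))) at_top"
proof -
  have w: "\<forall>\<^sub>F t in at_top. cmod (wpt s t) < 1"
    using eventually_gt_at_top[of "0::real"] by eventually_elim (rule cmod_wpt_less[OF s])
  show ?thesis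
    unfolding model_alt
    by (rule coh_ip_tendsto[OF p w w model_scaled_tendsto model_scaled_tendsto disc_limits(2)[OF s]]) (use s in simp)
qed

lemma evol_model_tendsto:
  assumes p: "p > -1" and s: "s > 0"
  shows "((\<lambda>t. norm2 NN (\<lambda>n. evol p s t n - model p s t n)) \<longlongrightarrow> 0) at_top"
proof (rule tendsto_of_power2)
  define L where "L = cnj (kap p) * kap p * of_real ((2 * s) powr (- (p + 1)))"
  have w: "\<forall>\<^sub>F t in at_top. cmod (wpt s t) < 1"
    using eventually_gt_at_top[of "0::real"] by eventually_elim (rule cmod_wpt_less[OF s])
  have z: "\<forall>\<^sub>F t in at_top. cmod (1 / wfun s t - 1) < 1"
    by (intro always_eventually allI cayley_less_1 s)
  have s2: "2 * s > 0" using s by simp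
  note d = disc_limits[OF s] and E = evol_scaled_tendsto[OF s, of p] and M = model_scaled_tendsto[of p]
  have 1: "((\<lambda>t. ip NN (evol p s t) (evol p s t)) \<longlongrightarrow> L) at_top"
    unfolding L_def evol_alt by (rule coh_ip_tendsto[OF p z z E E d(1) s2])
  have 2: "((\<lambda>t. ip NN (evol p s t) (model p s t)) \<longlongrightarrow> L) at_top"
    unfolding L_def evol_alt model_alt by (rule coh_ip_tendsto[OF p z w E M d(3) s2])
  have 3: "((\<lambda>t. ip NN (model p s t) (evol p s t)) \<longlongrightarrow> L) at_top"
    unfolding L_def evol_alt model_alt by (rule coh_ip_tendsto[OF p w z M E d(4) s2])
  have 4: "((\<lambda>t. ip NN (model p s t) (model p s t)) \<longlongrightarrow> L) at_top"
    unfolding L_def by (rule model_norm_tendsto[OF p s])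
  have "((\<lambda>t. Re ((ip NN (evol p s t) (evol p s t) - ip NN (evol p s t) (model p s t))
      - (ip NN (model p s t) (evol p s t) - ip NN (model p s t) (model p s t)))) \<longlongrightarrow> Re ((L - L) - (L - L))) at_top"
    by (intro tendsto_Re tendsto_diff 1 2 3 4)
  then have "((\<lambda>t. Re ((ip NN (evol p s t) (evol p s t) - ip NN (evol p s t) (model p s t))
      - (ip NN (model p s t) (evol p s t) - ip NN (model p s t) (model p s t)))) \<longlongrightarrow> 0) at_top" by simp
  then show "((\<lambda>t. (norm2 NN (\<lambda>n. evol p s t n - model p s t n))\<^sup>2) \<longlongrightarrow> 0) at_top"
  proof (rule Lim_transform_eventually)
    show "\<forall>\<^sub>F t in at_top. Re ((ip NN (evol p s t) (evol p s t) - ip NN (evol p s t) (model p s t))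
      - (ip NN (model p s t) (evol p s t) - ip NN (model p s t) (model p s t)))
      = (norm2 NN (\<lambda>n. evol p s t n - model p s t n))\<^sup>2"
      using eventually_gt_at_top[of "0::real"]
    proof eventually_elim
      case (elim t)
      have e: "evol p s t \<in> sq_int NN" using evol_l2[OF p s] by (simp add: l2_eq_sq_int)
      note m = model_sq_int[OF p s elim]
      have "complex_of_real ((norm2 NN (\<lambda>n. evol p s t n - model p s t n))\<^sup>2) =
        (ip NN (evol p s t) (evol p s t) - ip NN (evol p s t) (model p s t))
      - (ip NN (model p s t) (evol p s t) - ip NN (model p s t) (model p s t))"
        unfolding ip_self[symmetric] ip_diff_left[OF e m sq_int_diff[OF e m]] ip_diff_right[OF e e m] ip_diff_right[OF m e m] ..
      then show ?case by (metis Re_complex_of_real)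
    qed
  qed
qed simp

text \<open>The factor |t|^(-1) of the free evolution and the t^(-p) contained in (n/t^2)^(p/2) form
  the amplitude; alternating sign, phase and decay are all n-th powers and together form the power
  of \<open>wpt s t\<close>.\<close>

lemma free_evol_hfun:
  assumes t: "t > 0"
  shows "free_evol t (hfun p s) n = of_real (t powr (- (p + 1))) * wpt s t ^ n * of_real (real n powr (p / 2))"
proof -
  have w: "wpt s t ^ n = (-1) ^ n * (of_real (exp (- s * (real n / t\<^sup>2))) * exp (\<i> * of_real (real n / t)))"
  proof -
    have "exp (Complex (- s / t\<^sup>2) (1 / t)) ^ n = exp (of_real (- s * (real n / t\<^sup>2)) + \<i> * of_real (real n / t))"
      unfolding exp_of_nat_mult[symmetric] by (rule arg_cong[of _ _ exp]) (simp add: complex_eq_iff)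
    then show ?thesis unfolding wpt_def by (subst power_minus) (simp only: exp_add exp_of_real)
  qed
  have t2: "t\<^sup>2 powr (p / 2) = t powr p"
    using t by (simp add: power2_eq_square powr_mult powr_add[symmetric])
  have "(1 / \<bar>t\<bar>) * (real n / t\<^sup>2) powr (p / 2) = t powr (- (p + 1)) * real n powr (p / 2)"
  proof -
    have "t powr (- (p + 1)) = 1 / (t powr p * t)" using t by (simp only: powr_minus_divide powr_add) simp
    then show ?thesis using t by (simp add: powr_divide t2)
  qed
  then have k: "complex_of_real (1 / \<bar>t\<bar>) * of_real ((real n / t\<^sup>2) powr (p / 2)) = of_real (t powr (- (p + 1))) * of_real (real n powr (p / 2))"
    by (simp only: of_real_mult[symmetric])
  have "free_evol t (hfun p s) n = (-1) ^ n * exp (\<i> * of_real (real n / t)) *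
      (of_real (1 / \<bar>t\<bar>) * of_real ((real n / t\<^sup>2) powr (p / 2))) * of_real (exp (- s * (real n / t\<^sup>2)))"
    by (simp only: free_evol_def hfun_def of_real_mult mult.assoc)
  then show ?thesis unfolding k w by (simp only: mult_ac)
qed

text \<open>Euler's limit for the Gamma function. \<open>Gamma_series\<close> has one Pochhammer
  factor and one power of n more than \<open>nbinom\<close> and n^p require; the quotient (n + p +
  1)/n, which tends to 1, removes both.\<close>

lemma nbinom_asymp:
  assumes p: "p > -1"
  shows "(\<lambda>n. real n powr (p / 2) / sqrt (Gamma (p + 1) * nbinom p n)) \<longlonglongrightarrow> 1"
proof -
  have G: "Gamma (p + 1) > 0" using p by (intro Gamma_real_pos) auto
  have "(\<lambda>n. Gamma_series (p + 1) n * ((real n + p + 1) / real n)) \<longlonglongrightarrow> Gamma (p + 1) * 1"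
    by (intro tendsto_mult Gamma_series_LIMSEQ) real_asymp
  then have "(\<lambda>n. Gamma_series (p + 1) n * ((real n + p + 1) / real n) / Gamma (p + 1)) \<longlonglongrightarrow> Gamma (p + 1) * 1 / Gamma (p + 1)"
    using G by (intro tendsto_divide tendsto_const) auto
  then have "(\<lambda>n. sqrt (Gamma_series (p + 1) n * ((real n + p + 1) / real n) / Gamma (p + 1))) \<longlonglongrightarrow> sqrt 1"
    using G by (intro tendsto_real_sqrt) simp
  moreover have "\<forall>\<^sub>F n in sequentially. sqrt (Gamma_series (p + 1) n * ((real n + p + 1) / real n) / Gamma (p + 1))
     = real n powr (p / 2) / sqrt (Gamma (p + 1) * nbinom p n)"
    using eventually_gt_at_top[of 0]
  proof eventually_elim
    case (elim n)
    have P: "pochhammer (p + 1) n > 0" using p by (simp add: pochhammer_pos)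
    have N: "real n + p + 1 > 0" using p by simp
    have "exp ((p + 1) * ln (real n)) = real n powr p * real n"
      using elim by (simp add: powr_def distrib_right exp_add)
    then have "Gamma_series (p + 1) n * ((real n + p + 1) / real n) = real n powr p / nbinom p n"
      using elim P N unfolding Gamma_series_def nbinom_def
      by (simp add: pochhammer_Suc ln_real_def[symmetric] divide_simps add_ac mult_ac)
    moreover have "sqrt (real n powr p) = real n powr (p / 2)"
      by (rule real_sqrt_unique) (simp_all add: power2_eq_square powr_add[symmetric])
    ultimately show ?case by (simp add: real_sqrt_divide real_sqrt_mult)
  qed
  ultimately show ?thesis using Lim_transform_eventually by fastforce
qed

text \<open>The two sequences differ by a factor that depends on n only and tends to 1. For large n
  the difference is small relative to the model, whose norm stays bounded; the finitely many other
  components vanish with the amplitude t^(-p-1), as p > -1.\<close>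

lemma free_evol_model_tendsto:
  assumes p: "p > -1" and s: "s > 0"
  defines "\<theta> \<equiv> exp (- \<i> * complex_of_real ((p + 1) * pi / 2))"
  shows "((\<lambda>t. norm2 NN (\<lambda>n. model p s t n - \<theta> * free_evol t (hfun p s) n)) \<longlongrightarrow> 0) at_top"
    "\<And>t. t > 0 \<Longrightarrow> (\<lambda>n. \<theta> * free_evol t (hfun p s) n) \<in> sq_int NN"
proof -
  have G: "Gamma (p + 1) > 0" using p by (intro Gamma_real_pos) auto
  define B where "B = (\<lambda>t n. \<theta> * free_evol t (hfun p s) n)"
  \<comment> \<open>At n = 0 this is 0 for every p, since \<open>0 powr\<close> anything is 0; it
    matches the vanishing of \<open>hfun\<close> at the point 0.\<close>
  define \<rho> where "\<rho> = (\<lambda>n. real n powr (p / 2) / sqrt (Gamma (p + 1) * nbinom p n))"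
  have eq: "model p s t n - B t n = (1 - of_real (\<rho> n)) * model p s t n" if t: "t > 0" for t n
  proof -
    have c: "sqrt (Gamma (p + 1) * nbinom p n) \<noteq> 0" using G nbinom_pos[OF p, of n] by simp
    have r: "complex_of_real (\<rho> n) * (of_real (sqrt (Gamma (p + 1))) * of_real (sqrt (nbinom p n))) = of_real (real n powr (p / 2))"
      unfolding of_real_mult[symmetric] real_sqrt_mult[symmetric] \<rho>_def using c by simp
    have "B t n = of_real (\<rho> n) * model p s t n"
      unfolding B_def free_evol_hfun[OF t] model_def kap_def coh_def \<theta>_def[symmetric] r[symmetric]
      by (simp only: mult_ac)
    then show ?thesis by (simp only: left_diff_distrib mult_1)
  qed
  have lim: "\<rho> \<longlonglongrightarrow> 1" unfolding \<rho>_def by (rule nbinom_asymp[OF p])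
  then obtain R where R: "\<And>n. norm (\<rho> n) \<le> R"
    using convergent_imp_Bseq[OF convergentI[OF lim]] by (metis BseqE)
  have D: "(\<lambda>n. model p s t n - B t n) \<in> sq_int NN" if t: "t > 0" for t
  proof (rule sq_int_dominated(1)[OF model_sq_int[OF p s t]])
    show "cmod (model p s t n - B t n) \<le> (1 + R) * cmod (model p s t n)" for n
    proof -
      have "cmod (1 - of_real (\<rho> n)) \<le> 1 + norm (\<rho> n)"
        using norm_triangle_ineq4[of 1 "complex_of_real (\<rho> n)"] by simp
      then show ?thesis unfolding eq[OF t] norm_mult using R[of n] by (intro mult_right_mono) auto
    qed
  qed simp
  show "(\<lambda>n. \<theta> * free_evol t (hfun p s) n) \<in> sq_int NN" if t: "t > 0" for t
    using sq_int_diff[OF model_sq_int[OF p s t] D[OF t]] by (simp add: B_def)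
  define L where "L = sqrt (Re (cnj (kap p) * kap p * of_real ((2 * s) powr (- (p + 1)))))"
  have mn: "((\<lambda>t. norm2 NN (model p s t)) \<longlongrightarrow> L) at_top"
  proof -
    have "norm2 NN (model p s t) = sqrt (Re (ip NN (model p s t) (model p s t)))" for t
      unfolding ip_self by (simp del: of_real_power)
    then show ?thesis unfolding L_def using model_norm_tendsto[OF p s] by (simp only:) (intro tendsto_real_sqrt tendsto_Re)
  qed
  have "((\<lambda>t. norm2 NN (\<lambda>n. model p s t n - B t n)) \<longlongrightarrow> 0) at_top"
  proof (rule tendstoI)
    fix e :: real assume e: "e > 0"
    have L0: "L \<ge> 0" unfolding L_def by (simp add: mult.commute[of "cnj _"] complex_norm_square[symmetric] del: of_real_power)
    define \<delta> where "\<delta> = e / (2 * (L + 1))"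
    have \<delta>: "\<delta> > 0" using e L0 by (simp add: \<delta>_def)
    obtain N where N: "\<And>n. n \<ge> N \<Longrightarrow> norm (\<rho> n - 1) < \<delta>" using LIMSEQ_D[OF lim \<delta>] by blast
    \<comment> \<open>Bounds the first N components independently of t, once the amplitude is taken
      out and the powers of \<open>wpt\<close> are estimated by 1.\<close>
    define K where "K = (\<Sum>n<N. (cmod (1 - of_real (\<rho> n)) * (cmod (kap p) * sqrt (nbinom p n)))\<^sup>2)"
    have K0: "K \<ge> 0" unfolding K_def by (intro sum_nonneg) simp
    have bound: "norm2 NN (\<lambda>n. model p s t n - B t n) \<le> \<delta> * norm2 NN (model p s t) + t powr (- (p + 1)) * sqrt K"
      if t: "t > 0" for t
    proof -
      define X where "X = (\<lambda>n. model p s t n - B t n)"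
      have X: "X \<in> l2" using D[OF t] by (simp add: X_def l2_eq_sq_int)
      have "cmod (X n - trunc N X n) \<le> \<delta> * cmod (model p s t n)" for n
      proof (cases "n < N")
        case False
        have "cmod (1 - complex_of_real (\<rho> n)) = \<bar>\<rho> n - 1\<bar>"
          by (metis abs_minus_commute norm_of_real of_real_1 of_real_diff)
        then show ?thesis using False N[of n] unfolding X_def trunc_def eq[OF t] norm_mult
          by (simp add: norm_mult mult_right_mono)
      qed (use \<delta> in \<open>simp add: trunc_def\<close>)
      then have 1: "norm2 NN (\<lambda>n. X n - trunc N X n) \<le> \<delta> * norm2 NN (model p s t)"
        using \<delta> by (intro sq_int_dominated(2)[OF model_sq_int[OF p s t]]) auto
      have "(norm2 NN (trunc N X))\<^sup>2 \<le> (t powr (- (p + 1)) * sqrt K)\<^sup>2"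
      proof -
        have "cmod (X n) \<le> t powr (- (p + 1)) * (cmod (1 - of_real (\<rho> n)) * (cmod (kap p) * sqrt (nbinom p n)))" for n
        proof -
          have "cmod (wpt s t) ^ n \<le> 1" using cmod_wpt_less[OF s t] by (intro power_le_one) auto
          moreover have "cmod (X n) = (t powr (- (p + 1)) * (cmod (1 - of_real (\<rho> n)) * (cmod (kap p) * sqrt (nbinom p n)))) * cmod (wpt s t) ^ n"
            unfolding X_def eq[OF t] unfolding model_def coh_def using nbinom_pos[OF p, of n]
            by (simp add: norm_mult norm_power)
          ultimately show ?thesis using nbinom_pos[OF p, of n] by (simp add: mult_left_le)
        qed
        then have "(\<Sum>n<N. (cmod (X n))\<^sup>2) \<le> (\<Sum>n<N. (t powr (- (p + 1)) * (cmod (1 - of_real (\<rho> n)) * (cmod (kap p) * sqrt (nbinom p n))))\<^sup>2)"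
          by (intro sum_mono power_mono) auto
        also have "\<dots> = (t powr (- (p + 1)))\<^sup>2 * K"
          unfolding K_def sum_distrib_left power_mult_distrib[of "t powr _"] ..
        also have "\<dots> = (t powr (- (p + 1)) * sqrt K)\<^sup>2"
          using K0 by (simp only: power_mult_distrib real_sqrt_pow2)
        finally show ?thesis by (simp add: norm2_trunc)
      qed
      then have 2: "norm2 NN (trunc N X) \<le> t powr (- (p + 1)) * sqrt K"
        by (rule power2_le_imp_le) (simp add: K0)
      show ?thesis
        using norm2_le_diff[of X NN "trunc N X"] X trunc_l2[of N X] 1 2 unfolding X_def[symmetric] l2_eq_sq_int by linarith
    qed
    have "((\<lambda>t. \<delta> * norm2 NN (model p s t) + t powr (- (p + 1)) * sqrt K) \<longlongrightarrow> \<delta> * L + 0 * sqrt K) at_top"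
      using p by (intro tendsto_intros mn) real_asymp
    moreover have "\<delta> * L + 0 * sqrt K < e"
    proof -
      have "\<delta> * L = e * (L / (2 * (L + 1)))" by (simp add: \<delta>_def)
      also have "\<dots> < e * 1" using e L0 by (intro mult_strict_left_mono) (simp_all add: divide_less_eq)
      finally show ?thesis by simp
    qed
    ultimately have "\<forall>\<^sub>F t in at_top. \<delta> * norm2 NN (model p s t) + t powr (- (p + 1)) * sqrt K < e"
      by (rule order_tendstoD(2))
    then show "\<forall>\<^sub>F t in at_top. dist (norm2 NN (\<lambda>n. model p s t n - B t n)) 0 < e"
      using eventually_gt_at_top[of "0::real"]
    proof eventually_elim
      case (elim t)
      then show ?case using bound[OF elim(2)] by simp
    qed
  qed
  then show "((\<lambda>t. norm2 NN (\<lambda>n. model p s t n - \<theta> * free_evol t (hfun p s) n)) \<longlongrightarrow> 0) at_top"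
    by (simp add: B_def)
qed

section \<open>Long-time asymptotics\<close>

lemma hfun_asymptotics_at_top:
  assumes p: "p > -1" and s: "s > 0"
  shows "((\<lambda>t. norm2 NN (\<lambda>n. evol p s t n - exp (- \<i> * complex_of_real ((p + 1) * pi / 2)) * free_evol t (hfun p s) n)) \<longlongrightarrow> 0) at_top"
  (is "((\<lambda>t. norm2 NN (\<lambda>n. evol p s t n - ?\<theta> * free_evol t (hfun p s) n)) \<longlongrightarrow> 0) at_top")
proof (rule tendsto_sandwich[OF _ _ tendsto_const])
  note fm = free_evol_model_tendsto[OF p s]
  show "((\<lambda>t. norm2 NN (\<lambda>n. evol p s t n - model p s t n)
      + norm2 NN (\<lambda>n. model p s t n - ?\<theta> * free_evol t (hfun p s) n)) \<longlongrightarrow> 0) at_top"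
    using tendsto_add[OF evol_model_tendsto[OF p s] fm(1)] by simp
  show "\<forall>\<^sub>F t in at_top. norm2 NN (\<lambda>n. evol p s t n - ?\<theta> * free_evol t (hfun p s) n)
      \<le> norm2 NN (\<lambda>n. evol p s t n - model p s t n)
      + norm2 NN (\<lambda>n. model p s t n - ?\<theta> * free_evol t (hfun p s) n)"
    using eventually_gt_at_top[of "0::real"]
  proof eventually_elim
    case (elim t)
    have e: "evol p s t \<in> sq_int NN" using evol_l2[OF p s] by (simp add: l2_eq_sq_int)
    show ?case by (rule norm2_triangle_diff[OF e model_sq_int[OF p s elim] fm(2)[OF elim]])
  qed
qed simp

lemma evol_minus:
  assumes s: "s > 0" shows "evol p s (- t) n = cnj (evol p s t n)"
proof -
  have w: "wfun s (- t) = cnj (wfun s t)" by (simp add: wfun_def)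
  have "cnj (wfun s t powr (- of_real (p + 1))) = cnj (wfun s t) powr (- of_real (p + 1))"
    using wfun_props(3)[OF s, of t] by (subst cnj_powr) auto
  then show ?thesis by (simp add: evol_def coh_def w)
qed

lemma free_evol_minus_hfun: "free_evol (- t) (hfun p s) n = cnj (free_evol t (hfun p s) n)"
  by (simp add: free_evol_def hfun_def exp_cnj)

lemma norm2_cnj: "norm2 M (\<lambda>n. cnj (f n)) = norm2 M f"
  by (simp add: norm2_def)

text \<open>Time reversal: \<open>hfun\<close> and the Jacobi matrix are real, so changing the sign
  of t conjugates both evolutions, and the phase is conjugated with them.\<close>

lemma hfun_asymptotics_at_bot:
  assumes p: "p > -1" and s: "s > 0"
  shows "((\<lambda>t. norm2 NN (\<lambda>n. evol p s t n - exp (\<i> * complex_of_real ((p + 1) * pi / 2)) * free_evol t (hfun p s) n)) \<longlongrightarrow> 0) at_bot"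
  (is "((\<lambda>t. norm2 NN (\<lambda>n. evol p s t n - ?\<theta> * free_evol t (hfun p s) n)) \<longlongrightarrow> 0) at_bot")
proof -
  have c: "cnj ?\<theta> = exp (- \<i> * complex_of_real ((p + 1) * pi / 2))" by (simp add: exp_cnj)
  have "norm2 NN (\<lambda>n. evol p s (- t) n - ?\<theta> * free_evol (- t) (hfun p s) n)
    = norm2 NN (\<lambda>n. evol p s t n - cnj ?\<theta> * free_evol t (hfun p s) n)" for t
  proof -
    have "(\<lambda>n. evol p s (- t) n - ?\<theta> * free_evol (- t) (hfun p s) n)
      = (\<lambda>n. cnj (evol p s t n - cnj ?\<theta> * free_evol t (hfun p s) n))"
      unfolding evol_minus[OF s] free_evol_minus_hfun by simp
    then show ?thesis by (simp only: norm2_cnj)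
  qed
  then show ?thesis
    using hfun_asymptotics_at_top[OF p s, folded c] unfolding at_bot_mirror filterlim_filtermap by simp
qed

lemma coef_sum:
  assumes "p > -1" "\<And>i. i \<in> I \<Longrightarrow> F i \<in> sq_int PP"
  shows "coef p (\<lambda>x. \<Sum>i\<in>I. c i * F i x) n = (\<Sum>i\<in>I. c i * coef p (F i) n)"
  unfolding coef_def using assms
  by (subst ip_sum_right) (auto simp: sq_int_lag sq_int_scale ip_scale_right)

lemma free_evol_sum: "free_evol t (\<lambda>x. \<Sum>i\<in>I. c i * F i x) n = (\<Sum>i\<in>I. c i * free_evol t (F i) n)"
  by (simp only: free_evol_def sum_distrib_left mult_ac)

lemma cmod_free_evol: "cmod (free_evol t G n) = cmod (G (real n / t\<^sup>2)) / \<bar>t\<bar>"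
proof -
  have "cmod (exp (\<i> * of_real (real n / t))) = 1" by (rule norm_exp_i_times)
  then show ?thesis by (simp add: free_evol_def norm_mult norm_power norm_divide)
qed

text \<open>Both \<open>exp (- i J t)\<close> and \<open>U(t)\<close> are bounded in the weighted sup norm in which the span of the
  \<open>hfun\<close>s is dense, so the asymptotics extends from there.\<close>
lemma asymptotics_by_density:
  fixes g :: "real \<Rightarrow> complex"
  assumes p: "p > -1" and g: "g \<in> sq_int PP" "g 0 = 0"
    and app: "\<And>\<epsilon>. \<epsilon> > 0 \<Longrightarrow> \<exists>c N. \<forall>x>0. cmod (g x - (\<Sum>j\<le>N. c j * hfun p (1/4 + real j) x))
            \<le> \<epsilon> * (x powr (p / 2) * exp (- x / 4))"
    and lim: "\<And>s. s > 0 \<Longrightarrow> ((\<lambda>t. norm2 NN (\<lambda>n. evol p s t n - \<theta> * free_evol t (hfun p s) n)) \<longlongrightarrow> 0) F"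
    and mem: "\<And>s. s > 0 \<Longrightarrow> \<forall>\<^sub>F t in F. (\<lambda>n. \<theta> * free_evol t (hfun p s) n) \<in> sq_int NN"
    and nz: "\<forall>\<^sub>F t in F. t \<noteq> 0"
  shows "((\<lambda>t. l2_norm (\<lambda>n. evo p t (coef p g) n - \<theta> * free_evol t g n)) \<longlongrightarrow> 0) F"
proof (rule tendstoI)
  fix e :: real assume e: "e > 0"
  define H where "H = norm2 PP (hfun p (1/4))"
  have H: "H \<ge> 0" by (simp add: H_def)
  \<comment> \<open>Chosen so that the approximation errors of the exact evolution, at most
    \<epsilon> H, and of the free one, at most \<epsilon> (H + 1), add up to e/2.\<close>
  define \<epsilon> where "\<epsilon> = e / (2 * (2 * H + 1))"
  have \<epsilon>: "\<epsilon> > 0" using e H by (simp add: \<epsilon>_def)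
  have \<epsilon>H: "\<epsilon> * (2 * H + 1) = e / 2" using H by (simp add: \<epsilon>_def field_simps)
  from app[OF \<epsilon>] obtain c N where cN: "\<And>x. x > 0 \<Longrightarrow>
      cmod (g x - (\<Sum>j\<le>N. c j * hfun p (1/4 + real j) x)) \<le> \<epsilon> * (x powr (p / 2) * exp (- x / 4))" by blast
  define s where "s = (\<lambda>j::nat. 1/4 + real j)"
  have s: "s j > 0" for j by (simp add: s_def)
  define h where "h = (\<lambda>x. \<Sum>j\<le>N. c j * hfun p (s j) x)"
  have hx: "expands p h" unfolding h_def by (intro expands_sum expands_scale hfun_expands p s)
  then have hs: "h \<in> sq_int PP" by (simp add: expands_def)
  have gh: "(\<lambda>x. g x - h x) \<in> sq_int PP" by (rule sq_int_diff[OF g(1) hs])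
  have gh_le: "norm2 PP (\<lambda>x. g x - h x) \<le> \<epsilon> * H"
    unfolding H_def
  proof (rule sq_int_dominated(2)[OF sq_int_hfun(1)[OF p] sq_int_measurable[OF gh]])
    show "cmod (g x - h x) \<le> \<epsilon> * cmod (hfun p (1/4) x)" if "x \<in> space PP" for x
      using cN[of x] that by (simp add: h_def s_def cmod_hfun)
  qed (use \<epsilon> in auto)
  define S where "S = (\<lambda>t. \<Sum>j\<le>N. cmod (c j) * norm2 NN (\<lambda>n. evol p (s j) t n - \<theta> * free_evol t (hfun p (s j)) n))"
  have "(S \<longlongrightarrow> (\<Sum>j\<le>N. cmod (c j) * 0)) F"
    unfolding S_def by (intro tendsto_sum tendsto_mult_left lim s)
  then have S: "\<forall>\<^sub>F t in F. S t < e / 2"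
    using e by (intro order_tendstoD(2)) auto
  \<comment> \<open>This controls the free evolution of the weight: it comes within distance 1 of
    the exact evolution, whose norm is at most H.\<close>
  have Q: "\<forall>\<^sub>F t in F. norm2 NN (\<lambda>n. evol p (1/4) t n - \<theta> * free_evol t (hfun p (1/4)) n) < 1"
    by (rule order_tendstoD(2)[OF lim]) auto
  have m: "\<forall>\<^sub>F t in F. \<forall>j\<in>{..N}. (\<lambda>n. \<theta> * free_evol t (hfun p (s j)) n) \<in> sq_int NN"
    by (intro eventually_ball_finite ballI mem s) simp
  have m4: "\<forall>\<^sub>F t in F. (\<lambda>n. \<theta> * free_evol t (hfun p (1/4)) n) \<in> sq_int NN" by (rule mem) simp
  show "\<forall>\<^sub>F t in F. dist (l2_norm (\<lambda>n. evo p t (coef p g) n - \<theta> * free_evol t g n)) 0 < e"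
    using S Q m m4 nz
  proof eventually_elim
    case (elim t)
    have ev: "evol p r t \<in> sq_int NN" if "r > 0" for r using evol_l2[OF p that] by (simp add: l2_eq_sq_int)
    \<comment> \<open>\<open>P\<close> is the approximation error under the exact evolution,
      \<open>R\<close> the asymptotic error of the approximant, and \<open>T\<close> the
      approximation error under the free evolution.\<close>
    define P where "P = evo p t (\<lambda>n. coef p g n - coef p h n)"
    define R where "R = (\<lambda>n. \<Sum>j\<le>N. c j * (evol p (s j) t n - \<theta> * free_evol t (hfun p (s j)) n))"
    define T where "T = (\<lambda>n. \<theta> * free_evol t h n - \<theta> * free_evol t g n)"
    have cgh: "(\<lambda>n. coef p g n - coef p h n) = coef p (\<lambda>x. g x - h x)"
      by (rule ext) (rule coef_diff[OF p g(1) hs, symmetric])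
    note cl = bessel[OF p g(1)] bessel[OF p hs] bessel[OF p gh]
    have P: "P \<in> sq_int NN" "norm2 NN P \<le> \<epsilon> * H"
      unfolding P_def cgh using evo_contraction[OF p cl(5), of t] cl(6) gh_le by (auto simp: l2_eq_sq_int)
    have D: "(\<lambda>n. evol p (s j) t n - \<theta> * free_evol t (hfun p (s j)) n) \<in> sq_int NN" if "j \<le> N" for j
      using elim(3) that by (intro sq_int_diff ev s) auto
    have R: "R \<in> sq_int NN" unfolding R_def by (intro sq_int_sum sq_int_scale D) simp
    have R_le: "norm2 NN R \<le> S t"
    proof -
      have "norm2 NN (\<lambda>n. \<Sum>j\<le>M. c j * (evol p (s j) t n - \<theta> * free_evol t (hfun p (s j)) n))
        \<le> (\<Sum>j\<le>M. cmod (c j) * norm2 NN (\<lambda>n. evol p (s j) t n - \<theta> * free_evol t (hfun p (s j)) n))" if "M \<le> N" for M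
        using that
      proof (induction M)
        case (Suc M)
        have a: "(\<lambda>n. \<Sum>j\<le>M. c j * (evol p (s j) t n - \<theta> * free_evol t (hfun p (s j)) n)) \<in> sq_int NN"
          using Suc.prems by (intro sq_int_sum sq_int_scale D) simp
        show ?case
          using norm2_triangle[OF a sq_int_scale[OF D[OF Suc.prems], of "c (Suc M)"]] Suc
          by (simp add: norm2_scale)
      qed (simp add: norm2_scale)
      then show ?thesis by (simp add: R_def S_def)
    qed
    have Tb: "cmod (T n) \<le> \<epsilon> * cmod (\<theta> * free_evol t (hfun p (1/4)) n)" for n
    proof -
      have d: "cmod (h (real n / t\<^sup>2) - g (real n / t\<^sup>2)) \<le> \<epsilon> * cmod (hfun p (1/4) (real n / t\<^sup>2))"
      proof (cases "n = 0")
        \<comment> \<open>The weighted bound holds only for positive arguments. At 0 the left side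
          vanishes: g does by hypothesis, and each \<open>hfun\<close> because of
          \<open>0 powr\<close>.\<close>
        case True
        then show ?thesis using g(2) by (simp add: h_def hfun_def)
      next
        case False
        define y where "y = real n / t\<^sup>2"
        have "y > 0" using elim(5) False by (simp add: y_def)
        from cN[OF this] show ?thesis
          unfolding y_def[symmetric] by (simp add: h_def s_def cmod_hfun norm_minus_commute)
      qed
      have "T n = \<theta> * free_evol t (\<lambda>x. h x - g x) n" by (simp add: T_def free_evol_def algebra_simps)
      then have "cmod (T n) = cmod \<theta> * (cmod (h (real n / t\<^sup>2) - g (real n / t\<^sup>2)) / \<bar>t\<bar>)"
        by (simp only: norm_mult cmod_free_evol)
      also have "\<dots> \<le> cmod \<theta> * (\<epsilon> * cmod (hfun p (1/4) (real n / t\<^sup>2)) / \<bar>t\<bar>)"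
        by (intro mult_left_mono divide_right_mono d) auto
      also have "\<dots> = \<epsilon> * cmod (\<theta> * free_evol t (hfun p (1/4)) n)"
        by (simp only: norm_mult cmod_free_evol) simp
      finally show ?thesis .
    qed
    have T: "T \<in> sq_int NN" by (rule sq_int_dominated(1)[OF elim(4) _ Tb]) simp
    have "norm2 NN T \<le> \<epsilon> * norm2 NN (\<lambda>n. \<theta> * free_evol t (hfun p (1/4)) n)"
      by (rule sq_int_dominated(2)[OF elim(4) _ Tb]) (use \<epsilon> in auto)
    also have "\<dots> \<le> \<epsilon> * (H + 1)"
    proof -
      have "evol p (1/4) t = coef p (modul t (hfun p (1/4)))"
        by (rule ext) (rule coef_modul_hfun[OF p, symmetric], simp)
      then have "norm2 NN (evol p (1/4) t) \<le> H"
        using bessel(2)[OF p sq_int_modul[OF sq_int_hfun(1)[OF p, of "1/4"]], of t] by (simp add: H_def)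
      moreover have "norm2 NN (\<lambda>n. \<theta> * free_evol t (hfun p (1/4)) n) \<le> norm2 NN (evol p (1/4) t)
          + norm2 NN (\<lambda>n. \<theta> * free_evol t (hfun p (1/4)) n - evol p (1/4) t n)"
        by (rule norm2_le_diff[OF elim(4) ev]) simp
      moreover have "norm2 NN (\<lambda>n. \<theta> * free_evol t (hfun p (1/4)) n - evol p (1/4) t n)
          = norm2 NN (\<lambda>n. evol p (1/4) t n - \<theta> * free_evol t (hfun p (1/4)) n)" by (rule norm2_minus_commute)
      ultimately show ?thesis using elim(2) \<epsilon> by (intro mult_left_mono) auto
    qed
    finally have T_le: "norm2 NN T \<le> \<epsilon> * (H + 1)" .
    have dec: "(\<lambda>n. evo p t (coef p g) n - \<theta> * free_evol t g n) = (\<lambda>n. P n + (R n + T n))"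
    proof
      fix n
      have "modul t h = (\<lambda>x. \<Sum>j\<le>N. c j * modul t (hfun p (s j)) x)"
        by (simp add: modul_def h_def sum_distrib_left mult_ac fun_eq_iff)
      then have "evo p t (coef p h) n = (\<Sum>j\<le>N. c j * evol p (s j) t n)"
        unfolding evo_coef[OF p hx]
        by (simp add: coef_sum[OF p] sq_int_modul sq_int_hfun(1)[OF p s] coef_modul_hfun[OF p s])
      moreover have "free_evol t h n = (\<Sum>j\<le>N. c j * free_evol t (hfun p (s j)) n)"
        unfolding h_def by (rule free_evol_sum)
      ultimately have "R n = evo p t (coef p h) n - \<theta> * free_evol t h n"
        by (simp add: R_def right_diff_distrib sum_subtractf sum_distrib_left mult_ac)
      moreover have "P n = evo p t (coef p g) n - evo p t (coef p h) n"
        unfolding P_def by (rule evo_diff[OF p cl(1,3)])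
      ultimately show "evo p t (coef p g) n - \<theta> * free_evol t g n = P n + (R n + T n)"
        by (simp add: T_def)
    qed
    have "(\<lambda>n. P n + (R n + T n)) \<in> l2" unfolding l2_eq_sq_int by (intro sq_int_add P R T)
    then have eq: "l2_norm (\<lambda>n. evo p t (coef p g) n - \<theta> * free_evol t g n) = norm2 NN (\<lambda>n. P n + (R n + T n))"
      unfolding dec by (rule l2_norm_eq)
    have "norm2 NN (\<lambda>n. P n + (R n + T n)) \<le> norm2 NN P + (norm2 NN R + norm2 NN T)"
      using norm2_triangle[OF P(1) sq_int_add[OF R T]] norm2_triangle[OF R T] by linarith
    also have "\<dots> \<le> \<epsilon> * H + (S t + \<epsilon> * (H + 1))" using P(2) R_le T_le by linarith
    also have "\<dots> = e / 2 + S t" using \<epsilon>H by (simp add: algebra_simps)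
    also have "\<dots> < e" using elim(1) by simp
    finally show ?case unfolding eq by simp
  qed
qed

section \<open>Passage from the Laguerre transform and test functions to coefficients and
  approximations\<close>

lemma laguerre_transform_fin_trunc: "laguerre_transform_fin p (trunc k f) = syn p k f"
proof
  fix x
  have "(\<Sum>n | trunc k f n \<noteq> 0. of_real (laguerre_fun p n x) * trunc k f n) = (\<Sum>n<k. f n * lag p n x)"
    by (rule sum.mono_neutral_cong_left) (auto simp: trunc_def lag_def split: if_splits)
  then show "laguerre_transform_fin p (trunc k f) x = syn p k f x"
    by (simp add: laguerre_transform_fin_def syn_def)
qed

text \<open>The definition of the transform is tested on the truncations of \<open>f\<close>:
  coefficients depend continuously on the function in L2, and the n-th one of the k-th partial sum
  is \<open>f n\<close> as soon as k > n.\<close>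

lemma laguerre_transform_coef:
  assumes p: "p > -1" and tr: "is_laguerre_transform p f g"
  shows "g \<in> sq_int PP" "coef p g = f"
proof -
  have f: "f \<in> l2" and g: "g \<in> sq_int PP" using tr by (auto simp: is_laguerre_transform_def L2_pos_eq_sq_int)
  show "g \<in> sq_int PP" by (rule g)
  have "(\<lambda>k. l2_dist (trunc k f) f) \<longlonglongrightarrow> 0"
    using trunc_tendsto[OF f] by (simp add: l2_dist_eq[OF trunc_l2 f] norm2_minus_commute[of NN "trunc _ f"])
  then have "(\<lambda>k. L2_pos_dist (laguerre_transform_fin p (trunc k f)) g) \<longlonglongrightarrow> 0"
    using tr[unfolded is_laguerre_transform_def, THEN conjunct2, THEN conjunct2, THEN spec[of _ "\<lambda>k. trunc k f"]]
      trunc_finite_seqs by blast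
  then have lim: "(\<lambda>k. norm2 PP (\<lambda>x. syn p k f x - g x)) \<longlonglongrightarrow> 0"
    by (simp add: L2_pos_dist_eq laguerre_transform_fin_trunc)
  show "coef p g = f"
  proof
    fix n
    have "(\<lambda>k. coef p (\<lambda>x. syn p k f x - g x) n) \<longlonglongrightarrow> 0"
    proof (rule Lim_null_comparison[OF _ lim], intro always_eventually allI)
      fix k
      note b = bessel[OF p sq_int_diff[OF sq_int_syn[OF p] g], of k f]
      show "norm (coef p (\<lambda>x. syn p k f x - g x) n) \<le> norm2 PP (\<lambda>x. syn p k f x - g x)"
        using cmod_le_norm2_NN[OF b(1), of n] b(2) by linarith
    qed
    moreover have "\<forall>\<^sub>F k in sequentially. coef p (\<lambda>x. syn p k f x - g x) n = f n - coef p g n"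
      using eventually_gt_at_top[of n]
      by eventually_elim (simp add: coef_diff[OF p sq_int_syn[OF p] g] coef_syn[OF p])
    ultimately have "(\<lambda>k::nat. f n - coef p g n) \<longlonglongrightarrow> 0" using Lim_transform_eventually by fastforce
    then show "coef p g n = f n" by (simp add: LIMSEQ_const_iff)
  qed
qed

lemma test_fun_approx:
  assumes g: "test_fun_pos g"
  shows "g 0 = 0"
    "\<epsilon> > 0 \<Longrightarrow> \<exists>c N. \<forall>x>0. cmod (g x - (\<Sum>j\<le>N. c j * hfun p (1/4 + real j) x)) \<le> \<epsilon> * (x powr (p / 2) * exp (- x / 4))"
proof -
  obtain D K where D: "D 0 = g" "\<And>k x. (D k has_vector_derivative D (Suc k) x) (at x)"
    and K: "compact K" "K \<subseteq> {0<..}" "\<And>x. x \<notin> K \<Longrightarrow> g x = 0"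
    using g unfolding test_fun_pos_def by blast
  show "g 0 = 0" using K by auto
  have cont: "continuous_on A g" for A
    using D(2)[of 0] unfolding D(1) by (intro continuous_at_imp_continuous_on ballI) (rule has_vector_derivative_continuous)
  obtain a where a: "a > 0" "\<And>x. x < a \<Longrightarrow> g x = 0"
  proof (cases "K = {}")
    case True then show ?thesis using that[of 1] K(3) by auto
  next
    case False
    then obtain a where "a \<in> K" "\<forall>x\<in>K. a \<le> x" using compact_attains_inf[OF K(1)] by blast
    then show ?thesis using that[of a] K(2,3) by force
  qed
  obtain b where b: "\<And>x. x > b \<Longrightarrow> g x = 0"
  proof (cases "K = {}")
    case True then show ?thesis using that[of 1] K(3) by auto
  next
    case False
    then obtain b where "b \<in> K" "\<forall>x\<in>K. x \<le> b" using compact_attains_sup[OF K(1)] by blast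
    then show ?thesis using that[of b] K(3) by force
  qed
  define Q where "Q = (\<lambda>x. g x * of_real (x powr (- p / 2) * exp (x / 4)))"
  \<comment> \<open>The power x^(-p/2) may be singular at 0, but \<open>g\<close> vanishes to the
    left of \<open>a\<close>; \<open>Q\<close> is glued from two overlapping open sets.\<close>
  have "continuous_on ({..<a} \<union> {0<..}) Q"
  proof (rule continuous_on_open_Un)
    have "continuous_on {..<a} (\<lambda>x::real. 0::complex)" by simp
    then show "continuous_on {..<a} Q"
      by (rule continuous_on_cong[THEN iffD1, rotated -1]) (auto simp: Q_def a)
    show "continuous_on {0<..} Q" unfolding Q_def by (intro continuous_intros cont) auto
  qed auto
  then have Qc: "continuous_on {0..} Q" by (rule continuous_on_subset) (use a(1) in auto)
  have Ql: "(Q \<longlongrightarrow> 0) at_top"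
    by (rule tendsto_eventually, rule eventually_mono[OF eventually_gt_at_top[of b]]) (simp add: Q_def b)
  have gQ: "of_real (x powr (p / 2) * exp (- x / 4)) * Q x = g x" if "x > 0" for x
  proof -
    have "x powr (p / 2) * exp (- x / 4) * (x powr (- p / 2) * exp (x / 4)) = 1"
    proof -
      have "x powr (p / 2) * x powr (- p / 2) = 1" "exp (- x / 4) * exp (x / 4) = 1"
        using that by (simp_all add: powr_add[symmetric] exp_add[symmetric])
      then show ?thesis by (metis mult.assoc mult.left_commute mult_1_right)
    qed
    then have "complex_of_real (x powr (p / 2) * exp (- x / 4)) * of_real (x powr (- p / 2) * exp (x / 4)) = 1"
      by (simp only: of_real_mult[symmetric] of_real_1)
    then show ?thesis unfolding Q_def by (metis mult.left_commute mult_1_right)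
  qed
  show "\<exists>c N. \<forall>x>0. cmod (g x - (\<Sum>j\<le>N. c j * hfun p (1/4 + real j) x)) \<le> \<epsilon> * (x powr (p / 2) * exp (- x / 4))"
    if "\<epsilon> > 0"
    using hfun_approx[OF Qc Ql that, of p] by (simp only: gQ cong: imp_cong)
qed

theorem theorem4p5:
  fixes p :: real and f :: "nat \<Rightarrow> complex" and g :: "real \<Rightarrow> complex"
  assumes "p > -1"
    and "f \<in> l2"
    and "is_laguerre_transform p f g"
    and "test_fun_pos g"
  shows "((\<lambda>t. l2_norm (\<lambda>n. exp_minus_i (laguerre_op p) t f n
             - exp (- \<i> * of_real ((p + 1) * pi / 2)) * free_evol t g n)) \<longlongrightarrow> 0) at_top
       \<and> ((\<lambda>t. l2_norm (\<lambda>n. exp_minus_i (laguerre_op p) t f n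
             - exp (\<i> * of_real ((p + 1) * pi / 2)) * free_evol t g n)) \<longlongrightarrow> 0) at_bot"
proof
  note p = assms(1)
  note g = laguerre_transform_coef[OF p assms(3)] and tf = test_fun_approx[OF assms(4)]
  note E = exp_minus_i_laguerre_op[OF p assms(2)]
  show "((\<lambda>t. l2_norm (\<lambda>n. exp_minus_i (laguerre_op p) t f n
             - exp (- \<i> * of_real ((p + 1) * pi / 2)) * free_evol t g n)) \<longlongrightarrow> 0) at_top"
    unfolding E unfolding g(2)[symmetric]
  proof (rule asymptotics_by_density[OF p g(1) tf hfun_asymptotics_at_top[OF p]])
    fix s :: real assume s: "s > 0"
    show "\<forall>\<^sub>F t in at_top. (\<lambda>n. exp (- \<i> * of_real ((p + 1) * pi / 2)) * free_evol t (hfun p s) n) \<in> sq_int NN"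
      using eventually_gt_at_top[of 0] by eventually_elim (rule free_evol_model_tendsto(2)[OF p s])
  qed (auto intro: eventually_gt_at_top[THEN eventually_mono])
  show "((\<lambda>t. l2_norm (\<lambda>n. exp_minus_i (laguerre_op p) t f n
             - exp (\<i> * of_real ((p + 1) * pi / 2)) * free_evol t g n)) \<longlongrightarrow> 0) at_bot"
    unfolding E unfolding g(2)[symmetric]
  proof (rule asymptotics_by_density[OF p g(1) tf hfun_asymptotics_at_bot[OF p]])
    fix s :: real assume s: "s > 0"
    show "\<forall>\<^sub>F t in at_bot. (\<lambda>n. exp (\<i> * of_real ((p + 1) * pi / 2)) * free_evol t (hfun p s) n) \<in> sq_int NN"
      using eventually_gt_at_bot[of 0]
    proof eventually_elim
      case (elim t)
      have "cmod (free_evol t (hfun p s) n) = cmod (free_evol (- t) (hfun p s) n)" for n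
        by (simp add: free_evol_minus_hfun)
      then show ?case
        using free_evol_model_tendsto(2)[OF p s, of "- t"] elim by (simp add: sq_int_def norm_mult)
    qed
  qed (auto intro: eventually_gt_at_bot[THEN eventually_mono])
qed

end
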